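(* Let $\Omega\subseteq\mathbb{R}^n$ be a bounded domain with Lipschitz continuous boundary, let $\sigma>n/2+1$ and let $\Phi:\Omega\times\Omega\to\mathcal{L}(\mathbb{S}^{n\times n})$ be a reproducing kernel of $H^\sigma(\Omega;\mathbb{S}^{n\times n})$. Let $f\in C^1(\mathbb{R}^n,\mathbb{R}^n)$ be such that $f\in H^{\sigma-1}(\Omega;\mathbb{R}^n)$, $Df\in H^{\sigma-1}(\Omega;\mathbb{R}^{n\times n})$, and such that for each $x_0\in\Omega$ with $f(x_0)=0$ all eigenvalues of $Df(x_0)$ have negative real part (or, alternatively, for each such $x_0$ all eigenvalues of $Df(x_0)$ have positive real part). Let $X=\{x_1,\ldots,x_N\}\subseteq\Omega$ be pairwise distinct points and let $\lambda_k^{(i,j)}\in H^\sigma(\Omega;\mathbb{S}^{n\times n})^*$ be defined by \[ \lambda_k^{(i,j)}(M)=e_i^TF_k(M)e_j,\qquad F_k(M):=Df^T(x_k)M(x_k)+M(x_k)Df(x_k)+\nabla M(x_k)\cdot f(x_k). \] Let $C=(C_{ij})_{i,j=1,\dots,n}$ be a symmetric, positive definite matrix. Then there is a unique function $S\in H^\sigma(\Omega;\mathbb{S}^{n\times n})$ solving \[ \min\left\{\|M\|_{H^\sigma(\Omega;\mathbb{S}^{n\times n})}:\ \lambda_k^{(i,j)}(M)=-C_{ij},\ 1\le i\le j\le n,\ 1\le k\le N\right\}. \] It has the form \begin{align*} S(x)&=\sum_{k=1}^N\sum_{1\le i\le j\le n}\gamma_k^{(i,j)}\sum_{1\le\mu\le\nu\le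 n}\lambda_k^{(i,j)}(\Phi(\cdot,x)E^s_{\mu\nu})E^s_{\mu\nu}\\ &=\sum_{k=1}^N\sum_{1\le i\le j\le n}\gamma_k^{(i,j)}\Bigg[\sum_{\mu=1}^nF_k(\Phi(\cdot,x)_{\cdot,\cdot,\mu,\mu})_{ij}E_{\mu\mu}\\ &\qquad+\frac12\sum_{\substack{\mu,\nu=1\\ \mu\ne\nu}}^n\left[F_k(\Phi(\cdot,x)_{\cdot,\cdot,\mu,\nu})_{ij}+F_k(\Phi(\cdot,x)_{\cdot,\cdot,\nu,\mu})_{ij}\right]E_{\mu\nu}\Bigg], \end{align*} where the coefficients $\gamma_k=(\gamma_k^{(i,j)})_{1\le i\le j\le n}$ are determined by $\lambda_\ell^{(i,j)}(S)=-C_{ij}$ for $1\le i\le j\le n$, $1\le \ell\le N$. If the kernel $\Phi$ is given by $\Phi(x,y)_{ijk\ell}=\phi(x,y)\delta_{ik}\delta_{j\ell}$ with a reproducing kernel $\phi:\Omega\times\Omega\to\mathbb{R}$ of $H^\sigma(\Omega)$, then also \[ S(x)=\sum_{k=1}^N\sum_{i,j=1}^n\beta_k^{(i,j)}\sum_{\mu,\nu=1}^nF_k(\Phi(\cdot,x)_{\cdot,\cdot,\mu,\nu})_{ij}E_{\mu\nu}, \] where the symmetric matrices $\beta_k\in\mathbb{S}^{n\times n}$ are defined by $\beta_k^{(j,i)}=\beta_k^{(i,j)}=\frac12\gamma_k^{(i,j)}$ for $i<j$ and $\beta_k^{(i,i)}=\gamma_k^{(i,i)}$.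
   Context: $\mathbb{S}^{n\times n}$ is the space of symmetric real $n\times n$ matrices with inner product $\langle\alpha,\beta\rangle=\sum_{i,j}\alpha_{ij}\beta_{ij}$; $\mathcal{L}(W)$ is the space of bounded linear operators on $W$; $e_i$ is the $i$-th standard unit vector of $\mathbb{R}^n$. $\nabla M(x)\cdot f(x)$ denotes the $n\times n$ matrix with entries $\nabla M_{ij}(x)^Tf(x)$. $H^\sigma(\Omega)$ is the $L_2$-based Sobolev space of (possibly non-integer) order $\sigma$ (elements identified with continuous representatives), and $H^\sigma(\Omega;\mathbb{S}^{n\times n})$ is the space of symmetric-matrix-valued functions with every component in $H^\sigma(\Omega)$; its inner product $\langle M,S\rangle=\sum_{i,j}\langle M_{ij},S_{ij}\rangle_{H^\sigma(\Omega)}$ may be replaced by an equivalent one, and the norm being minimised is the one for which $\Phi$ is the reproducing kernel. A Hilbert space $\mathcal{H}$ of functions $\Omega\to W$ ($W$ a real Hilbert space) has reproducing kernel $\Phi:\Omega\times\Omega\to\mathcal{L}(W)$ if $\Phi(\cdot,x)\alpha\in\mathcal{H}$ and $\langle g(x),\alpha\rangle_W=\langle g,\Phi(\cdot,x)\alpha\rangle_{\mathcal{H}}$ for all $g\in\mathcal{H}$, $x\in\Omega$, $\alpha\in W$. For matrix-valued functions $\Phi$ is represented by a tensor of order 4 via $(\Phi(x,y)\alpha)_{ij}=\sum_{k,\ell=1}^n\Phi(x,y)_{ijk\ell}\alpha_{k\ell}$. $\Phi(\cdot,x)_{\cdot,\cdot,\mu,\nu}$ denotes the matrix-valued function with $(i,j)$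 entry $\Phi(\cdot,x)_{ij\mu\nu}$; $F_k$ is applied to it (in the variable marked by the dot) by the formula $F_k(M)=Df^T(x_k)M(x_k)+M(x_k)Df(x_k)+\nabla M(x_k)\cdot f(x_k)$ with $M=\Phi(\cdot,x)_{\cdot,\cdot,\mu,\nu}$, even if this $M$ is not symmetric. $E_{\mu\nu}$ is the $n\times n$ matrix with entry $1$ at position $(\mu,\nu)$ and $0$ elsewhere; $E^s_{\mu\mu}=E_{\mu\mu}$ and $E^s_{\mu\nu}=\frac1{\sqrt2}(E_{\mu\nu}+E_{\nu\mu})$ for $\mu<\nu$. *)

theory Defs
  imports "HOL-Analysis.Analysis"
begin

section \<open>Domains with Lipschitz continuous boundary\<close>

text \<open>
  Near every boundary point the domain is, in suitable orthogonal coordinates with vertical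
  direction \<open>e\<close>, the strict epigraph of a Lipschitz function on the hyperplane orthogonal to \<open>e\<close>.
\<close>

definition lipschitz_boundary :: "'a::euclidean_space set \<Rightarrow> bool" where
  "lipschitz_boundary \<Omega> \<longleftrightarrow>
     (\<forall>p\<in>frontier \<Omega>. \<exists>r>0. \<exists>e. norm e = 1 \<and> (\<exists>L g. L-lipschitz_on {y. y \<bullet> e = 0} g \<and>
        \<Omega> \<inter> ball p r = {x \<in> ball p r. g (x - (x \<bullet> e) *\<^sub>R e) < x \<bullet> e}))"

definition bounded_lipschitz_domain :: "'a::euclidean_space set \<Rightarrow> bool" where
  "bounded_lipschitz_domain \<Omega> \<longleftrightarrow>
     open \<Omega> \<and> connected \<Omega> \<and> \<Omega> \<noteq> {} \<and> bounded \<Omega> \<and> lipschitz_boundary \<Omega>"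


section \<open>Sobolev spaces of real order\<close>

definition square_integrable :: "(real^'n \<Rightarrow> complex) \<Rightarrow> bool" where
  "square_integrable u \<longleftrightarrow>
     u \<in> borel_measurable lborel \<and> integrable lborel (\<lambda>x. (norm (u x))\<^sup>2)"

definition truncated_fourier :: "real \<Rightarrow> (real^'n \<Rightarrow> complex) \<Rightarrow> real^'n \<Rightarrow> complex" where
  "truncated_fourier R u \<xi> = complex_of_real ((2 * pi) powr (- real CARD('n) / 2)) *
     (LINT x:cball 0 R|lborel. cis (- (x \<bullet> \<xi>)) * u x)"

text \<open>
  \<open>h\<close> is the (Plancherel) Fourier transform of the square integrable function \<open>u\<close>: the limit in
  \<open>L\<^sub>2\<close> of the Fourier integrals over balls of growing radius.
\<close>

definition is_fourier_transform :: "(real^'n \<Rightarrow> complex) \<Rightarrow> (real^'n \<Rightarrow> complex) \<Rightarrow> bool" where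
  "is_fourier_transform u h \<longleftrightarrow> square_integrable u \<and> square_integrable h \<and>
     ((\<lambda>R. \<integral>\<^sup>+ \<xi>. ennreal ((norm (h \<xi> - truncated_fourier R u \<xi>))\<^sup>2) \<partial>lborel) \<longlongrightarrow> 0) at_top"

text \<open>
  \<open>sobolev_extension s \<Omega> u U h\<close>: the function \<open>U\<close> belongs to \<open>H\<^sup>s\<close> of the whole space, \<open>h\<close> is its
  Fourier transform, and \<open>U\<close> restricts to \<open>u\<close> on \<open>\<Omega>\<close>.
\<close>

definition sobolev_extension ::
  "real \<Rightarrow> (real^'n) set \<Rightarrow> (real^'n \<Rightarrow> real) \<Rightarrow> (real^'n \<Rightarrow> real) \<Rightarrow> (real^'n \<Rightarrow> complex) \<Rightarrow> bool" where
  "sobolev_extension s \<Omega> u U h \<longleftrightarrow>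
     is_fourier_transform (\<lambda>x. complex_of_real (U x)) h \<and>
     integrable lborel (\<lambda>\<xi>. (1 + (norm \<xi>)\<^sup>2) powr s * (norm (h \<xi>))\<^sup>2) \<and>
     (AE x in lborel. x \<in> \<Omega> \<longrightarrow> U x = u x)"

text \<open>
  Functions on \<open>\<Omega>\<close> are represented by total functions that vanish off \<open>\<Omega>\<close>; this has no
  bearing on their regularity.
\<close>

definition zero_off :: "'a set \<Rightarrow> ('a \<Rightarrow> 'b::zero) \<Rightarrow> 'a \<Rightarrow> 'b" where
  "zero_off \<Omega> u x = (if x \<in> \<Omega> then u x else 0)"

text \<open>
  \<open>H\<^sup>s(\<Omega>)\<close> is the space of restrictions of elements of \<open>H\<^sup>s\<close> of the whole space, with the quotient
  norm; on Lipschitz domains this is the usual Sobolev(-Slobodeckij) space. Elements are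
  continuous representatives, so the definition is meant for \<open>s\<close> greater than half the dimension.
\<close>

definition sobolev :: "real \<Rightarrow> (real^'n) set \<Rightarrow> (real^'n \<Rightarrow> real) set" where
  "sobolev s \<Omega> = {u. continuous_on \<Omega> u \<and> (\<forall>x. x \<notin> \<Omega> \<longrightarrow> u x = 0) \<and>
     (\<exists>U h. sobolev_extension s \<Omega> u U h)}"

definition sobolev_norm :: "real \<Rightarrow> (real^'n) set \<Rightarrow> (real^'n \<Rightarrow> real) \<Rightarrow> real" where
  "sobolev_norm s \<Omega> u =
     Inf {sqrt (LINT \<xi>|lborel. (1 + (norm \<xi>)\<^sup>2) powr s * (norm (h \<xi>))\<^sup>2) | U h.
       sobolev_extension s \<Omega> u U h}"

definition sym_matrices :: "(real^'n^'n) set" where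
  "sym_matrices = {A. transpose A = A}"

definition sobolev_sym :: "real \<Rightarrow> (real^'n) set \<Rightarrow> (real^'n \<Rightarrow> real^'n^'n) set" where
  "sobolev_sym s \<Omega> =
     {M. (\<forall>x. M x \<in> sym_matrices) \<and> (\<forall>i j. (\<lambda>x. M x $ i $ j) \<in> sobolev s \<Omega>)}"

definition sobolev_sym_norm :: "real \<Rightarrow> (real^'n) set \<Rightarrow> (real^'n \<Rightarrow> real^'n^'n) \<Rightarrow> real" where
  "sobolev_sym_norm s \<Omega> M =
     sqrt (\<Sum>i\<in>UNIV. \<Sum>j\<in>UNIV. (sobolev_norm s \<Omega> (\<lambda>x. M x $ i $ j))\<^sup>2)"


section \<open>Hilbert spaces of functions and reproducing kernels\<close>

definition ip_norm :: "('f \<Rightarrow> 'f \<Rightarrow> real) \<Rightarrow> 'f \<Rightarrow> real" where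
  "ip_norm ip M = sqrt (ip M M)"

text \<open>
  A Hilbert space \<open>H\<close> of functions from \<open>\<Omega>\<close> into the linear subspace \<open>W\<close>, with inner product \<open>ip\<close>.
\<close>

definition hilbert_function_space ::
  "'a set \<Rightarrow> 'w::real_inner set \<Rightarrow> ('a \<Rightarrow> 'w) set \<Rightarrow> (('a \<Rightarrow> 'w) \<Rightarrow> ('a \<Rightarrow> 'w) \<Rightarrow> real) \<Rightarrow> bool" where
  "hilbert_function_space \<Omega> W H ip \<longleftrightarrow>
     (\<forall>M\<in>H. (\<forall>x\<in>\<Omega>. M x \<in> W) \<and> (\<forall>x. x \<notin> \<Omega> \<longrightarrow> M x = 0)) \<and>
     (\<lambda>x. 0) \<in> H \<and>
     (\<forall>M\<in>H. \<forall>S\<in>H. (\<lambda>x. M x + S x) \<in> H) \<and>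
     (\<forall>c. \<forall>M\<in>H. (\<lambda>x. c *\<^sub>R M x) \<in> H) \<and>
     (\<forall>M\<in>H. \<forall>S\<in>H. ip M S = ip S M) \<and>
     (\<forall>M\<in>H. \<forall>S\<in>H. \<forall>T\<in>H. ip (\<lambda>x. M x + S x) T = ip M T + ip S T) \<and>
     (\<forall>c. \<forall>M\<in>H. \<forall>S\<in>H. ip (\<lambda>x. c *\<^sub>R M x) S = c * ip M S) \<and>
     (\<forall>M\<in>H. M \<noteq> (\<lambda>x. 0) \<longrightarrow> 0 < ip M M) \<and>
     (\<forall>u :: nat \<Rightarrow> 'a \<Rightarrow> 'w. (\<forall>m. u m \<in> H) \<and>
        (\<forall>e>0. \<exists>K. \<forall>m\<ge>K. \<forall>m'\<ge>K. ip_norm ip (\<lambda>x. u m x - u m' x) < e) \<longrightarrow>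
        (\<exists>M\<in>H. (\<lambda>m. ip_norm ip (\<lambda>x. u m x - M x)) \<longlonglongrightarrow> 0))"

definition bounded_operator_on :: "'w::real_normed_vector set \<Rightarrow> ('w \<Rightarrow> 'w) \<Rightarrow> bool" where
  "bounded_operator_on W A \<longleftrightarrow>
     (\<forall>a\<in>W. A a \<in> W) \<and>
     (\<forall>a\<in>W. \<forall>b\<in>W. A (a + b) = A a + A b) \<and>
     (\<forall>c. \<forall>a\<in>W. A (c *\<^sub>R a) = c *\<^sub>R A a) \<and>
     (\<exists>K. \<forall>a\<in>W. norm (A a) \<le> K * norm a)"

definition reproducing_kernel ::
  "'a set \<Rightarrow> 'w::real_inner set \<Rightarrow> ('a \<Rightarrow> 'w) set \<Rightarrow> (('a \<Rightarrow> 'w) \<Rightarrow> ('a \<Rightarrow> 'w) \<Rightarrow> real) \<Rightarrow>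
     ('a \<Rightarrow> 'a \<Rightarrow> 'w \<Rightarrow> 'w) \<Rightarrow> bool" where
  "reproducing_kernel \<Omega> W H ip \<Phi> \<longleftrightarrow>
     (\<forall>x\<in>\<Omega>. \<forall>y\<in>\<Omega>. bounded_operator_on W (\<Phi> x y)) \<and>
     (\<forall>x\<in>\<Omega>. \<forall>\<alpha>\<in>W. zero_off \<Omega> (\<lambda>y. \<Phi> y x \<alpha>) \<in> H \<and>
        (\<forall>g\<in>H. g x \<bullet> \<alpha> = ip g (zero_off \<Omega> (\<lambda>y. \<Phi> y x \<alpha>))))"

definition equivalent_norms :: "'f set \<Rightarrow> ('f \<Rightarrow> real) \<Rightarrow> ('f \<Rightarrow> real) \<Rightarrow> bool" where
  "equivalent_norms H p q \<longleftrightarrow>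
     (\<exists>c>0. \<exists>C>0. \<forall>M\<in>H. c * q M \<le> p M \<and> p M \<le> C * q M)"

definition sobolev_sym_kernel ::
  "real \<Rightarrow> (real^'n) set \<Rightarrow> ((real^'n \<Rightarrow> real^'n^'n) \<Rightarrow> (real^'n \<Rightarrow> real^'n^'n) \<Rightarrow> real) \<Rightarrow>
     (real^'n \<Rightarrow> real^'n \<Rightarrow> real^'n^'n \<Rightarrow> real^'n^'n) \<Rightarrow> bool" where
  "sobolev_sym_kernel \<sigma> \<Omega> ip \<Phi> \<longleftrightarrow>
     hilbert_function_space \<Omega> sym_matrices (sobolev_sym \<sigma> \<Omega>) ip \<and>
     equivalent_norms (sobolev_sym \<sigma> \<Omega>) (ip_norm ip) (sobolev_sym_norm \<sigma> \<Omega>) \<and>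
     reproducing_kernel \<Omega> sym_matrices (sobolev_sym \<sigma> \<Omega>) ip \<Phi>"

definition sobolev_kernel ::
  "real \<Rightarrow> (real^'n) set \<Rightarrow> ((real^'n \<Rightarrow> real) \<Rightarrow> (real^'n \<Rightarrow> real) \<Rightarrow> real) \<Rightarrow>
     (real^'n \<Rightarrow> real^'n \<Rightarrow> real) \<Rightarrow> bool" where
  "sobolev_kernel \<sigma> \<Omega> ip \<phi> \<longleftrightarrow>
     hilbert_function_space \<Omega> UNIV (sobolev \<sigma> \<Omega>) ip \<and>
     equivalent_norms (sobolev \<sigma> \<Omega>) (ip_norm ip) (sobolev_norm \<sigma> \<Omega>) \<and>
     reproducing_kernel \<Omega> UNIV (sobolev \<sigma> \<Omega>) ip (\<lambda>x y a. \<phi> x y * a)"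

definition represented_by_tensor ::
  "(real^'n) set \<Rightarrow> (real^'n \<Rightarrow> real^'n \<Rightarrow> real^'n^'n \<Rightarrow> real^'n^'n) \<Rightarrow>
     (real^'n \<Rightarrow> real^'n \<Rightarrow> 'n \<Rightarrow> 'n \<Rightarrow> 'n \<Rightarrow> 'n \<Rightarrow> real) \<Rightarrow> bool" where
  "represented_by_tensor \<Omega> \<Phi> T \<longleftrightarrow>
     (\<forall>x\<in>\<Omega>. \<forall>y\<in>\<Omega>. \<forall>\<alpha>\<in>sym_matrices. \<forall>i j.
        \<Phi> x y \<alpha> $ i $ j = (\<Sum>k\<in>UNIV. \<Sum>l\<in>UNIV. T x y i j k l * \<alpha> $ k $ l))"

definition bounded_functional_on ::
  "('a \<Rightarrow> 'w::real_vector) set \<Rightarrow> (('a \<Rightarrow> 'w) \<Rightarrow> ('a \<Rightarrow> 'w) \<Rightarrow> real) \<Rightarrow> (('a \<Rightarrow> 'w) \<Rightarrow> real) \<Rightarrow> bool" where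
  "bounded_functional_on H ip l \<longleftrightarrow>
     (\<forall>M\<in>H. \<forall>S\<in>H. l (\<lambda>x. M x + S x) = l M + l S) \<and>
     (\<forall>c. \<forall>M\<in>H. l (\<lambda>x. c *\<^sub>R M x) = c * l M) \<and>
     (\<exists>K. \<forall>M\<in>H. \<bar>l M\<bar> \<le> K * ip_norm ip M)"


section \<open>Matrices and the collocation functionals\<close>

definition complex_eigenvalue :: "real^'n^'n \<Rightarrow> complex \<Rightarrow> bool" where
  "complex_eigenvalue A z \<longleftrightarrow>
     (\<exists>v::complex^'n. v \<noteq> 0 \<and> (\<chi> i j. complex_of_real (A $ i $ j)) *v v = z *s v)"

definition positive_definite :: "real^'n^'n \<Rightarrow> bool" where
  "positive_definite A \<longleftrightarrow> (\<forall>v. v \<noteq> 0 \<longrightarrow> 0 < v \<bullet> (A *v v))"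

definition E_unit :: "'n \<Rightarrow> 'n \<Rightarrow> real^'n^'n" where
  "E_unit \<mu> \<nu> = (\<chi> i j. if i = \<mu> \<and> j = \<nu> then 1 else 0)"

definition E_sym :: "'n \<Rightarrow> 'n \<Rightarrow> real^'n^'n" where
  "E_sym \<mu> \<nu> = (if \<mu> = \<nu> then E_unit \<mu> \<mu> else (1 / sqrt 2) *\<^sub>R (E_unit \<mu> \<nu> + E_unit \<nu> \<mu>))"

text \<open>
  \<open>F_op f p M\<close> is \<open>Df\<^sup>T M + M Df + \<nabla>M \<cdot> f\<close> at the point \<open>p\<close>; the derivative of an entry
  applied to \<open>f p\<close> is the inner product of its gradient with \<open>f p\<close>.
\<close>

definition F_op :: "(real^'n \<Rightarrow> real^'n) \<Rightarrow> real^'n \<Rightarrow> (real^'n \<Rightarrow> real^'n^'n) \<Rightarrow> real^'n^'n" where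
  "F_op f p M = transpose (jacobian f (at p)) ** M p + M p ** jacobian f (at p) +
     (\<chi> i j. frechet_derivative (\<lambda>y. M y $ i $ j) (at p) (f p))"

definition collocation_functional ::
  "(real^'n \<Rightarrow> real^'n) \<Rightarrow> real^'n \<Rightarrow> 'n \<Rightarrow> 'n \<Rightarrow> (real^'n \<Rightarrow> real^'n^'n) \<Rightarrow> real" where
  "collocation_functional f p i j M = axis i 1 \<bullet> (F_op f p M *v axis j 1)"

definition tensor_slice ::
  "(real^'n \<Rightarrow> real^'n \<Rightarrow> 'n \<Rightarrow> 'n \<Rightarrow> 'n \<Rightarrow> 'n \<Rightarrow> real) \<Rightarrow> real^'n \<Rightarrow> 'n \<Rightarrow> 'n \<Rightarrow> real^'n \<Rightarrow> real^'n^'n" where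
  "tensor_slice T x \<mu> \<nu> y = (\<chi> i j. T y x i j \<mu> \<nu>)"

text \<open>
  An index type of class \<open>{finite, linorder}\<close> is order isomorphic to \<open>{1..n}\<close>, so that the
  condition \<open>i \<le> j\<close> on matrix indices makes sense. The synonyms only serve to state this sort once.
\<close>

type_synonym 'n rvector = "(real, 'n) vec"
type_synonym 'n rmatrix = "((real, 'n) vec, 'n) vec"

definition satisfies_constraints ::
  "('n::{finite,linorder} rvector \<Rightarrow> 'n rvector) \<Rightarrow> (nat \<Rightarrow> 'n rvector) \<Rightarrow> nat \<Rightarrow> 'n rmatrix \<Rightarrow>
     ('n rvector \<Rightarrow> 'n rmatrix) \<Rightarrow> bool" where
  "satisfies_constraints f p N C M \<longleftrightarrow>
     (\<forall>k\<in>{1..N}. \<forall>i j. i \<le> j \<longrightarrow> collocation_functional f (p k) i j M = - C $ i $ j)"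

definition is_norm_minimal ::
  "('n::{finite,linorder} rvector \<Rightarrow> 'n rvector) \<Rightarrow> (nat \<Rightarrow> 'n rvector) \<Rightarrow> nat \<Rightarrow> 'n rmatrix \<Rightarrow>
     ('n rvector \<Rightarrow> 'n rmatrix) set \<Rightarrow>
     (('n rvector \<Rightarrow> 'n rmatrix) \<Rightarrow> ('n rvector \<Rightarrow> 'n rmatrix) \<Rightarrow> real) \<Rightarrow> ('n rvector \<Rightarrow> 'n rmatrix) \<Rightarrow> bool" where
  "is_norm_minimal f p N C H ip S \<longleftrightarrow>
     S \<in> H \<and> satisfies_constraints f p N C S \<and>
     (\<forall>M\<in>H. satisfies_constraints f p N C M \<longrightarrow> ip_norm ip S \<le> ip_norm ip M)"

definition kernel_ansatz ::
  "('n::{finite,linorder} rvector \<Rightarrow> 'n rvector) \<Rightarrow> (nat \<Rightarrow> 'n rvector) \<Rightarrow> nat \<Rightarrow>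
     ('n rvector \<Rightarrow> 'n rvector \<Rightarrow> 'n rmatrix \<Rightarrow> 'n rmatrix) \<Rightarrow>
     (nat \<Rightarrow> 'n \<Rightarrow> 'n \<Rightarrow> real) \<Rightarrow> 'n rvector \<Rightarrow> 'n rmatrix" where
  "kernel_ansatz f p N \<Phi> \<gamma> x =
     (\<Sum>k\<in>{1..N}. \<Sum>(i, j)\<in>{(i, j). i \<le> j}. \<gamma> k i j *\<^sub>R
        (\<Sum>(\<mu>, \<nu>)\<in>{(\<mu>, \<nu>). \<mu> \<le> \<nu>}.
           collocation_functional f (p k) i j (\<lambda>y. \<Phi> y x (E_sym \<mu> \<nu>)) *\<^sub>R E_sym \<mu> \<nu>))"

end

theory Submission
  imports Defs "HOL-Probability.Characteristic_Functions" "HOL-Real_Asymp.Real_Asymp"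
    "HOL-Computational_Algebra.Fundamental_Theorem_Algebra"
begin

text \<open>
  The constraints are finitely many linear functionals \<open>l a\<close> on a Hilbert space, indexed by a point
  and a position \<open>i \<le> j\<close>. Everything rests on two facts: each of them is bounded
  (\<open>collocation_bounded\<close>), and they are linearly independent, that is, there are functions \<open>B b\<close> with
  \<open>l a (B b) = 0\<close> for \<open>a \<noteq> b\<close> and \<open>l a (B a) = 1\<close> (from \<open>collocation_prescribed\<close>). Then a solution \<open>S\<close> of
  minimal norm exists by completeness. It is orthogonal to the common kernel of the functionals, hence
  it is the combination of their Riesz representers with coefficients \<open>ip S (B b)\<close>, and the dual
  family makes the coefficients unique (\<open>minimal_norm_interpolation\<close>). The reproducing property gives
  the value of a representer at \<open>x\<close> in the direction \<open>\<alpha>\<close>: it is the functional applied to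
  \<open>\<Phi>(\<cdot>, x) \<alpha>\<close>. Expanding in the orthonormal basis \<open>E_sym \<mu> \<nu>\<close> of the symmetric matrices yields the
  first formula for \<open>S\<close>; the second one follows by linearity of \<open>F_op\<close> and the third one
  because \<open>F_op\<close> commutes with transposition.

  Boundedness is the Sobolev embedding of \<open>H\<^sup>\<sigma>\<close> into the continuously differentiable functions for
  \<open>\<sigma> > n / 2 + 1\<close> (\<open>sobolev_embedding_C1\<close>). By the Cauchy-Schwarz inequality the Fourier transform \<open>h\<close> of an
  extension is integrable, even against the weight \<open>norm \<xi>\<close>, with a bound by the Sobolev norm. It
  remains to know that the function is the inverse Fourier integral of \<open>h\<close>. Since \<open>h\<close> is only an
  \<open>L\<^sub>2\<close> limit of truncated transforms, this is shown by pairing with modulated Gaussians, whose transforms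
  are heat kernels, and by shrinking the heat kernel to a point (\<open>fourier_inversion_L2\<close>). At points of
  the domain the function is continuous, so the inversion holds there pointwise.

  For independence one needs functions in \<open>H\<^sup>\<sigma>\<close> with prescribed values and derivatives at finitely
  many points. Translated Gaussians lie in \<open>H\<^sup>\<sigma>\<close> (\<open>gaussian_translate_in_sobolev\<close>), and up to constants
  they are products of one Gaussian with exponentials \<open>exp (b \<bullet> x)\<close>. The span of the latter
  is an algebra that separates points, so it contains functions vanishing to second order at all but one
  of the points. At a point where \<open>f\<close> is not zero, a prescribed slope along \<open>f\<close> makes \<open>F_op\<close> take any
  symmetric value. At an equilibrium \<open>F_op\<close> reduces to the Lyapunov operator
  \<open>A \<mapsto> D\<^sup>T A + A D\<close>, which is invertible on symmetric matrices since the eigenvalues of \<open>D\<close> lie in an open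
  half plane (\<open>lyapunov_solvable\<close>).
\<close>

section \<open>Gaussians and their Fourier transforms\<close>

text \<open>
  Fubini for products of functions of one coordinate each: Lebesgue measure is the image of a
  product measure. It reduces the Gaussian on \<open>\<real>\<^sup>n\<close> to the real line.
\<close>

lemma lborel_prod_integral:
  fixes g :: "'a::euclidean_space \<Rightarrow> real \<Rightarrow> complex"
  assumes "\<And>b. b \<in> Basis \<Longrightarrow> integrable lborel (g b)"
  shows "integrable lborel (\<lambda>x::'a. \<Prod>b\<in>Basis. g b (x \<bullet> b))"
    and "(LINT x|lborel. (\<Prod>b\<in>Basis. g b (x \<bullet> b))) = (\<Prod>b\<in>(Basis::'a set). LINT x|lborel. g b x)"
proof -
  interpret product_sigma_finite "\<lambda>b::'a. lborel :: real measure" ..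
  have [measurable]: "g b \<in> borel_measurable borel" if "b \<in> Basis" for b
    using assms[OF that] by (simp add: integrable_iff_bounded)
  have *: "(\<Prod>b\<in>Basis. g b ((\<Sum>b\<in>Basis. f b *\<^sub>R b) \<bullet> b)) = (\<Prod>b\<in>Basis. g b (f b))" for f :: "'a \<Rightarrow> real"
    by (intro prod.cong) auto
  show "integrable lborel (\<lambda>x::'a. \<Prod>b\<in>Basis. g b (x \<bullet> b))"
    unfolding lborel_eq[where 'a='a]
    by (subst integrable_distr_eq) (auto simp: * intro!: product_integrable_prod assms)
  show "(LINT x|lborel. (\<Prod>b\<in>Basis. g b (x \<bullet> b))) = (\<Prod>b\<in>(Basis::'a set). LINT x|lborel. g b x)"
    unfolding lborel_eq[where 'a='a]
    by (subst integral_distr) (auto simp: * intro!: product_integral_prod assms)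
qed

lemma cis_measurable [measurable]: "cis \<in> borel_measurable borel"
  by (intro borel_measurable_continuous_onI continuous_intros)

lemma cnj_measurable [measurable]: "cnj \<in> borel_measurable borel"
  by (intro borel_measurable_continuous_onI continuous_intros)

text \<open>
  A rescaling of the characteristic function of the standard normal distribution.
\<close>

lemma gaussian_fourier_1d:
  fixes s y :: real
  assumes "s > 0"
  shows "integrable lborel (\<lambda>x. cis (x * y) * complex_of_real (exp (- (s * x)\<^sup>2 / 2)))"
    and "(LINT x|lborel. cis (x * y) * complex_of_real (exp (- (s * x)\<^sup>2 / 2))) =
      complex_of_real (sqrt (2 * pi) / s * exp (- (y / s)\<^sup>2 / 2))"
proof -
  have std: "complex_of_real (exp (- x\<^sup>2 / 2)) = complex_of_real (sqrt (2 * pi)) * complex_of_real (std_normal_density x)" for x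
    by (simp add: std_normal_density_def)
  have int: "integrable lborel std_normal_density"
    using integrable_normal_moment[of 1 0 0] by simp
  have int': "integrable lborel (\<lambda>x. complex_of_real (exp (- x\<^sup>2 / 2)))"
    unfolding std using int by (intro integrable_mult_right integrable_of_real)
  have i1: "integrable lborel (\<lambda>x. cis (x * y) * complex_of_real (exp (- x\<^sup>2 / 2)))" for y
    by (rule Bochner_Integration.integrable_bound[OF int'])
      (auto simp: norm_mult)
  have "complex_of_real (exp (- (t^2) / 2)) = (LINT x|std_normal_distribution. cis (t * x))" for t
    using fun_cong[OF char_std_normal_distribution, of t] by (simp add: char_def cis_conv_exp)
  also have "\<And>t. (LINT x|std_normal_distribution. cis (t * x)) = (LINT x|lborel. std_normal_density x *\<^sub>R cis (t * x))"
    by (subst integral_density) auto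
  finally have e0: "(LINT x|lborel. std_normal_density x *\<^sub>R cis (t * x)) = complex_of_real (exp (- (t^2) / 2))" for t by simp
  have e1: "(LINT x|lborel. cis (x * t) * complex_of_real (exp (- x\<^sup>2 / 2))) = complex_of_real (sqrt (2 * pi) * exp (- (t^2) / 2))" for t
  proof -
    have "(LINT x|lborel. cis (x * t) * complex_of_real (exp (- x\<^sup>2 / 2))) =
        (LINT x|lborel. complex_of_real (sqrt (2 * pi)) * (std_normal_density x *\<^sub>R cis (t * x)))"
      by (intro Bochner_Integration.integral_cong refl) (simp only: std scaleR_conv_of_real mult_ac)
    then show ?thesis by (simp only: integral_mult_right_zero e0 of_real_mult)
  qed
  have eq: "cis (x * y) * complex_of_real (exp (- (s * x)\<^sup>2 / 2)) =
     (\<lambda>z. cis (z * (y / s)) * complex_of_real (exp (- z\<^sup>2 / 2))) (0 + s * x)" for x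
    using assms by simp
  show "integrable lborel (\<lambda>x. cis (x * y) * complex_of_real (exp (- (s * x)\<^sup>2 / 2)))"
    unfolding eq by (rule lborel_integrable_real_affine[OF i1]) (use assms in auto)
  have "complex_of_real (sqrt (2 * pi) * exp (- ((y/s)^2) / 2)) = 
     s *\<^sub>R (LINT x|lborel. cis (x * y) * complex_of_real (exp (- (s * x)\<^sup>2 / 2)))"
    unfolding eq e1[symmetric] using assms 
    by (subst lborel_integral_real_affine[where c = s and t = 0]) auto
  then show "(LINT x|lborel. cis (x * y) * complex_of_real (exp (- (s * x)\<^sup>2 / 2))) =
      complex_of_real (sqrt (2 * pi) / s * exp (- (y / s)\<^sup>2 / 2))"
    using assms by (simp add: scaleR_conv_of_real field_simps)
qed

definition gaussian :: "real \<Rightarrow> 'a::euclidean_space \<Rightarrow> real" where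
  "gaussian s x = exp (- (s * norm x)\<^sup>2 / 2)"

lemma gaussian_measurable [measurable]: "gaussian s \<in> borel_measurable borel"
  unfolding gaussian_def by measurable

lemma gaussian_bounds [simp]: "0 < gaussian s x" "0 \<le> gaussian s x" "gaussian s x \<le> 1"
  by (auto simp: gaussian_def)

lemma gaussian_neq_0 [simp]: "gaussian s x \<noteq> 0"
  by (simp add: gaussian_def)

lemma norm_power2_Basis: "(norm (x::'a::euclidean_space))\<^sup>2 = (\<Sum>b\<in>Basis. (x \<bullet> b)\<^sup>2)"
  unfolding power2_norm_eq_inner by (subst euclidean_inner) (simp add: power2_eq_square)

lemma cis_sum: "finite A \<Longrightarrow> cis (\<Sum>a\<in>A. f a) = (\<Prod>a\<in>A. cis (f a))"
  by (induction A rule: finite_induct) (auto simp: cis_mult[symmetric])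

lemma gaussian_fourier:
  fixes y :: "'a::euclidean_space"
  assumes "s > 0"
  shows "integrable lborel (\<lambda>x. cis (x \<bullet> y) * complex_of_real (gaussian s x))"
    and "(LINT x|lborel. cis (x \<bullet> y) * complex_of_real (gaussian s x)) =
      complex_of_real ((sqrt (2 * pi) / s) ^ DIM('a) * gaussian (1 / s) y)"
proof -
  have eq: "cis (x \<bullet> y) * complex_of_real (gaussian s x) = 
     (\<Prod>b\<in>Basis. (\<lambda>b t. cis (t * (y \<bullet> b)) * complex_of_real (exp (- (s * t)\<^sup>2 / 2))) b (x \<bullet> b))" for x :: 'a
  proof -
    have "gaussian s x = (\<Prod>b\<in>Basis. exp (- (s * (x \<bullet> b))\<^sup>2 / 2))"
      unfolding gaussian_def power_mult_distrib norm_power2_Basis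
      by (simp add: sum_distrib_left exp_sum[symmetric] sum_negf sum_divide_distrib)
    moreover have "cis (x \<bullet> y) = (\<Prod>b\<in>Basis. cis ((x \<bullet> b) * (y \<bullet> b)))"
      by (subst euclidean_inner) (simp add: cis_sum)
    ultimately show ?thesis by (simp add: prod.distrib)
  qed
  show "integrable lborel (\<lambda>x. cis (x \<bullet> y) * complex_of_real (gaussian s x))"
    unfolding eq by (rule lborel_prod_integral(1)) (rule gaussian_fourier_1d(1)[OF assms])
  have g: "(\<Prod>b\<in>Basis. sqrt (2 * pi) / s * exp (- ((y \<bullet> b) / s)\<^sup>2 / 2)) = (sqrt (2 * pi) / s) ^ DIM('a) * gaussian (1/s) y"
    unfolding gaussian_def power_mult_distrib norm_power2_Basis prod.distrib
    by (simp add: sum_distrib_left exp_sum[symmetric] sum_negf sum_divide_distrib power_divide)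
  show "(LINT x|lborel. cis (x \<bullet> y) * complex_of_real (gaussian s x)) =
      complex_of_real ((sqrt (2 * pi) / s) ^ DIM('a) * gaussian (1 / s) y)"
    unfolding eq by (subst lborel_prod_integral(2), rule gaussian_fourier_1d(1)[OF assms])
      (subst gaussian_fourier_1d(2)[OF assms], simp only: g flip: of_real_prod)
qed

lemma nn_integral_affine:
  fixes F :: "'a::euclidean_space \<Rightarrow> ennreal"
  assumes [measurable]: "F \<in> borel_measurable borel" and "c \<noteq> 0"
  shows "(\<integral>\<^sup>+x. F x \<partial>lborel) = ennreal (\<bar>c\<bar> ^ DIM('a)) * (\<integral>\<^sup>+x. F (t + c *\<^sub>R x) \<partial>lborel)"
  by (subst lborel_affine[OF assms(2), of t])
    (simp add: nn_integral_density nn_integral_distr nn_integral_cmult)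

lemma gaussian_integrable:
  assumes "s > 0"
  shows "integrable lborel (gaussian s :: 'a::euclidean_space \<Rightarrow> real)"
    and "(LINT x|lborel. gaussian s (x::'a)) = (sqrt (2 * pi) / s) ^ DIM('a)"
proof -
  have i: "integrable lborel (\<lambda>x. complex_of_real (gaussian s (x::'a)))"
    using gaussian_fourier(1)[OF assms, of "0::'a"] by simp
  then show 1: "integrable lborel (gaussian s :: 'a \<Rightarrow> real)"
    unfolding complex_of_real_integrable_eq .
  have "complex_of_real (LINT x|lborel. gaussian s (x::'a)) = complex_of_real ((sqrt (2 * pi) / s) ^ DIM('a))"
    using gaussian_fourier(2)[OF assms, of "0::'a"] by (simp add: gaussian_def)
  then show "(LINT x|lborel. gaussian s (x::'a)) = (sqrt (2 * pi) / s) ^ DIM('a)"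
    using of_real_eq_iff by blast
qed

text \<open>
  The heat kernel at time \<open>s\<^sup>2 / 2\<close>, up to the normalising constant. It is the Fourier transform of
  \<open>gaussian s\<close> in the unitary normalisation, and an approximate identity as \<open>s\<close> tends to \<open>0\<close>.
\<close>

definition heat :: "real \<Rightarrow> 'a::euclidean_space \<Rightarrow> real" where
  "heat s x = gaussian (1 / s) x / s ^ DIM('a)"

lemma heat_measurable [measurable]: "heat s \<in> borel_measurable borel"
  unfolding heat_def by measurable

lemma heat_minus: "heat s (- x) = heat s x"
  by (simp add: heat_def gaussian_def)

lemma heat_bounds: "s > 0 \<Longrightarrow> 0 \<le> heat s x" "s > 0 \<Longrightarrow> heat s x \<le> 1 / s ^ DIM('a)" for x :: "'a::euclidean_space"
  by (auto simp: heat_def divide_right_mono)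

lemma nn_integral_heat:
  fixes y :: "'a::euclidean_space"
  assumes "s > 0"
  shows "(\<integral>\<^sup>+x. ennreal (heat s (y - x)) \<partial>lborel) = ennreal (sqrt (2 * pi) ^ DIM('a))"
proof -
  have "(\<integral>\<^sup>+x. ennreal (heat s (x::'a)) \<partial>lborel) = ennreal (LINT x|lborel. heat s (x::'a))"
    unfolding heat_def using assms gaussian_integrable(1)[of "1/s", where 'a='a]
    by (intro nn_integral_eq_integral) auto
  also have "(LINT x|lborel. heat s (x::'a)) = sqrt (2 * pi) ^ DIM('a)"
    unfolding heat_def using assms gaussian_integrable(2)[of "1/s", where 'a='a]
    by (simp add: power_mult_distrib field_simps)
  finally have "(\<integral>\<^sup>+x. ennreal (heat s (x::'a)) \<partial>lborel) = ennreal (sqrt (2 * pi) ^ DIM('a))" .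
  then show ?thesis
    by (subst (asm) nn_integral_affine[where c = "-1" and t = y]) auto
qed

lemma heat_integrable:
  fixes y :: "'a::euclidean_space"
  assumes "s > 0"
  shows "integrable lborel (\<lambda>x. heat s (y - x))"
    and "(LINT x|lborel. heat s (y - x)) = sqrt (2 * pi) ^ DIM('a)"
proof -
  have n: "(\<integral>\<^sup>+x. ennreal (norm (heat s (y - x))) \<partial>lborel) = ennreal (sqrt (2 * pi) ^ DIM('a))"
    using nn_integral_heat[OF assms, of y] heat_bounds(1)[OF assms, where 'a='a] by simp
  show "integrable lborel (\<lambda>x. heat s (y - x))"
    by (rule integrableI_bounded, measurable, simp only: n) simp
  show "(LINT x|lborel. heat s (y - x)) = sqrt (2 * pi) ^ DIM('a)"
    using nn_integral_heat[OF assms, of y] heat_bounds(1)[OF assms, where 'a='a]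
    by (subst integral_eq_nn_integral) auto
qed

section \<open>The Fourier transform of integrable and square integrable functions\<close>

lemma product_integrable:
  fixes g :: "'a::euclidean_space \<Rightarrow> complex" and k :: "'b::euclidean_space \<Rightarrow> complex"
  assumes "integrable lborel g" "integrable lborel k"
    and [measurable]: "w \<in> borel_measurable (borel \<Otimes>\<^sub>M borel)" and w: "\<And>z. norm (w z) \<le> 1"
  shows "integrable (lborel \<Otimes>\<^sub>M lborel) (\<lambda>(x, y). w (x, y) * g x * k y :: complex)"
proof -
  have [measurable]: "g \<in> borel_measurable borel" "k \<in> borel_measurable borel"
    using assms by (auto simp: integrable_iff_bounded)
  have "integrable (lborel \<Otimes>\<^sub>M lborel) (\<lambda>(x, y). g x * k y)"
  proof (rule lborel_pair.Fubini_integrable)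
    show "integrable lborel (\<lambda>x. LINT y|lborel. norm (case (x, y) of (x, y) \<Rightarrow> g x * k y))"
      using assms(1) by (simp add: norm_mult)
    show "AE x in lborel. integrable lborel (\<lambda>y. case (x, y) of (x, y) \<Rightarrow> g x * k y)"
      using assms(2) by simp
  qed measurable
  then show ?thesis
  proof (rule Bochner_Integration.integrable_bound)
    show "AE z in lborel \<Otimes>\<^sub>M lborel. norm (case z of (x, y) \<Rightarrow> w (x, y) * g x * k y) \<le> norm (case z of (x, y) \<Rightarrow> g x * k y)"
      using w by (intro always_eventually allI) (auto simp: norm_mult mult.assoc intro!: mult_left_le_one_le)
  qed measurable
qed

text \<open>
  The unitary normalisation, so that \<open>fourier\<close> of a function cut off outside a ball is its
  \<open>truncated_fourier\<close>.
\<close>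

definition fourier :: "('a::euclidean_space \<Rightarrow> complex) \<Rightarrow> 'a \<Rightarrow> complex" where
  "fourier g \<xi> = complex_of_real ((2 * pi) powr (- real DIM('a) / 2)) *
     (LINT x|lborel. cis (- (x \<bullet> \<xi>)) * g x)"

lemma fourier_const: "(2 * pi) powr (- real n / 2) * sqrt (2 * pi) ^ n = 1"
proof -
  have "sqrt (2 * pi) ^ n = (2 * pi) powr (real n / 2)"
    by (simp add: powr_half_sqrt[symmetric] powr_realpow[symmetric] powr_powr)
  then show ?thesis by (simp add: powr_add[symmetric])
qed

lemma cis_mult_integrable:
  fixes g :: "'a::euclidean_space \<Rightarrow> complex"
  assumes "integrable lborel g" and [measurable]: "w \<in> borel_measurable borel"
  shows "integrable lborel (\<lambda>x. cis (w x) * g x)"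
  by (rule Bochner_Integration.integrable_bound[OF assms(1)])
    (use assms in \<open>auto simp: norm_mult integrable_iff_bounded\<close>)

lemma fourier_measurable [measurable]:
  assumes [measurable]: "g \<in> borel_measurable borel"
  shows "fourier g \<in> borel_measurable borel"
  unfolding fourier_def by measurable

lemma fourier_bound:
  fixes \<xi> :: "'a::euclidean_space"
  assumes "integrable lborel g"
  shows "norm (fourier g \<xi>) \<le> (2 * pi) powr (- real DIM('a) / 2) * (LINT x|lborel. norm (g x))"
proof -
  have "norm (LINT x|lborel. cis (- (x \<bullet> \<xi>)) * g x) \<le> (LINT x|lborel. norm (cis (- (x \<bullet> \<xi>)) * g x))"
    by (rule integral_norm_bound)
  then show ?thesis by (simp add: fourier_def norm_mult)
qed

text \<open>
  Both sides are the integral of \<open>cis (- (x \<bullet> \<xi>)) * g x * k \<xi>\<close> over the product space. With a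
  modulated Gaussian for \<open>k\<close>, whose transform is known, this inverts the transform of \<open>g\<close> up to
  smoothing.
\<close>

lemma fourier_multiplication_formula:
  fixes g k :: "'a::euclidean_space \<Rightarrow> complex"
  assumes "integrable lborel g" "integrable lborel k"
  shows "(LINT \<xi>|lborel. fourier g \<xi> * k \<xi>) = (LINT x|lborel. g x * fourier k x)"
proof -
  let ?c = "complex_of_real ((2 * pi) powr (- real DIM('a) / 2))"
  have i: "integrable (lborel \<Otimes>\<^sub>M lborel) (\<lambda>(x, \<xi>). cis (- (x \<bullet> \<xi>)) * g x * k \<xi>)"
    using product_integrable[OF assms, of "\<lambda>z. cis (- (fst z \<bullet> snd z))"] by simp
  have "(LINT \<xi>|lborel. fourier g \<xi> * k \<xi>) = (LINT \<xi>|lborel. ?c * (LINT x|lborel. cis (- (x \<bullet> \<xi>)) * g x * k \<xi>))"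
  proof (intro Bochner_Integration.integral_cong refl)
    fix \<xi>
    show "fourier g \<xi> * k \<xi> = ?c * (LINT x|lborel. cis (- (x \<bullet> \<xi>)) * g x * k \<xi>)"
      unfolding fourier_def integral_mult_left_zero by (rule mult.assoc)
  qed
  also have "\<dots> = ?c * (LINT \<xi>|lborel. (LINT x|lborel. cis (- (x \<bullet> \<xi>)) * g x * k \<xi>))"
    by (rule integral_mult_right_zero)
  also have "\<dots> = ?c * (LINT x|lborel. (LINT \<xi>|lborel. cis (- (x \<bullet> \<xi>)) * g x * k \<xi>))"
    using lborel_pair.Fubini_integral[OF i] by simp
  also have "\<dots> = (LINT x|lborel. ?c * (LINT \<xi>|lborel. cis (- (x \<bullet> \<xi>)) * g x * k \<xi>))"
    by (rule integral_mult_right_zero[symmetric])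
  also have "\<dots> = (LINT x|lborel. g x * fourier k x)"
  proof (intro Bochner_Integration.integral_cong refl)
    fix x
    have "(LINT \<xi>|lborel. cis (- (x \<bullet> \<xi>)) * g x * k \<xi>) = (LINT \<xi>|lborel. g x * (cis (- (\<xi> \<bullet> x)) * k \<xi>))"
      by (intro Bochner_Integration.integral_cong refl) (simp add: inner_commute)
    then show "?c * (LINT \<xi>|lborel. cis (- (x \<bullet> \<xi>)) * g x * k \<xi>) = g x * fourier k x"
      by (simp add: fourier_def)
  qed
  finally show ?thesis .
qed

lemma gaussian_fourier_shift:
  fixes x x0 :: "'a::euclidean_space"
  assumes "s > 0"
  shows "integrable lborel (\<lambda>\<xi>. complex_of_real (gaussian s \<xi>) * cis (\<xi> \<bullet> x0))"
    and "fourier (\<lambda>\<xi>. complex_of_real (gaussian s \<xi>) * cis (\<xi> \<bullet> x0)) x = complex_of_real (heat s (x0 - x))"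
proof -
  show "integrable lborel (\<lambda>\<xi>. complex_of_real (gaussian s \<xi>) * cis (\<xi> \<bullet> x0))"
    using gaussian_fourier(1)[OF assms, of x0] by (simp add: mult.commute)
  have "(LINT \<xi>|lborel. cis (- (\<xi> \<bullet> x)) * (complex_of_real (gaussian s \<xi>) * cis (\<xi> \<bullet> x0))) =
    (LINT \<xi>|lborel. cis (\<xi> \<bullet> (x0 - x)) * complex_of_real (gaussian s \<xi>))"
  proof (intro Bochner_Integration.integral_cong refl)
    have "cis (a - b) = cis (- b) * cis a" for a b
      by (simp add: cis_mult)
    then show "cis (- (\<xi> \<bullet> x)) * (complex_of_real (gaussian s \<xi>) * cis (\<xi> \<bullet> x0)) =
        cis (\<xi> \<bullet> (x0 - x)) * complex_of_real (gaussian s \<xi>)" for \<xi>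
      by (simp only: inner_diff_right mult_ac)
  qed
  also have "\<dots> = complex_of_real ((sqrt (2 * pi) / s) ^ DIM('a) * gaussian (1 / s) (x0 - x))"
    by (rule gaussian_fourier(2)[OF assms])
  also have "\<dots> = complex_of_real (sqrt (2 * pi) ^ DIM('a) * heat s (x0 - x))"
    by (simp add: heat_def power_divide)
  finally have "fourier (\<lambda>\<xi>. complex_of_real (gaussian s \<xi>) * cis (\<xi> \<bullet> x0)) x =
     complex_of_real (((2 * pi) powr (- real DIM('a) / 2) * sqrt (2 * pi) ^ DIM('a)) * heat s (x0 - x))"
    unfolding fourier_def by (simp add: mult.assoc)
  then show "fourier (\<lambda>\<xi>. complex_of_real (gaussian s \<xi>) * cis (\<xi> \<bullet> x0)) x = complex_of_real (heat s (x0 - x))"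
    unfolding fourier_const by simp
qed

text \<open>
  Inversion up to smoothing: damping the inverse Fourier integral by a Gaussian amounts to
  averaging \<open>g\<close> against the heat kernel.
\<close>

lemma fourier_smoothing:
  fixes g :: "'a::euclidean_space \<Rightarrow> complex"
  assumes "integrable lborel g" "s > 0"
  shows "(LINT \<xi>|lborel. fourier g \<xi> * (complex_of_real (gaussian s \<xi>) * cis (\<xi> \<bullet> x0))) =
    (LINT x|lborel. g x * complex_of_real (heat s (x0 - x)))"
  using fourier_multiplication_formula[OF assms(1) gaussian_fourier_shift(1)[OF assms(2), of x0]]
  by (simp add: gaussian_fourier_shift(2)[OF assms(2)])

lemma norm_integral_le_nn_integral:
  fixes f :: "_ \<Rightarrow> 'a :: {banach, second_countable_topology}"
  shows "ennreal (norm (integral\<^sup>L M f)) \<le> (\<integral>\<^sup>+x. ennreal (norm (f x)) \<partial>M)"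
  using integral_norm_bound_ennreal[of M f] by (cases "integrable M f") (auto simp: not_integrable_integral_eq)

text \<open>
  One half of Plancherel's theorem. Weighted with \<open>gaussian s\<close>, the integral of the squared
  modulus of the transform becomes, by the multiplication formula and the smoothing formula, the
  double integral of \<open>g x\<close> and \<open>cnj (g y)\<close> against the heat kernel at \<open>x - y\<close>. The kernel has mass one
  in either variable after normalisation, so that the bound
  \<open>2 * norm (g x) * norm (g y) \<le> (norm (g x))\<^sup>2 + (norm (g y))\<^sup>2\<close> suffices. Fatou's lemma removes the weight.
\<close>

lemma fourier_L2_bound:
  fixes g :: "'a::euclidean_space \<Rightarrow> complex"
  assumes "integrable lborel g"
  shows "(\<integral>\<^sup>+\<xi>. ennreal ((norm (fourier g \<xi>))\<^sup>2) \<partial>lborel) \<le> (\<integral>\<^sup>+x. ennreal ((norm (g x))\<^sup>2) \<partial>lborel)"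
proof -
  have [measurable]: "g \<in> borel_measurable borel"
    using assms by (auto simp: integrable_iff_bounded)
  let ?c = "(2 * pi) powr (- real DIM('a) / 2)"
  let ?L = "sqrt (2 * pi) ^ DIM('a)"
  let ?I = "\<lambda>s. \<integral>\<^sup>+\<xi>. ennreal ((norm (fourier g \<xi>))\<^sup>2 * gaussian s \<xi>) \<partial>lborel"
  let ?K = "\<lambda>s x y. ennreal (?c * heat s (x - y))" and ?q = "\<lambda>x. ennreal ((norm (g x))\<^sup>2 / 2)"
  let ?G = "\<integral>\<^sup>+x. ennreal ((norm (g x))\<^sup>2) \<partial>lborel"
  define B where "B = ?c * (LINT x|lborel. norm (g x))"
  have B: "norm (fourier g \<xi>) \<le> B" for \<xi>
    unfolding B_def by (rule fourier_bound[OF assms])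
  have B0: "0 \<le> B" using B[of 0] norm_ge_zero order_trans by blast
  have reg: "?I s \<le> ?G" if s: "s > 0" for s
  proof -
    define k where "k = (\<lambda>\<xi>. cnj (fourier g \<xi>) * complex_of_real (gaussian s \<xi>))"
    have k_int: "integrable lborel k"
    proof (rule Bochner_Integration.integrable_bound)
      show "integrable lborel (\<lambda>\<xi>::'a. B * gaussian s \<xi>)"
        using gaussian_integrable(1)[OF s, where 'a='a] by simp
      show "k \<in> borel_measurable lborel" unfolding k_def by measurable
      show "AE \<xi> in lborel. norm (k \<xi>) \<le> norm (B * gaussian s \<xi>)"
        using B B0 by (intro always_eventually allI) (auto simp: k_def norm_mult abs_mult intro!: mult_right_mono)
    qed
    have fk: "fourier k x = complex_of_real ?c * cnj (LINT y|lborel. g y * complex_of_real (heat s (x - y)))" for x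
    proof -
      have "(LINT \<xi>|lborel. cis (- (\<xi> \<bullet> x)) * k \<xi>) = (LINT \<xi>|lborel. cnj (fourier g \<xi> * (complex_of_real (gaussian s \<xi>) * cis (\<xi> \<bullet> x))))"
        by (intro Bochner_Integration.integral_cong refl) (simp add: k_def cis_cnj)
      then show ?thesis
        unfolding fourier_smoothing[OF assms s, symmetric] by (simp only: Bochner_Integration.integral_cnj fourier_def)
    qed
    have eq: "complex_of_real ((norm (fourier g \<xi>))\<^sup>2 * gaussian s \<xi>) = fourier g \<xi> * k \<xi>" for \<xi>
      by (simp only: k_def of_real_mult complex_norm_square mult.assoc)
    have "?I s = 
       ennreal (LINT \<xi>|lborel. (norm (fourier g \<xi>))\<^sup>2 * gaussian s \<xi>)"
    proof (rule nn_integral_eq_integral)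
      show "integrable lborel (\<lambda>\<xi>. (norm (fourier g \<xi>))\<^sup>2 * gaussian s \<xi>)"
      proof (rule Bochner_Integration.integrable_bound)
        show "integrable lborel (\<lambda>\<xi>::'a. B\<^sup>2 * gaussian s \<xi>)"
          using gaussian_integrable(1)[OF s, where 'a='a] by simp
        show "AE \<xi> in lborel. norm ((norm (fourier g \<xi>))\<^sup>2 * gaussian s \<xi>) \<le> norm (B\<^sup>2 * gaussian s \<xi>)"
          using B B0 by (intro always_eventually allI) (auto simp: abs_mult intro!: mult_right_mono power_mono)
      qed measurable
    qed auto
    also have "(LINT \<xi>|lborel. (norm (fourier g \<xi>))\<^sup>2 * gaussian s \<xi>) =
       norm (LINT \<xi>|lborel. complex_of_real ((norm (fourier g \<xi>))\<^sup>2 * gaussian s \<xi>))"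
      by (simp only: integral_complex_of_real norm_of_real) (auto intro!: abs_of_nonneg[symmetric] Bochner_Integration.integral_nonneg)
    also have "(LINT \<xi>|lborel. complex_of_real ((norm (fourier g \<xi>))\<^sup>2 * gaussian s \<xi>)) = (LINT x|lborel. g x * fourier k x)"
      unfolding eq by (rule fourier_multiplication_formula[OF assms k_int])
    also have "ennreal (norm (LINT x|lborel. g x * fourier k x)) \<le> (\<integral>\<^sup>+x. ennreal (norm (g x * fourier k x)) \<partial>lborel)"
      by (rule norm_integral_le_nn_integral)
    also have "\<dots> \<le> (\<integral>\<^sup>+x. (\<integral>\<^sup>+y. ?K s x y * (?q x + ?q y) \<partial>lborel) \<partial>lborel)"
    proof (rule nn_integral_mono)
      fix x
      have "ennreal (norm (g x * fourier k x)) = ennreal (norm (g x) * ?c) * ennreal (norm (LINT y|lborel. g y * complex_of_real (heat s (x - y))))"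
        by (simp add: fk norm_mult ennreal_mult' mult.assoc)
      also have "\<dots> \<le> ennreal (norm (g x) * ?c) * (\<integral>\<^sup>+y. ennreal (norm (g y * complex_of_real (heat s (x - y)))) \<partial>lborel)"
        by (intro mult_left_mono norm_integral_le_nn_integral) auto
      also have "\<dots> = (\<integral>\<^sup>+y. ennreal (norm (g x) * ?c) * ennreal (norm (g y * complex_of_real (heat s (x - y)))) \<partial>lborel)"
        by (rule nn_integral_cmult[symmetric]) measurable
      also have "\<dots> \<le> (\<integral>\<^sup>+y. ?K s x y * (?q x + ?q y) \<partial>lborel)"
      proof (rule nn_integral_mono)
        fix y
        have am: "norm (g x) * norm (g y) \<le> (norm (g x))\<^sup>2 / 2 + (norm (g y))\<^sup>2 / 2"
          using sum_squares_bound[of "norm (g x)" "norm (g y)"] by simp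
        have h: "0 \<le> heat s (x - y)" by (rule heat_bounds(1)[OF s])
        have "norm (g x) * ?c * norm (g y * complex_of_real (heat s (x - y))) = (?c * heat s (x - y)) * (norm (g x) * norm (g y))"
          using h by (simp add: norm_mult)
        also have "\<dots> \<le> (?c * heat s (x - y)) * ((norm (g x))\<^sup>2 / 2 + (norm (g y))\<^sup>2 / 2)"
          using h by (intro mult_left_mono am) auto
        finally show "ennreal (norm (g x) * ?c) * ennreal (norm (g y * complex_of_real (heat s (x - y)))) \<le>
            ?K s x y * (?q x + ?q y)"
          using h by (simp add: ennreal_mult[symmetric] ennreal_plus[symmetric] del: ennreal_plus)
      qed
      finally show "ennreal (norm (g x * fourier k x)) \<le> (\<integral>\<^sup>+y. ?K s x y * (?q x + ?q y) \<partial>lborel)" .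
    qed
    also have "\<dots> = (\<integral>\<^sup>+x. (\<integral>\<^sup>+y. ?K s x y * ?q x \<partial>lborel) \<partial>lborel) +
        (\<integral>\<^sup>+x. (\<integral>\<^sup>+y. ?K s x y * ?q y \<partial>lborel) \<partial>lborel)"
      unfolding distrib_left by (simp add: nn_integral_add)
    also have "(\<integral>\<^sup>+x. (\<integral>\<^sup>+y. ?K s x y * ?q y \<partial>lborel) \<partial>lborel) =
       (\<integral>\<^sup>+y. (\<integral>\<^sup>+x. ?K s x y * ?q y \<partial>lborel) \<partial>lborel)"
      by (rule lborel_pair.Fubini') measurable
    also have "\<dots> = (\<integral>\<^sup>+x. (\<integral>\<^sup>+y. ?K s x y * ?q x \<partial>lborel) \<partial>lborel)"
      using heat_minus[of s "x - y" for x y :: 'a] by simp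
    also have "\<dots> = (\<integral>\<^sup>+x. ?q x \<partial>lborel)"
    proof (rule nn_integral_cong)
      fix x
      have "(\<integral>\<^sup>+y. ?K s x y * ?q x \<partial>lborel) =
         ennreal ?c * (\<integral>\<^sup>+y. ennreal (heat s (x - y)) \<partial>lborel) * ?q x"
        by (simp add: nn_integral_cmult nn_integral_multc ennreal_mult' heat_bounds(1)[OF s])
      also have "ennreal ?c * (\<integral>\<^sup>+y. ennreal (heat s (x - y)) \<partial>lborel) = 1"
        by (simp only: nn_integral_heat[OF s] ennreal_mult'[symmetric] powr_ge_zero fourier_const ennreal_1)
      finally show "(\<integral>\<^sup>+y. ?K s x y * ?q x \<partial>lborel) = ?q x"
        by simp
    qed
    also have "\<dots> + \<dots> = ?G"
      by (simp flip: nn_integral_add ennreal_plus)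
    finally show ?thesis .
  qed
  have "(\<lambda>m. gaussian (inverse (real (Suc m))) \<xi>) \<longlonglongrightarrow> gaussian 0 \<xi>" for \<xi> :: 'a
    unfolding gaussian_def by (intro tendsto_intros LIMSEQ_inverse_real_of_nat) simp_all
  then have lim: "(\<lambda>m. gaussian (inverse (real (Suc m))) \<xi>) \<longlonglongrightarrow> 1" for \<xi> :: 'a
    by (simp add: gaussian_def)
  have "(\<lambda>m. ennreal ((norm (fourier g \<xi>))\<^sup>2 * gaussian (inverse (real (Suc m))) \<xi>)) \<longlonglongrightarrow> ennreal ((norm (fourier g \<xi>))\<^sup>2 * 1)" for \<xi>
    by (intro tendsto_ennrealI tendsto_mult tendsto_const lim)
  then have "(\<integral>\<^sup>+\<xi>. ennreal ((norm (fourier g \<xi>))\<^sup>2) \<partial>lborel) =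
      (\<integral>\<^sup>+\<xi>. liminf (\<lambda>m. ennreal ((norm (fourier g \<xi>))\<^sup>2 * gaussian (inverse (real (Suc m))) \<xi>)) \<partial>lborel)"
    by (intro nn_integral_cong lim_imp_Liminf[symmetric]) auto
  also have "\<dots> \<le> liminf (\<lambda>m. ?I (inverse (real (Suc m))))"
    by (intro nn_integral_liminf) measurable
  also have "\<dots> \<le> liminf (\<lambda>m. ?G)"
    by (intro Liminf_mono always_eventually allI reg) auto
  also have "\<dots> = ?G" by (simp add: Liminf_const)
  finally show ?thesis .
qed

section \<open>Pointwise Fourier inversion\<close>

text \<open>
  Convergence to \<open>0\<close> in \<open>L\<^sub>2\<close> implies weak convergence, by the Cauchy-Schwarz inequality.
\<close>

lemma integral_product_tendsto_0:
  fixes d :: "nat \<Rightarrow> 'a \<Rightarrow> complex" and k :: "'a \<Rightarrow> complex"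
  assumes [measurable]: "\<And>m. d m \<in> borel_measurable M" "k \<in> borel_measurable M"
    and d: "(\<lambda>m. \<integral>\<^sup>+x. ennreal ((norm (d m x))\<^sup>2) \<partial>M) \<longlonglongrightarrow> 0"
    and k: "integrable M (\<lambda>x. (norm (k x))\<^sup>2)"
  shows "(\<lambda>m. LINT x|M. d m x * k x) \<longlonglongrightarrow> 0"
proof -
  define K where "K = (\<integral>\<^sup>+x. ennreal ((norm (k x))\<^sup>2) \<partial>M)"
  have K: "K < top"
    unfolding K_def using k by (auto simp: integrable_iff_bounded)
  define a where "a = (\<lambda>m. norm (LINT x|M. d m x * k x))"
  have le: "ennreal ((a m)\<^sup>2) \<le> (\<integral>\<^sup>+x. ennreal ((norm (d m x))\<^sup>2) \<partial>M) * K" for m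
  proof -
    have "ennreal ((a m)\<^sup>2) = (ennreal (a m))\<^sup>2"
      by (simp add: a_def ennreal_power)
    also have "\<dots> \<le> (\<integral>\<^sup>+x. ennreal (norm (d m x)) * ennreal (norm (k x)) \<partial>M)\<^sup>2"
      using norm_integral_le_nn_integral[of M "\<lambda>x. d m x * k x"]
      by (intro power_mono) (auto simp: a_def norm_mult ennreal_mult)
    also have "\<dots> \<le> (\<integral>\<^sup>+x. (ennreal (norm (d m x)))\<^sup>2 \<partial>M) * (\<integral>\<^sup>+x. (ennreal (norm (k x)))\<^sup>2 \<partial>M)"
      by (rule Cauchy_Schwarz_nn_integral) measurable
    finally show ?thesis by (simp add: K_def ennreal_power)
  qed
  have "(\<lambda>m. (\<integral>\<^sup>+x. ennreal ((norm (d m x))\<^sup>2) \<partial>M) * K) \<longlonglongrightarrow> 0 * K"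
    using ennreal_tendsto_cmult[OF K d] by (simp add: mult.commute)
  then have "(\<lambda>m. ennreal ((a m)\<^sup>2)) \<longlonglongrightarrow> ennreal 0"
    by (intro tendsto_sandwich[OF _ _ tendsto_const[of "ennreal 0"], of "\<lambda>m. ennreal ((a m)\<^sup>2)" sequentially "\<lambda>m. (\<integral>\<^sup>+x. ennreal ((norm (d m x))\<^sup>2) \<partial>M) * K"])
      (auto intro!: always_eventually le)
  then have "(\<lambda>m. (a m)\<^sup>2) \<longlonglongrightarrow> 0"
    by (subst (asm) tendsto_ennreal_iff) (auto intro!: always_eventually)
  then have "(\<lambda>m. sqrt ((a m)\<^sup>2)) \<longlonglongrightarrow> sqrt 0"
    by (intro tendsto_real_sqrt)
  then have "a \<longlonglongrightarrow> 0" by (simp add: a_def)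
  then show ?thesis
    unfolding a_def by (rule tendsto_norm_zero_cancel)
qed

lemma integrable_product_L2:
  fixes f g :: "'a \<Rightarrow> complex"
  assumes [measurable]: "f \<in> borel_measurable M" "g \<in> borel_measurable M"
    and "integrable M (\<lambda>x. (norm (f x))\<^sup>2)" "integrable M (\<lambda>x. (norm (g x))\<^sup>2)"
  shows "integrable M (\<lambda>x. f x * g x)"
proof (rule Bochner_Integration.integrable_bound)
  show "integrable M (\<lambda>x. (norm (f x))\<^sup>2 + (norm (g x))\<^sup>2)"
    using assms by simp
  show "AE x in M. norm (f x * g x) \<le> norm ((norm (f x))\<^sup>2 + (norm (g x))\<^sup>2)"
  proof (intro always_eventually allI)
    fix x
    have "2 * (norm (f x) * norm (g x)) \<le> (norm (f x))\<^sup>2 + (norm (g x))\<^sup>2"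
      using sum_squares_bound[of "norm (f x)" "norm (g x)"] by simp
    moreover have "0 \<le> norm (f x) * norm (g x)" by simp
    ultimately show "norm (f x * g x) \<le> norm ((norm (f x))\<^sup>2 + (norm (g x))\<^sup>2)"
      unfolding norm_mult real_norm_def by linarith
  qed
qed measurable

lemma heat_square_integrable:
  fixes x0 :: "'a::euclidean_space"
  assumes "s > 0"
  shows "integrable lborel (\<lambda>x. (heat s (x0 - x))\<^sup>2)"
proof (rule Bochner_Integration.integrable_bound)
  show "integrable lborel (\<lambda>x. 1 / s ^ DIM('a) * heat s (x0 - x))"
    using heat_integrable(1)[OF assms, of x0] by simp
  show "AE x in lborel. norm ((heat s (x0 - x))\<^sup>2) \<le> norm (1 / s ^ DIM('a) * heat s (x0 - x))"
  proof (intro always_eventually allI)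
    fix x
    show "norm ((heat s (x0 - x))\<^sup>2) \<le> norm (1 / s ^ DIM('a) * heat s (x0 - x))"
      using mult_right_mono[OF heat_bounds(2)[OF assms, of "x0 - x"] heat_bounds(1)[OF assms, of "x0 - x"]]
        heat_bounds(1)[OF assms, of "x0 - x"] assms
      by (simp add: power2_eq_square abs_mult)
  qed
qed measurable

lemma integrable_truncation:
  fixes U :: "'a::euclidean_space \<Rightarrow> complex"
  assumes [measurable]: "U \<in> borel_measurable borel" and U2: "integrable lborel (\<lambda>x. (norm (U x))\<^sup>2)"
  shows "integrable lborel (\<lambda>x. indicator (cball 0 R) x *\<^sub>R U x)"
proof (rule Bochner_Integration.integrable_bound)
  have [measurable]: "cball (0::'a) R \<in> sets borel" by simp
  show "(\<lambda>x. indicator (cball 0 R) x *\<^sub>R U x) \<in> borel_measurable lborel" by measurable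
  have "integrable lborel (indicator (cball 0 R) :: 'a \<Rightarrow> real)"
    by (intro integrable_real_indicator emeasure_bounded_finite) auto
  then show "integrable lborel (\<lambda>x::'a. indicator (cball 0 R) x + (norm (U x))\<^sup>2 :: real)"
    by (intro Bochner_Integration.integrable_add U2)
  show "AE x in lborel. norm (indicator (cball 0 R) x *\<^sub>R U x) \<le> norm (indicator (cball 0 R) x + (norm (U x))\<^sup>2 :: real)"
  proof (intro always_eventually allI)
    fix x
    have "2 * norm (U x) \<le> 1 + (norm (U x))\<^sup>2"
      using sum_squares_bound[of 1 "norm (U x)"] by simp
    moreover have "0 \<le> norm (U x)" by simp
    ultimately have "norm (U x) \<le> 1 + (norm (U x))\<^sup>2" by linarith
    then show "norm (indicator (cball 0 R) x *\<^sub>R U x) \<le> norm (indicator (cball 0 R) x + (norm (U x))\<^sup>2 :: real)"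
      by (auto simp: indicator_def)
  qed
qed

text \<open>
  The smoothing formula extends from integrable functions to a function \<open>U\<close> whose transform \<open>h\<close> is
  only an \<open>L\<^sub>2\<close> limit: it holds for the restrictions of \<open>U\<close> to balls, and both sides pass to the limit,
  the left one by weak convergence and the right one by dominated convergence.
\<close>

lemma fourier_smoothing_L2:
  fixes U h :: "'a::euclidean_space \<Rightarrow> complex"
  assumes [measurable]: "U \<in> borel_measurable borel" "h \<in> borel_measurable borel"
    and U2: "integrable lborel (\<lambda>x. (norm (U x))\<^sup>2)" and h2: "integrable lborel (\<lambda>x. (norm (h x))\<^sup>2)"
    and lim: "((\<lambda>R. \<integral>\<^sup>+ \<xi>. ennreal ((norm (h \<xi> - fourier (\<lambda>x. indicator (cball 0 R) x *\<^sub>R U x) \<xi>))\<^sup>2) \<partial>lborel) \<longlongrightarrow> 0) at_top"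
    and s: "s > 0"
  shows "(LINT \<xi>|lborel. h \<xi> * (complex_of_real (gaussian s \<xi>) * cis (\<xi> \<bullet> x0))) =
    (LINT x|lborel. U x * complex_of_real (heat s (x0 - x)))"
proof -
  define V where "V = (\<lambda>m::nat. \<lambda>x. indicator (cball 0 (real m)) x *\<^sub>R U x)"
  define k where "k = (\<lambda>\<xi>. complex_of_real (gaussian s \<xi>) * cis (\<xi> \<bullet> x0))"
  have [measurable]: "cball (0::'a) r \<in> sets borel" for r by simp
  have [measurable]: "k \<in> borel_measurable borel" "V m \<in> borel_measurable borel" for m
    unfolding k_def V_def by measurable
  have k_int: "integrable lborel k"
    unfolding k_def by (rule gaussian_fourier_shift(1)[OF s])
  have k1: "norm (k \<xi>) \<le> 1" for \<xi> by (simp add: k_def norm_mult)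
  have k2: "integrable lborel (\<lambda>x. (norm (k x))\<^sup>2)"
  proof (rule Bochner_Integration.integrable_bound)
    show "integrable lborel (\<lambda>x. norm (k x))" using k_int by simp
    show "AE x in lborel. norm ((norm (k x))\<^sup>2) \<le> norm (norm (k x))"
      using k1 by (intro always_eventually allI) (simp add: power2_eq_square mult_left_le_one_le)
  qed measurable
  have V: "integrable lborel (V m)" for m
    unfolding V_def by (rule integrable_truncation[OF assms(1) U2])
  have hk: "integrable lborel (\<lambda>\<xi>. h \<xi> * k \<xi>)"
    by (rule integrable_product_L2[OF _ _ h2 k2]) measurable
  have fk: "integrable lborel (\<lambda>\<xi>. fourier (V m) \<xi> * k \<xi>)" for m
  proof (rule Bochner_Integration.integrable_bound)
    let ?B = "(2 * pi) powr (- real DIM('a) / 2) * (LINT x|lborel. norm (V m x))"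
    show "integrable lborel (\<lambda>\<xi>. ?B *\<^sub>R k \<xi>)"
      using k_int by (intro integrable_scaleR_right)
    show "AE \<xi> in lborel. norm (fourier (V m) \<xi> * k \<xi>) \<le> norm (?B *\<^sub>R k \<xi>)"
      using fourier_bound[OF V, of m] by (intro always_eventually allI) (auto simp: norm_mult intro!: mult_right_mono)
  qed measurable
  have "(\<lambda>m. \<integral>\<^sup>+ \<xi>. ennreal ((norm (h \<xi> - fourier (V m) \<xi>))\<^sup>2) \<partial>lborel) \<longlonglongrightarrow> 0"
    unfolding V_def by (rule filterlim_compose[OF lim filterlim_real_sequentially])
  then have "(\<lambda>m. LINT \<xi>|lborel. (h \<xi> - fourier (V m) \<xi>) * k \<xi>) \<longlonglongrightarrow> 0"
    by (intro integral_product_tendsto_0 k2) (auto simp: measurable_lborel1)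
  moreover have "(LINT \<xi>|lborel. (h \<xi> - fourier (V m) \<xi>) * k \<xi>) =
     (LINT \<xi>|lborel. h \<xi> * k \<xi>) - (LINT x|lborel. V m x * complex_of_real (heat s (x0 - x)))" for m
    using hk fk[of m] fourier_smoothing[OF V s, of m x0] by (simp add: left_diff_distrib k_def)
  ultimately have "(\<lambda>m. (LINT \<xi>|lborel. h \<xi> * k \<xi>) - (LINT x|lborel. V m x * complex_of_real (heat s (x0 - x)))) \<longlonglongrightarrow> 0"
    by simp
  from tendsto_diff[OF tendsto_const[of "LINT \<xi>|lborel. h \<xi> * k \<xi>"] this]
  have l1: "(\<lambda>m. LINT x|lborel. V m x * complex_of_real (heat s (x0 - x))) \<longlonglongrightarrow> (LINT \<xi>|lborel. h \<xi> * k \<xi>)"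
    by simp
  have l2: "(\<lambda>m. LINT x|lborel. V m x * complex_of_real (heat s (x0 - x))) \<longlonglongrightarrow> (LINT x|lborel. U x * complex_of_real (heat s (x0 - x)))"
  proof (rule integral_dominated_convergence)
    show "integrable lborel (\<lambda>x. norm (U x * complex_of_real (heat s (x0 - x))))"
      by (intro integrable_norm integrable_product_L2 U2) (auto intro!: heat_square_integrable[OF s])
    show "AE x in lborel. (\<lambda>m. V m x * complex_of_real (heat s (x0 - x))) \<longlonglongrightarrow> U x * complex_of_real (heat s (x0 - x))"
    proof (intro always_eventually allI tendsto_mult tendsto_const)
      fix x :: 'a
      obtain m0 where "norm x \<le> real m0" using real_arch_simple by blast
      then have "eventually (\<lambda>m. V m x = U x) sequentially"
        by (intro eventually_sequentiallyI[of m0]) (auto simp: V_def)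
      then show "(\<lambda>m. V m x) \<longlonglongrightarrow> U x"
        by (rule tendsto_eventually)
    qed
    show "AE x in lborel. norm (V m x * complex_of_real (heat s (x0 - x))) \<le> norm (U x * complex_of_real (heat s (x0 - x)))" for m
      by (intro always_eventually allI) (auto simp: V_def indicator_def)
  qed measurable
  from LIMSEQ_unique[OF l1 l2] show ?thesis unfolding k_def .
qed

text \<open>
  Only the values of \<open>U\<close> near \<open>x0\<close> matter in the limit. Near \<open>x0\<close> continuity of \<open>u\<close> makes the error
  small; at distance at least \<open>\<delta>\<close> the kernel with \<open>s = 1 / (m + 1)\<close> is the kernel with \<open>s = 1\<close> times a
  factor that tends to \<open>0\<close>. Since \<open>u\<close> is continuous, the limit is identified at each point and
  not merely almost everywhere.
\<close>

lemma heat_approximate_identity: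
  fixes U :: "'a::euclidean_space \<Rightarrow> complex" and u :: "'a \<Rightarrow> complex"
  assumes [measurable]: "U \<in> borel_measurable borel"
    and U2: "integrable lborel (\<lambda>x. (norm (U x))\<^sup>2)"
    and "open S" "continuous_on S u" "x0 \<in> S" and AE: "AE x in lborel. x \<in> S \<longrightarrow> U x = u x"
  shows "(\<lambda>m. LINT x|lborel. U x * complex_of_real (heat (1 / real (Suc m)) (x0 - x))) \<longlonglongrightarrow>
     complex_of_real (sqrt (2 * pi) ^ DIM('a)) * u x0"
proof -
  let ?L = "sqrt (2 * pi) ^ DIM('a)"
  let ?H = "\<lambda>m x. heat (1 / real (Suc m)) (x0 - x)"
  let ?err = "\<lambda>m. norm ((LINT x|lborel. U x * complex_of_real (?H m x)) - ?L * u x0)"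
  let ?a = "\<lambda>\<delta> m. real (Suc m) ^ DIM('a) * exp (- (\<delta>\<^sup>2 * ((real (Suc m))\<^sup>2 - 1) / 2))"
  have pos: "1 / real (Suc m) > 0" for m by simp
  have UH: "integrable lborel (\<lambda>x. U x * complex_of_real (?H m x))" for m
    by (intro integrable_product_L2 U2) (auto intro!: heat_square_integrable)
  have H: "integrable lborel (\<lambda>x. u x0 * complex_of_real (?H m x))" for m
    using heat_integrable(1)[OF pos] by (intro integrable_mult_right integrable_of_real) 
  define w where "w = (\<lambda>x. (norm (U x) + norm (u x0)) * heat 1 (x0 - x))"
  \<comment> \<open>The error away from \<open>x0\<close> is a small multiple of the integral of \<open>w\<close>.\<close>
  have w_int: "integrable lborel w"
  proof -
    have "integrable lborel (\<lambda>x. norm (U x * complex_of_real (heat 1 (x0 - x))) + norm (u x0) * heat 1 (x0 - x))"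
      by (intro Bochner_Integration.integrable_add integrable_norm integrable_product_L2 U2 integrable_mult_right heat_integrable)
        (auto intro!: heat_square_integrable)
    then show ?thesis
      using heat_bounds(1)[of 1, where 'a='a] by (simp add: w_def norm_mult distrib_right)
  qed
  define W where "W = (LINT x|lborel. w x)"
  have bound: "\<exists>\<delta>>0. \<forall>m. ?err m \<le> e * ?L + ?a \<delta> m * W"
    if e: "e > 0" for e
  proof -
    obtain d1 where d1: "d1 > 0" "ball x0 d1 \<subseteq> S" using assms(3,5) openE by blast
    obtain d2 where d2: "d2 > 0" "\<And>x. x \<in> S \<Longrightarrow> dist x x0 < d2 \<Longrightarrow> dist (u x) (u x0) < e"
      using assms(4)[unfolded continuous_on_iff, rule_format, OF assms(5) e] by blast
    define \<delta> where "\<delta> = min d1 d2"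
    have \<delta>: "\<delta> > 0" using d1 d2 by (simp add: \<delta>_def)
    have near: "norm (u x - u x0) \<le> e \<and> x \<in> S" if "norm (x0 - x) < \<delta>" for x
      using d1 d2(2)[of x] that by (auto simp: \<delta>_def dist_norm norm_minus_commute subset_iff)
    have "?err m \<le> e * ?L + ?a \<delta> m * W" for m
    proof -
      define a where "a = ?a \<delta> m"
      have a0: "a \<ge> 0" by (simp add: a_def)
      \<comment> \<open>For \<open>n = norm (x0 - x) \<ge> \<delta>\<close> and \<open>q = m + 1\<close>: \<open>q\<^sup>2 * n\<^sup>2 \<ge> n\<^sup>2 + \<delta>\<^sup>2 * (q\<^sup>2 - 1)\<close>.\<close>
      have far: "?H m x \<le> a * heat 1 (x0 - x)" if "norm (x0 - x) \<ge> \<delta>" for x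
      proof -
        have aux: "- (q * b) / 2 \<le> - (a * (q - 1) / 2) + - b / 2" if "a * (q - 1) \<le> b * (q - 1)" for a b q :: real
          using that by (simp add: right_diff_distrib mult.commute diff_divide_distrib)
        have "\<delta>\<^sup>2 * ((real (Suc m))\<^sup>2 - 1) \<le> (norm (x0 - x))\<^sup>2 * ((real (Suc m))\<^sup>2 - 1)"
          using that \<delta> by (intro mult_right_mono power_mono) auto
        then have "- (real (Suc m) * norm (x0 - x))\<^sup>2 / 2 \<le> - (\<delta>\<^sup>2 * ((real (Suc m))\<^sup>2 - 1) / 2) + - (norm (x0 - x))\<^sup>2 / 2"
          unfolding power_mult_distrib by (rule aux)
        then have "exp (- (real (Suc m) * norm (x0 - x))\<^sup>2 / 2) \<le> exp (- (\<delta>\<^sup>2 * ((real (Suc m))\<^sup>2 - 1) / 2)) * exp (- (norm (x0 - x))\<^sup>2 / 2)"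
          by (simp only: exp_le_cancel_iff flip: exp_add)
        from mult_left_mono[OF this, of "real (Suc m) ^ DIM('a)"] show ?thesis
          unfolding heat_def gaussian_def a_def by (simp add: power_divide mult_ac)
      qed
      have L: "?L * u x0 = (LINT x|lborel. u x0 * complex_of_real (?H m x))"
        using heat_integrable(2)[OF pos, of m x0] by simp
      have "(LINT x|lborel. U x * complex_of_real (?H m x)) - ?L * u x0 = (LINT x|lborel. U x * complex_of_real (?H m x) - u x0 * complex_of_real (?H m x))"
        unfolding L by (rule Bochner_Integration.integral_diff[symmetric, OF UH H])
      also have "norm \<dots> \<le> (LINT x|lborel. norm (U x * complex_of_real (?H m x) - u x0 * complex_of_real (?H m x)))"
        by (rule integral_norm_bound)
      also have "\<dots> \<le> (LINT x|lborel. e * ?H m x + a * w x)"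
      proof (rule integral_mono_AE)
        show "integrable lborel (\<lambda>x. norm (U x * complex_of_real (?H m x) - u x0 * complex_of_real (?H m x)))"
          by (intro integrable_norm Bochner_Integration.integrable_diff UH H)
        show "integrable lborel (\<lambda>x. e * ?H m x + a * w x)"
          by (intro Bochner_Integration.integrable_add integrable_mult_right heat_integrable w_int) simp
        show "AE x in lborel. norm (U x * complex_of_real (?H m x) - u x0 * complex_of_real (?H m x)) \<le> e * ?H m x + a * w x"
          using AE
        proof eventually_elim
          fix x assume x: "x \<in> S \<longrightarrow> U x = u x"
          have h0: "?H m x \<ge> 0" "heat 1 (x0 - x) \<ge> 0" using heat_bounds(1)[OF pos] heat_bounds(1)[of 1] by auto
          have w0: "0 \<le> a * w x" using a0 h0 by (simp add: w_def)
          have eq: "norm (U x * complex_of_real (?H m x) - u x0 * complex_of_real (?H m x)) = norm (U x - u x0) * ?H m x"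
            using h0 by (simp add: norm_mult flip: left_diff_distrib)
          show "norm (U x * complex_of_real (?H m x) - u x0 * complex_of_real (?H m x)) \<le> e * ?H m x + a * w x"
          proof (cases "norm (x0 - x) < \<delta>")
            case True
            then have "norm (U x - u x0) * ?H m x \<le> e * ?H m x" using near[of x] x h0 by (intro mult_right_mono) auto
            then show ?thesis unfolding eq using w0 by linarith
          next
            case False
            have "norm (U x - u x0) * ?H m x \<le> (norm (U x) + norm (u x0)) * (a * heat 1 (x0 - x))"
              using False h0 by (intro mult_mono norm_triangle_ineq4 far) auto
            also have "\<dots> = a * w x" by (simp add: w_def mult_ac)
            also have "\<dots> \<le> e * ?H m x + a * w x" using h0 \<open>e > 0\<close> by simp
            finally show ?thesis unfolding eq .
          qed
        qed
      qed
      also have "\<dots> = e * ?L + a * W"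
        unfolding W_def using heat_integrable[OF pos, of m x0] w_int by simp
      finally show ?thesis unfolding a_def .
    qed
    then show ?thesis using \<delta> by blast
  qed
  show ?thesis
  proof (rule LIMSEQ_I)
    fix r :: real assume r: "r > 0"
    have L0: "?L > 0" by simp
    define e where "e = r / (2 * ?L)"
    have e: "e > 0" "e * ?L = r / 2" using r L0 by (auto simp: e_def)
    obtain \<delta> where \<delta>: "\<delta> > 0" "\<And>m. ?err m \<le> e * ?L + ?a \<delta> m * W"
      using bound[OF e(1)] by blast
    have "(\<lambda>m. real (Suc m) ^ d * exp (- (\<delta>\<^sup>2 * ((real (Suc m))\<^sup>2 - 1) / 2)) * W) \<longlonglongrightarrow> 0" for d
      using \<delta>(1) by real_asymp
    from LIMSEQ_D[OF this[of "DIM('a)"], of "r/2"] r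
    obtain m0 where m0: "\<And>m. m \<ge> m0 \<Longrightarrow> norm (?a \<delta> m * W - 0) < r / 2"
      by auto
    show "\<exists>no. \<forall>n\<ge>no. ?err n < r"
    proof (intro exI allI impI)
      fix m assume "m \<ge> m0"
      from m0[OF this] have "?a \<delta> m * W < r / 2"
        unfolding diff_zero real_norm_def by (rule order_le_less_trans[OF abs_ge_self])
      then show "?err m < r"
        using \<delta>(2)[of m] e(2) by linarith
    qed
  qed
qed

text \<open>
  Let the width of the damping Gaussian grow in the smoothing formula: one side converges because
  \<open>h\<close> is integrable, the other because the heat kernel is an approximate identity.
\<close>

theorem fourier_inversion_L2:
  fixes U h u :: "'a::euclidean_space \<Rightarrow> complex"
  assumes [measurable]: "U \<in> borel_measurable borel" and U2: "integrable lborel (\<lambda>x. (norm (U x))\<^sup>2)"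
    and h1: "integrable lborel h" and h2: "integrable lborel (\<lambda>x. (norm (h x))\<^sup>2)"
    and lim: "((\<lambda>R. \<integral>\<^sup>+ \<xi>. ennreal ((norm (h \<xi> - fourier (\<lambda>x. indicator (cball 0 R) x *\<^sub>R U x) \<xi>))\<^sup>2) \<partial>lborel) \<longlongrightarrow> 0) at_top"
    and S: "open S" "continuous_on S u" "x0 \<in> S" and AE: "AE x in lborel. x \<in> S \<longrightarrow> U x = u x"
  shows "(LINT \<xi>|lborel. h \<xi> * cis (\<xi> \<bullet> x0)) = complex_of_real (sqrt (2 * pi) ^ DIM('a)) * u x0"
proof -
  have [measurable]: "h \<in> borel_measurable borel"
    using h1 by (auto simp: integrable_iff_bounded)
  let ?k = "\<lambda>m \<xi>. h \<xi> * (complex_of_real (gaussian (1 / real (Suc m)) \<xi>) * cis (\<xi> \<bullet> x0))"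
  have "(\<lambda>m. LINT \<xi>|lborel. ?k m \<xi>) \<longlonglongrightarrow> (LINT \<xi>|lborel. h \<xi> * cis (\<xi> \<bullet> x0))"
  proof (rule integral_dominated_convergence)
    show "integrable lborel (\<lambda>\<xi>. norm (h \<xi>))" using h1 by simp
    show "AE \<xi> in lborel. (\<lambda>m. ?k m \<xi>) \<longlonglongrightarrow> h \<xi> * cis (\<xi> \<bullet> x0)"
    proof (intro always_eventually allI)
      fix \<xi>
      have "(\<lambda>m. 1 / real (Suc m)) \<longlonglongrightarrow> 0"
        using LIMSEQ_inverse_real_of_nat by (simp add: inverse_eq_divide)
      then have "(\<lambda>m. ?k m \<xi>) \<longlonglongrightarrow> h \<xi> * (complex_of_real (gaussian 0 \<xi>) * cis (\<xi> \<bullet> x0))"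
        unfolding gaussian_def by (intro tendsto_intros) simp_all
      then show "(\<lambda>m. ?k m \<xi>) \<longlonglongrightarrow> h \<xi> * cis (\<xi> \<bullet> x0)"
        by (simp add: gaussian_def)
    qed
    show "AE \<xi> in lborel. norm (?k m \<xi>) \<le> norm (h \<xi>)" for m
      by (intro always_eventually allI) (simp add: norm_mult mult_left_le)
  qed measurable
  moreover have "(LINT \<xi>|lborel. ?k m \<xi>) = (LINT x|lborel. U x * complex_of_real (heat (1 / real (Suc m)) (x0 - x)))" for m
    by (rule fourier_smoothing_L2[OF _ _ U2 h2 lim]) auto
  ultimately show ?thesis
    using heat_approximate_identity[OF assms(1) U2 S AE] LIMSEQ_unique by simp
qed

section \<open>The Sobolev embedding into continuously differentiable functions\<close>

lemma nn_integral_powr_half_line: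
  assumes "q > 1"
  shows "(\<integral>\<^sup>+x. ennreal ((1 + x) powr (- q)) * indicator {0..} x \<partial>lborel) < top"
proof -
  have "filterlim (\<lambda>x::real. 1 + x) at_top at_top" by real_asymp
  then have "((\<lambda>x::real. (1 + x) powr (1 - q)) \<longlongrightarrow> 0) at_top"
    using assms by (intro tendsto_neg_powr) auto
  then have "((\<lambda>x::real. (1 + x) powr (1 - q) / (1 - q)) \<longlongrightarrow> 0 / (1 - q)) at_top"
    using assms by (intro tendsto_divide tendsto_const) auto
  then have "((\<lambda>x. (1 + x) powr (1 - q) / (1 - q)) \<longlongrightarrow> 0) at_top" by simp
  then have "(\<integral>\<^sup>+x. ennreal ((1 + x) powr (- q)) * indicator {0..} x \<partial>lborel) = ennreal (0 - (1 + 0) powr (1 - q) / (1 - q))"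
    using assms by (intro nn_integral_FTC_atLeast) (auto intro!: derivative_eq_intros)
  then show ?thesis by simp
qed

text \<open>
  The integrand is even and, up to the constant \<open>2 powr q\<close>, dominated by a power of \<open>1 + \<bar>x\<bar>\<close>.
\<close>

lemma nn_integral_weight_1d:
  assumes "q > 1 / 2"
  shows "(\<integral>\<^sup>+x. ennreal ((1 + x\<^sup>2) powr (- q)) \<partial>lborel) < top"
proof -
  let ?I = "\<integral>\<^sup>+x. ennreal ((1 + x) powr (- (2 * q))) * indicator {0..} x \<partial>lborel"
  have le: "(1 + x\<^sup>2) powr (- q) \<le> 2 powr q * (1 + \<bar>x\<bar>) powr (- (2 * q))" for x :: real
  proof -
    have "(1 + \<bar>x\<bar>)\<^sup>2 / 2 \<le> 1 + x\<^sup>2"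
      using sum_squares_bound[of 1 "\<bar>x\<bar>"] by (simp add: power2_eq_square algebra_simps)
    then have "(1 + x\<^sup>2) powr (- q) \<le> ((1 + \<bar>x\<bar>)\<^sup>2 / 2) powr (- q)"
      using assms by (intro powr_mono2') auto
    also have "\<dots> = 2 powr q * (1 + \<bar>x\<bar>) powr (- (2 * q))"
    proof -
      have "(1 + \<bar>x\<bar>)\<^sup>2 = (1 + \<bar>x\<bar>) powr 2" by (simp add: powr_numeral)
      then have "((1 + \<bar>x\<bar>)\<^sup>2) powr (- q) = (1 + \<bar>x\<bar>) powr (- (2 * q))" by (simp only: powr_powr) simp
      then show ?thesis by (simp only: powr_divide abs_ge_zero) (simp add: powr_minus_divide)
    qed
    finally show ?thesis .
  qed
  have "(\<integral>\<^sup>+x. ennreal ((1 + x\<^sup>2) powr (- q)) \<partial>lborel) \<le>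
     (\<integral>\<^sup>+x. ennreal (2 powr q) * (ennreal ((1 + x) powr (- (2 * q))) * indicator {0..} x + ennreal ((1 - x) powr (- (2 * q))) * indicator {0..} (- x)) \<partial>lborel)"
  proof (rule nn_integral_mono)
    fix x :: real
    have "ennreal ((1 + x\<^sup>2) powr (- q)) \<le> ennreal (2 powr q) * ennreal ((1 + \<bar>x\<bar>) powr (- (2 * q)))"
      using le[of x] by (simp add: ennreal_mult[symmetric] ennreal_leI)
    also have "\<dots> \<le> ennreal (2 powr q) * (ennreal ((1 + x) powr (- (2 * q))) * indicator {0..} x + ennreal ((1 - x) powr (- (2 * q))) * indicator {0..} (- x))"
      by (intro mult_left_mono) (auto simp: indicator_def abs_if)
    finally show "ennreal ((1 + x\<^sup>2) powr (- q)) \<le> ennreal (2 powr q) * (ennreal ((1 + x) powr (- (2 * q))) * indicator {0..} x + ennreal ((1 - x) powr (- (2 * q))) * indicator {0..} (- x))" .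
  qed
  also have "\<dots> = ennreal (2 powr q) * (?I + (\<integral>\<^sup>+x. ennreal ((1 - x) powr (- (2 * q))) * indicator {0..} (- x) \<partial>lborel))"
    by (simp add: nn_integral_cmult nn_integral_add)
  also have "(\<integral>\<^sup>+x. ennreal ((1 - x) powr (- (2 * q))) * indicator {0..} (- x) \<partial>lborel) = ?I"
    by (subst nn_integral_real_affine[where c = "-1" and t = 0]) auto
  also have "ennreal (2 powr q) * (?I + ?I) < top"
    using nn_integral_powr_half_line[of "2 * q"] assms by (auto simp: ennreal_mult_less_top)
  finally show ?thesis .
qed

text \<open>
  Each coordinate is bounded by the norm, so the \<open>n\<close>-th root of the weight is at most the same
  weight of one coordinate; the product of these bounds integrates coordinatewise.
\<close>

lemma integrable_weight:
  assumes "r > real DIM('a) / 2"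
  shows "integrable lborel (\<lambda>\<xi>::'a::euclidean_space. (1 + (norm \<xi>)\<^sup>2) powr (- r))"
proof (rule integrableI_bounded)
  let ?d = "real DIM('a)"
  let ?q = "r / ?d"
  have d: "?d > 0" by simp
  have q: "?q > 1 / 2" using assms d by (simp add: field_simps)
  have le: "(1 + (norm \<xi>)\<^sup>2) powr (- r) \<le> (\<Prod>b\<in>Basis. (1 + (\<xi> \<bullet> b)\<^sup>2) powr (- ?q))" for \<xi> :: 'a
  proof -
    have pos: "0 < 1 + (norm \<xi>)\<^sup>2" by (simp add: add_pos_nonneg)
    have "(1 + (norm \<xi>)\<^sup>2) powr (- r) = ((1 + (norm \<xi>)\<^sup>2) powr (- ?q)) ^ DIM('a)"
      using d pos by (subst powr_power) auto
    also have "\<dots> = (\<Prod>b\<in>(Basis::'a set). (1 + (norm \<xi>)\<^sup>2) powr (- ?q))" by simp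
    also have "\<dots> \<le> (\<Prod>b\<in>Basis. (1 + (\<xi> \<bullet> b)\<^sup>2) powr (- ?q))"
    proof (intro prod_mono conjI powr_mono2')
      fix b :: 'a assume b: "b \<in> Basis"
      show "- ?q \<le> 0" using q by linarith
      show "0 < 1 + (\<xi> \<bullet> b)\<^sup>2" by (simp add: add_pos_nonneg)
      have "\<bar>\<xi> \<bullet> b\<bar>\<^sup>2 \<le> (norm \<xi>)\<^sup>2" by (intro power_mono Basis_le_norm b) auto
      then show "1 + (\<xi> \<bullet> b)\<^sup>2 \<le> 1 + (norm \<xi>)\<^sup>2" by simp
    qed auto
    finally show ?thesis .
  qed
  have "(\<integral>\<^sup>+\<xi>. ennreal (norm ((1 + (norm (\<xi>::'a))\<^sup>2) powr (- r))) \<partial>lborel) \<le> (\<integral>\<^sup>+\<xi>. (\<Prod>b\<in>Basis. ennreal ((1 + ((\<xi>::'a) \<bullet> b)\<^sup>2) powr (- ?q))) \<partial>lborel)"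
    using le by (intro nn_integral_mono) (simp add: prod_ennreal ennreal_leI)
  also have "\<dots> = (\<Prod>b\<in>(Basis::'a set). (\<integral>\<^sup>+x. ennreal ((1 + x\<^sup>2) powr (- ?q)) \<partial>lborel))"
    by (rule nn_integral_lborel_prod) auto
  also have "\<dots> < top"
    using nn_integral_weight_1d[OF q] by (simp add: power_less_top_ennreal)
  finally show "(\<integral>\<^sup>+\<xi>. ennreal (norm ((1 + (norm (\<xi>::'a))\<^sup>2) powr (- r))) \<partial>lborel) < \<infinity>" by simp
qed measurable

text \<open>
  The constant of the Sobolev embedding, up to normalisation.
\<close>

definition weight_const :: "'a::euclidean_space itself \<Rightarrow> real \<Rightarrow> real" where
  "weight_const _ r = sqrt (LINT \<xi>::'a|lborel. (1 + (norm \<xi>)\<^sup>2) powr (- r))"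

text \<open>
  The Cauchy-Schwarz inequality for the splitting of \<open>(1 + \<bar>\<xi>\<bar>\<^sup>2) powr (1 / 2)\<close> into the powers
  \<open>s / 2\<close> and \<open>(1 - s) / 2\<close>. The weight \<open>sqrt (1 + \<bar>\<xi>\<bar>\<^sup>2)\<close> dominates both \<open>1\<close> and \<open>\<bar>\<xi>\<bar>\<close>, hence one
  bound controls a function together with its gradient.
\<close>

lemma weighted_L1_bound:
  fixes h :: "'a::euclidean_space \<Rightarrow> complex"
  assumes [measurable]: "h \<in> borel_measurable borel" and s: "s > real DIM('a) / 2 + 1"
    and h: "integrable lborel (\<lambda>\<xi>. (1 + (norm \<xi>)\<^sup>2) powr s * (norm (h \<xi>))\<^sup>2)"
  shows "integrable lborel (\<lambda>\<xi>. sqrt (1 + (norm \<xi>)\<^sup>2) * norm (h \<xi>))"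
    and "(LINT \<xi>|lborel. sqrt (1 + (norm \<xi>)\<^sup>2) * norm (h \<xi>)) \<le>
      weight_const TYPE('a) (s - 1) * sqrt (LINT \<xi>|lborel. (1 + (norm \<xi>)\<^sup>2) powr s * (norm (h \<xi>))\<^sup>2)"
proof -
  let ?p = "\<lambda>\<xi>::'a. 1 + (norm \<xi>)\<^sup>2"
  let ?J = "\<integral>\<^sup>+\<xi>. ennreal (sqrt (?p \<xi>) * norm (h \<xi>)) \<partial>lborel"
  let ?A = "LINT \<xi>|lborel. ?p \<xi> powr s * (norm (h \<xi>))\<^sup>2"
  let ?B = "LINT \<xi>|lborel. ?p \<xi> powr (- (s - 1))"
  have B: "integrable lborel (\<lambda>\<xi>::'a. ?p \<xi> powr (- (s - 1)))"
    using s by (intro integrable_weight) simp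
  have pos: "?p \<xi> > 0" for \<xi> by (simp add: add_pos_nonneg)
  then have nz: "?p \<xi> \<noteq> 0" for \<xi> by (metis less_irrefl)
  have A0: "?A \<ge> 0" "?B \<ge> 0" by (auto intro!: Bochner_Integration.integral_nonneg)
  have J1: "?J = (\<integral>\<^sup>+\<xi>. ennreal (?p \<xi> powr (s / 2) * norm (h \<xi>)) * ennreal (?p \<xi> powr ((1 - s) / 2)) \<partial>lborel)"
  proof (rule nn_integral_cong)
    fix \<xi>
    have "?p \<xi> powr (s / 2) * ?p \<xi> powr ((1 - s) / 2) = sqrt (?p \<xi>)"
      using pos[of \<xi>] by (simp add: powr_add[symmetric] add_divide_distrib[symmetric] powr_half_sqrt)
    then have "sqrt (?p \<xi>) * norm (h \<xi>) = (?p \<xi> powr (s / 2) * norm (h \<xi>)) * ?p \<xi> powr ((1 - s) / 2)"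
      by (simp only: mult_ac)
    then show "ennreal (sqrt (?p \<xi>) * norm (h \<xi>)) = ennreal (?p \<xi> powr (s / 2) * norm (h \<xi>)) * ennreal (?p \<xi> powr ((1 - s) / 2))"
      by (simp only: ennreal_mult'' powr_ge_zero)
  qed
  have "?J\<^sup>2 \<le> (\<integral>\<^sup>+\<xi>. (ennreal (?p \<xi> powr (s / 2) * norm (h \<xi>)))\<^sup>2 \<partial>lborel) * (\<integral>\<^sup>+\<xi>. (ennreal (?p \<xi> powr ((1 - s) / 2)))\<^sup>2 \<partial>lborel)"
    unfolding J1 by (rule Cauchy_Schwarz_nn_integral) measurable
  also have "(\<integral>\<^sup>+\<xi>. (ennreal (?p \<xi> powr (s / 2) * norm (h \<xi>)))\<^sup>2 \<partial>lborel) = (\<integral>\<^sup>+\<xi>. ennreal (?p \<xi> powr s * (norm (h \<xi>))\<^sup>2) \<partial>lborel)"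
    by (intro nn_integral_cong) (simp add: ennreal_power power_mult_distrib powr_power nz)
  also have "\<dots> = ennreal ?A"
    by (rule nn_integral_eq_integral[OF h]) auto
  also have "(\<integral>\<^sup>+\<xi>. (ennreal (?p \<xi> powr ((1 - s) / 2)))\<^sup>2 \<partial>lborel) = (\<integral>\<^sup>+\<xi>. ennreal (?p \<xi> powr (- (s - 1))) \<partial>lborel)"
    by (intro nn_integral_cong) (simp add: ennreal_power powr_power nz diff_divide_distrib)
  also have "\<dots> = ennreal ?B"
    by (rule nn_integral_eq_integral[OF B]) auto
  finally have J: "?J\<^sup>2 \<le> ennreal (?A * ?B)"
    using A0 by (simp add: ennreal_mult)
  have "?J \<noteq> top"
  proof
    assume "?J = top"
    then show False using J by (simp add: power2_eq_square top_unique)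
  qed
  then show i: "integrable lborel (\<lambda>\<xi>. sqrt (?p \<xi>) * norm (h \<xi>))"
    by (intro integrableI_bounded) (auto simp: less_top abs_mult)
  have "?J = ennreal (LINT \<xi>|lborel. sqrt (?p \<xi>) * norm (h \<xi>))"
    by (rule nn_integral_eq_integral[OF i]) auto
  moreover have "(LINT \<xi>|lborel. sqrt (?p \<xi>) * norm (h \<xi>)) \<ge> 0" by (auto intro!: Bochner_Integration.integral_nonneg)
  ultimately have "(LINT \<xi>|lborel. sqrt (?p \<xi>) * norm (h \<xi>))\<^sup>2 \<le> ?A * ?B"
    using J A0 by (simp add: ennreal_power)
  then have "(LINT \<xi>|lborel. sqrt (?p \<xi>) * norm (h \<xi>)) \<le> sqrt (?A * ?B)"
    by (rule real_le_rsqrt)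
  then show "(LINT \<xi>|lborel. sqrt (?p \<xi>) * norm (h \<xi>)) \<le> weight_const TYPE('a) (s - 1) * sqrt ?A"
    by (simp add: weight_const_def real_sqrt_mult mult.commute)
qed

text \<open>
  Differentiation under the integral sign. The difference quotients are dominated by
  \<open>2 * norm \<xi> * norm (h \<xi>)\<close> and converge pointwise, by the first two Taylor estimates of \<open>cis\<close>.
\<close>

lemma fourier_integral_has_derivative:
  fixes h :: "'a::euclidean_space \<Rightarrow> complex"
  assumes h: "integrable lborel h" and h1: "integrable lborel (\<lambda>\<xi>. norm \<xi> * norm (h \<xi>))"
  shows "((\<lambda>x. LINT \<xi>|lborel. h \<xi> * cis (\<xi> \<bullet> x)) has_derivative
      (\<lambda>d. LINT \<xi>|lborel. h \<xi> * (\<i> * complex_of_real (\<xi> \<bullet> d) * cis (\<xi> \<bullet> x)))) (at x)"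
    and "norm (LINT \<xi>|lborel. h \<xi> * (\<i> * complex_of_real (\<xi> \<bullet> d) * cis (\<xi> \<bullet> x))) \<le> norm d * (LINT \<xi>|lborel. norm \<xi> * norm (h \<xi>))"
proof -
  have [measurable]: "h \<in> borel_measurable borel"
    using h by (auto simp: integrable_iff_bounded)
  let ?G = "\<lambda>x. LINT \<xi>|lborel. h \<xi> * cis (\<xi> \<bullet> x)"
  let ?D = "\<lambda>d \<xi>. h \<xi> * (\<i> * complex_of_real (\<xi> \<bullet> d) * cis (\<xi> \<bullet> x))"
  have bd: "norm (?D d \<xi>) \<le> norm d * (norm \<xi> * norm (h \<xi>))" for d \<xi>
  proof -
    have "norm (?D d \<xi>) = \<bar>\<xi> \<bullet> d\<bar> * norm (h \<xi>)" by (simp add: norm_mult)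
    also have "\<dots> \<le> (norm \<xi> * norm d) * norm (h \<xi>)" by (intro mult_right_mono Cauchy_Schwarz_ineq2) auto
    finally show ?thesis by (simp add: mult_ac)
  qed
  have G: "integrable lborel (\<lambda>\<xi>. h \<xi> * cis (\<xi> \<bullet> y))" for y
    by (rule Bochner_Integration.integrable_bound[OF h]) (auto simp: norm_mult)
  have D: "integrable lborel (?D d)" for d
  proof (rule Bochner_Integration.integrable_bound)
    show "integrable lborel (\<lambda>\<xi>. norm d * (norm \<xi> * norm (h \<xi>)))" using h1 by simp
    show "AE \<xi> in lborel. norm (?D d \<xi>) \<le> norm (norm d * (norm \<xi> * norm (h \<xi>)))"
      using bd by (intro always_eventually allI) (simp add: abs_mult)
  qed measurable
  show b: "norm (LINT \<xi>|lborel. ?D d \<xi>) \<le> norm d * (LINT \<xi>|lborel. norm \<xi> * norm (h \<xi>))" for d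
  proof -
    have "norm (LINT \<xi>|lborel. ?D d \<xi>) \<le> (LINT \<xi>|lborel. norm (?D d \<xi>))" by (rule integral_norm_bound)
    also have "\<dots> \<le> (LINT \<xi>|lborel. norm d * (norm \<xi> * norm (h \<xi>)))"
      using D h1 bd by (intro integral_mono) auto
    finally show ?thesis by simp
  qed
  have lin: "bounded_linear (\<lambda>d. LINT \<xi>|lborel. ?D d \<xi>)"
  proof (rule bounded_linear_intro)
    show "(LINT \<xi>|lborel. ?D (d + e) \<xi>) = (LINT \<xi>|lborel. ?D d \<xi>) + (LINT \<xi>|lborel. ?D e \<xi>)" for d e
      by (subst Bochner_Integration.integral_add[symmetric, OF D D])
        (auto intro!: Bochner_Integration.integral_cong simp: inner_add_right algebra_simps)
    show "(LINT \<xi>|lborel. ?D (r *\<^sub>R d) \<xi>) = r *\<^sub>R (LINT \<xi>|lborel. ?D d \<xi>)" for r d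
      by (subst integral_scaleR_right[symmetric])
        (auto intro!: Bochner_Integration.integral_cong simp: scaleR_conv_of_real mult_ac)
    show "norm (LINT \<xi>|lborel. ?D d \<xi>) \<le> norm d * (LINT \<xi>|lborel. norm \<xi> * norm (h \<xi>))" for d by (rule b)
  qed
  have e1: "norm (cis t - 1) \<le> \<bar>t\<bar>" for t
    using iexp_approx1[of t 0] by (simp add: cis_conv_exp)
  have e2: "norm (cis t - 1 - \<i> * complex_of_real t) \<le> t\<^sup>2 / 2" for t
    using iexp_approx1[of t 1] by (simp add: cis_conv_exp power2_eq_square diff_diff_eq)
  let ?Q = "\<lambda>y \<xi>. (1 / norm (y - x)) *\<^sub>R (h \<xi> * cis (\<xi> \<bullet> y) - (h \<xi> * cis (\<xi> \<bullet> x) + ?D (y - x) \<xi>))"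
  have Qeq: "norm (?Q y \<xi>) = norm (h \<xi>) * (norm (cis (\<xi> \<bullet> (y - x)) - 1 - \<i> * complex_of_real (\<xi> \<bullet> (y - x))) / norm (y - x))" for y \<xi>
  proof -
    have "cis (\<xi> \<bullet> y) = cis (\<xi> \<bullet> (y - x)) * cis (\<xi> \<bullet> x)" by (simp add: cis_mult inner_diff_right)
    then have "h \<xi> * cis (\<xi> \<bullet> y) - (h \<xi> * cis (\<xi> \<bullet> x) + ?D (y - x) \<xi>) =
       h \<xi> * cis (\<xi> \<bullet> x) * (cis (\<xi> \<bullet> (y - x)) - 1 - \<i> * complex_of_real (\<xi> \<bullet> (y - x)))"
      by (simp only: algebra_simps mult_1_left)
    then show ?thesis by (simp add: norm_mult)
  qed
  have lim: "((\<lambda>y. (1 / norm (y - x)) *\<^sub>R (?G y - (?G x + (LINT \<xi>|lborel. ?D (y - x) \<xi>)))) \<longlongrightarrow> 0) (at x)"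
  proof -
    have "((\<lambda>y. LINT \<xi>|lborel. ?Q y \<xi>) \<longlongrightarrow> (LINT (\<xi>::'a)|lborel. (0::complex))) (at x)"
      unfolding tendsto_at_iff_sequentially o_def
    proof (intro allI impI)
      fix X :: "nat \<Rightarrow> 'a" assume X: "\<forall>i. X i \<in> UNIV - {x}" "X \<longlonglongrightarrow> x"
      show "(\<lambda>i. LINT \<xi>|lborel. ?Q (X i) \<xi>) \<longlonglongrightarrow> (LINT (\<xi>::'a)|lborel. (0::complex))"
      proof (rule integral_dominated_convergence)
        show "integrable lborel (\<lambda>\<xi>. 2 * (norm \<xi> * norm (h \<xi>)))" using h1 by simp
        show "AE \<xi> in lborel. norm (?Q (X i) \<xi>) \<le> 2 * (norm \<xi> * norm (h \<xi>))" for i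
        proof (intro always_eventually allI)
          fix \<xi>
          let ?t = "\<xi> \<bullet> (X i - x)"
          have n: "norm (X i - x) > 0" using X(1) by auto
          have "norm (cis ?t - 1 - \<i> * complex_of_real ?t) \<le> norm (cis ?t - 1) + norm (\<i> * complex_of_real ?t)"
            by (rule norm_triangle_ineq4)
          also have "\<dots> \<le> 2 * \<bar>?t\<bar>" using e1[of ?t] by (simp add: norm_mult)
          also have "\<dots> \<le> 2 * (norm \<xi> * norm (X i - x))" by (intro mult_left_mono Cauchy_Schwarz_ineq2) auto
          finally have "norm (cis ?t - 1 - \<i> * complex_of_real ?t) / norm (X i - x) \<le> 2 * norm \<xi>"
            using n by (simp add: field_simps)
          then have "norm (?Q (X i) \<xi>) \<le> norm (h \<xi>) * (2 * norm \<xi>)"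
            unfolding Qeq by (rule mult_left_mono) simp
          then show "norm (?Q (X i) \<xi>) \<le> 2 * (norm \<xi> * norm (h \<xi>))"
            by (simp only: mult_ac)
        qed
        show "AE \<xi> in lborel. (\<lambda>i. ?Q (X i) \<xi>) \<longlonglongrightarrow> 0"
        proof (intro always_eventually allI)
          fix \<xi>
          have "(\<lambda>i. norm (h \<xi>) * ((norm \<xi>)\<^sup>2 * norm (X i - x) / 2)) \<longlonglongrightarrow> norm (h \<xi>) * ((norm \<xi>)\<^sup>2 * norm (x - x) / 2)"
            by (intro tendsto_intros X(2)) simp_all
          then have z: "(\<lambda>i. norm (h \<xi>) * ((norm \<xi>)\<^sup>2 * norm (X i - x) / 2)) \<longlonglongrightarrow> 0" by simp
          show "(\<lambda>i. ?Q (X i) \<xi>) \<longlonglongrightarrow> 0"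
          proof (rule Lim_null_comparison[OF always_eventually z], rule allI)
            fix i
            let ?t = "\<xi> \<bullet> (X i - x)"
            have n: "norm (X i - x) > 0" using X(1) by auto
            have "norm (cis ?t - 1 - \<i> * complex_of_real ?t) \<le> \<bar>?t\<bar>\<^sup>2 / 2" using e2[of ?t] by simp
            also have "\<dots> \<le> (norm \<xi> * norm (X i - x))\<^sup>2 / 2"
              by (intro divide_right_mono power_mono Cauchy_Schwarz_ineq2) auto
            finally have "norm (cis ?t - 1 - \<i> * complex_of_real ?t) / norm (X i - x) \<le> (norm \<xi>)\<^sup>2 * norm (X i - x) / 2"
              using n by (simp add: field_simps power2_eq_square)
            then show "norm (?Q (X i) \<xi>) \<le> norm (h \<xi>) * ((norm \<xi>)\<^sup>2 * norm (X i - x) / 2)"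
              unfolding Qeq by (rule mult_left_mono) simp
          qed
        qed
      qed measurable
    qed
    moreover have "(LINT \<xi>|lborel. ?Q y \<xi>) = (1 / norm (y - x)) *\<^sub>R (?G y - (?G x + (LINT \<xi>|lborel. ?D (y - x) \<xi>)))" for y
      using G[of y] G[of x] D[of "y - x"] by simp
    ultimately show ?thesis
      by (simp only: Bochner_Integration.integral_zero)
  qed
  show "(?G has_derivative (\<lambda>d. LINT \<xi>|lborel. ?D d \<xi>)) (at x)"
    unfolding has_derivative_at_within using lin lim
    by (simp only: inverse_eq_divide diff_diff_eq simp_thms)
qed

lemma truncated_fourier_eq:
  fixes U :: "real^'n \<Rightarrow> complex"
  shows "truncated_fourier R U = fourier (\<lambda>x. indicator (cball 0 R) x *\<^sub>R U x)"
proof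
  fix \<xi> :: "real^'n"
  have "(\<lambda>x. indicator (cball 0 R) x *\<^sub>R (cis (- (x \<bullet> \<xi>)) * U x)) = (\<lambda>x. cis (- (x \<bullet> \<xi>)) * (indicator (cball 0 R) x *\<^sub>R U x))"
    by auto
  then show "truncated_fourier R U \<xi> = fourier (\<lambda>x. indicator (cball 0 R) x *\<^sub>R U x) \<xi>"
    unfolding truncated_fourier_def fourier_def set_lebesgue_integral_def by simp
qed

definition weighted_norm :: "real \<Rightarrow> (real^'n \<Rightarrow> complex) \<Rightarrow> real" where
  "weighted_norm s h = sqrt (LINT \<xi>|lborel. (1 + (norm \<xi>)\<^sup>2) powr s * (norm (h \<xi>))\<^sup>2)"

text \<open>
  On \<open>\<Omega>\<close> the function is the inverse Fourier integral of \<open>h\<close>, which is continuously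
  differentiable since \<open>h\<close> and \<open>norm \<xi> * h \<xi>\<close> are integrable.
\<close>

lemma sobolev_extension_C1:
  fixes \<Omega> :: "(real^'n) set"
  assumes ext: "sobolev_extension s \<Omega> u U h" and s: "s > real CARD('n) / 2 + 1"
    and \<Omega>: "open \<Omega>" "continuous_on \<Omega> u" "x \<in> \<Omega>"
  obtains D where "(u has_derivative D) (at x)"
    and "\<bar>u x\<bar> \<le> weight_const TYPE(real^'n) (s - 1) * weighted_norm s h"
    and "\<And>d. \<bar>D d\<bar> \<le> norm d * (weight_const TYPE(real^'n) (s - 1) * weighted_norm s h)"
proof -
  let ?U = "\<lambda>x. complex_of_real (U x)"
  let ?L = "sqrt (2 * pi) ^ DIM(real^'n)"
  let ?c = "weight_const TYPE(real^'n) (s - 1) * weighted_norm s h"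
  have U: "?U \<in> borel_measurable borel" "integrable lborel (\<lambda>x. (norm (?U x))\<^sup>2)"
    and hm[measurable]: "h \<in> borel_measurable borel" and h2: "integrable lborel (\<lambda>x. (norm (h x))\<^sup>2)"
    and lim: "((\<lambda>R. \<integral>\<^sup>+ \<xi>. ennreal ((norm (h \<xi> - fourier (\<lambda>x. indicator (cball 0 R) x *\<^sub>R ?U x) \<xi>))\<^sup>2) \<partial>lborel) \<longlongrightarrow> 0) at_top"
    and hs: "integrable lborel (\<lambda>\<xi>. (1 + (norm \<xi>)\<^sup>2) powr s * (norm (h \<xi>))\<^sup>2)"
    and AE: "AE x in lborel. x \<in> \<Omega> \<longrightarrow> ?U x = complex_of_real (u x)"
    using ext unfolding sobolev_extension_def is_fourier_transform_def square_integrable_def truncated_fourier_eq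
    by (auto simp: measurable_lborel1)
  have s': "s > real DIM(real^'n) / 2 + 1" using s by simp
  note w = weighted_L1_bound[OF hm s' hs]
  have sq1: "1 \<le> sqrt (1 + (norm \<xi>)\<^sup>2)" and sq2: "norm \<xi> \<le> sqrt (1 + (norm \<xi>)\<^sup>2)" for \<xi> :: "real^'n"
    by (auto intro!: real_le_rsqrt)
  have h1: "integrable lborel h"
  proof (rule Bochner_Integration.integrable_bound[OF w(1)])
    show "AE x in lborel. norm (h x) \<le> norm (sqrt (1 + (norm x)\<^sup>2) * norm (h x))"
      using mult_right_mono[OF sq1 norm_ge_zero[of "h _"]] by (intro always_eventually allI) (auto simp: abs_mult)
  qed measurable
  have h1': "integrable lborel (\<lambda>\<xi>. norm \<xi> * norm (h \<xi>))"
  proof (rule Bochner_Integration.integrable_bound[OF w(1)])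
    show "AE x in lborel. norm (norm x * norm (h x)) \<le> norm (sqrt (1 + (norm x)\<^sup>2) * norm (h x))"
      using mult_right_mono[OF sq2 norm_ge_zero[of "h _"]] by (intro always_eventually allI) (auto simp: abs_mult)
  qed measurable
  have b1: "(LINT \<xi>|lborel. norm (h \<xi>)) \<le> ?c"
  proof -
    have "(LINT \<xi>|lborel. norm (h \<xi>)) \<le> (LINT \<xi>|lborel. sqrt (1 + (norm \<xi>)\<^sup>2) * norm (h \<xi>))"
      using h1 w(1) mult_right_mono[OF sq1 norm_ge_zero[of "h _"]] by (intro integral_mono) auto
    then show ?thesis using w(2) by (simp add: weighted_norm_def)
  qed
  have b2: "(LINT \<xi>|lborel. norm \<xi> * norm (h \<xi>)) \<le> ?c"
  proof -
    have "(LINT \<xi>|lborel. norm \<xi> * norm (h \<xi>)) \<le> (LINT \<xi>|lborel. sqrt (1 + (norm \<xi>)\<^sup>2) * norm (h \<xi>))"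
      using h1' w(1) mult_right_mono[OF sq2 norm_ge_zero[of "h _"]] by (intro integral_mono) auto
    then show ?thesis using w(2) by (simp add: weighted_norm_def)
  qed
  \<comment> \<open>The normalising constant of the inverse transform is at most \<open>1\<close>, so it can be dropped from the bounds.\<close>
  have L1: "?L \<ge> 1"
    using pi_gt3 by (intro one_le_power) auto
  have inv: "(LINT \<xi>|lborel. h \<xi> * cis (\<xi> \<bullet> y)) = complex_of_real (?L * u y)" if "y \<in> \<Omega>" for y
    using fourier_inversion_L2[OF U h1 h2 lim \<Omega>(1) _ that AE] \<Omega>(2) by (simp add: continuous_on_of_real)
  define D where "D = (\<lambda>d. Re (LINT \<xi>|lborel. h \<xi> * (\<i> * complex_of_real (\<xi> \<bullet> d) * cis (\<xi> \<bullet> x))) / ?L)"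
  have Re_le: "\<bar>Re z / ?L\<bar> \<le> norm z" for z
  proof -
    have "\<bar>Re z / ?L\<bar> \<le> \<bar>Re z\<bar>" using L1 by (simp add: abs_divide divide_le_eq mult_left_le mult_le_cancel_left1)
    then show ?thesis using abs_Re_le_cmod[of z] by linarith
  qed
  have der: "((\<lambda>y. Re (LINT \<xi>|lborel. h \<xi> * cis (\<xi> \<bullet> y)) / ?L) has_derivative D) (at x)"
    unfolding D_def divide_inverse
    by (intro has_derivative_mult_left bounded_linear.has_derivative[OF bounded_linear_Re] fourier_integral_has_derivative(1) h1 h1')
  have "(u has_derivative D) (at x)"
  proof (rule has_derivative_transform_within_open[OF der \<Omega>(1) \<Omega>(3)])
    fix y assume "y \<in> \<Omega>"
    from inv[OF this] show "Re (LINT \<xi>|lborel. h \<xi> * cis (\<xi> \<bullet> y)) / ?L = u y"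
      using L1 by simp
  qed
  moreover have "\<bar>u x\<bar> \<le> ?c"
  proof -
    have "u x = Re (LINT \<xi>|lborel. h \<xi> * cis (\<xi> \<bullet> x)) / ?L" using inv[OF \<Omega>(3)] L1 by simp
    then have "\<bar>u x\<bar> \<le> norm (LINT \<xi>|lborel. h \<xi> * cis (\<xi> \<bullet> x))" using Re_le by simp
    also have "\<dots> \<le> (LINT \<xi>|lborel. norm (h \<xi> * cis (\<xi> \<bullet> x)))" by (rule integral_norm_bound)
    also have "\<dots> \<le> ?c" using b1 by (simp add: norm_mult)
    finally show ?thesis .
  qed
  moreover have "\<bar>D d\<bar> \<le> norm d * ?c" for d
  proof -
    have "\<bar>D d\<bar> \<le> norm (LINT \<xi>|lborel. h \<xi> * (\<i> * complex_of_real (\<xi> \<bullet> d) * cis (\<xi> \<bullet> x)))"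
      unfolding D_def by (rule Re_le)
    also have "\<dots> \<le> norm d * (LINT \<xi>|lborel. norm \<xi> * norm (h \<xi>))"
      by (rule fourier_integral_has_derivative(2)[OF h1 h1'])
    also have "\<dots> \<le> norm d * ?c" by (intro mult_left_mono b2) auto
    finally show ?thesis .
  qed
  ultimately show ?thesis using that by blast
qed

lemma le_mult_Inf:
  fixes K c :: real
  assumes "S \<noteq> {}" "K \<ge> 0" "\<And>a. a \<in> S \<Longrightarrow> c \<le> K * a"
  shows "c \<le> K * Inf S"
proof (cases "K = 0")
  case True
  then show ?thesis using assms(1,3) by auto
next
  case False
  then have K: "K > 0" using assms(2) by simp
  then have "c / K \<le> Inf S"
    using assms by (intro cInf_greatest) (auto simp: field_simps)
  then show ?thesis using K by (simp add: field_simps)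
qed

text \<open>
  The bounds hold for every extension with the same constant, and so pass to the infimum that
  defines the quotient norm. This makes point values and derivatives bounded functionals.
\<close>

theorem sobolev_embedding_C1:
  fixes \<Omega> :: "(real^'n) set"
  assumes s: "s > real CARD('n) / 2 + 1" and \<Omega>: "open \<Omega>"
  obtains K where "K \<ge> 0"
    and "\<And>u x. u \<in> sobolev s \<Omega> \<Longrightarrow> x \<in> \<Omega> \<Longrightarrow> u differentiable (at x)"
    and "\<And>u x. u \<in> sobolev s \<Omega> \<Longrightarrow> x \<in> \<Omega> \<Longrightarrow> \<bar>u x\<bar> \<le> K * sobolev_norm s \<Omega> u"
    and "\<And>u x d. u \<in> sobolev s \<Omega> \<Longrightarrow> x \<in> \<Omega> \<Longrightarrow> \<bar>frechet_derivative u (at x) d\<bar> \<le> norm d * K * sobolev_norm s \<Omega> u"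
proof -
  let ?K = "weight_const TYPE(real^'n) (s - 1)"
  have K: "?K \<ge> 0" by (auto simp: weight_const_def intro!: Bochner_Integration.integral_nonneg)
  have ext: "\<exists>U h. sobolev_extension s \<Omega> u U h" "continuous_on \<Omega> u" if "u \<in> sobolev s \<Omega>" for u
    using that by (auto simp: sobolev_def)
  have norm_eq: "sobolev_norm s \<Omega> u = Inf {weighted_norm s h |U h. sobolev_extension s \<Omega> u U h}" for u
    by (simp add: sobolev_norm_def weighted_norm_def)
  show ?thesis
  proof (rule that[OF K])
    fix u x assume u: "u \<in> sobolev s \<Omega>" and x: "x \<in> \<Omega>"
    note C1 = sobolev_extension_C1[OF _ s \<Omega> ext(2)[OF u] x]
    show "u differentiable (at x)"
      using ext(1)[OF u] C1 unfolding differentiable_def by metis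
    show "\<bar>u x\<bar> \<le> ?K * sobolev_norm s \<Omega> u"
      unfolding norm_eq using ext(1)[OF u] by (intro le_mult_Inf K) (auto elim: C1)
    fix d
    have fd: "\<bar>frechet_derivative u (at x) d\<bar> \<le> norm d * (?K * weighted_norm s h)" if "sobolev_extension s \<Omega> u U h" for U h
      using C1[OF that] frechet_derivative_at by metis
    show "\<bar>frechet_derivative u (at x) d\<bar> \<le> norm d * ?K * sobolev_norm s \<Omega> u"
      unfolding norm_eq using ext(1)[OF u] fd K by (intro le_mult_Inf) (auto simp: mult.assoc)
  qed
qed

section \<open>Gaussians belong to all Sobolev spaces\<close>

text \<open>
  The error of the truncated transform is the transform of the part of \<open>U\<close> outside a ball, so the
  \<open>L\<^sub>2\<close> bound reduces the claim to the convergence of the integral of \<open>(norm (U x))\<^sup>2\<close>.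
\<close>

lemma is_fourier_transform_L1_L2:
  fixes U :: "real^'n \<Rightarrow> complex"
  assumes U1: "integrable lborel U" and U2: "integrable lborel (\<lambda>x. (norm (U x))\<^sup>2)"
  shows "is_fourier_transform U (fourier U)"
proof -
  have [measurable]: "U \<in> borel_measurable borel"
    using U1 by (auto simp: integrable_iff_bounded)
  have [measurable]: "cball (0::real^'n) R \<in> sets borel" for R by simp
  have "integrable lborel (\<lambda>\<xi>. (norm (fourier U \<xi>))\<^sup>2)"
  proof (rule integrableI_bounded)
    have "(\<integral>\<^sup>+\<xi>. ennreal (norm ((norm (fourier U \<xi>))\<^sup>2)) \<partial>lborel) \<le> (\<integral>\<^sup>+x. ennreal ((norm (U x))\<^sup>2) \<partial>lborel)"
      using fourier_L2_bound[OF U1] by simp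
    also have "\<dots> < \<infinity>" using U2 by (auto simp: integrable_iff_bounded)
    finally show "(\<integral>\<^sup>+\<xi>. ennreal (norm ((norm (fourier U \<xi>))\<^sup>2)) \<partial>lborel) < \<infinity>" .
  qed measurable
  moreover have "((\<lambda>R. \<integral>\<^sup>+ \<xi>. ennreal ((norm (fourier U \<xi> - truncated_fourier R U \<xi>))\<^sup>2) \<partial>lborel) \<longlongrightarrow> 0) at_top"
  proof -
    let ?T = "\<lambda>R x. indicator (- cball 0 R) x *\<^sub>R U x"
    let ?t = "\<lambda>R x. indicator (- cball 0 R) x *\<^sub>R (norm (U x))\<^sup>2"
    have cut: "integrable lborel (\<lambda>x. indicator A x *\<^sub>R U x)" if [measurable]: "A \<in> sets borel" for A
      by (rule integrable_mult_indicator[OF _ U1]) simp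
    have eq: "fourier U \<xi> - truncated_fourier R U \<xi> = fourier (?T R) \<xi>" for R \<xi>
    proof -
      have "(LINT x|lborel. cis (- (x \<bullet> \<xi>)) * U x) = (LINT x|lborel. cis (- (x \<bullet> \<xi>)) * ?T R x + cis (- (x \<bullet> \<xi>)) * (indicator (cball 0 R) x *\<^sub>R U x))"
        by (intro Bochner_Integration.integral_cong refl) (auto simp: indicator_def)
      also have "\<dots> = (LINT x|lborel. cis (- (x \<bullet> \<xi>)) * ?T R x) + (LINT x|lborel. cis (- (x \<bullet> \<xi>)) * (indicator (cball 0 R) x *\<^sub>R U x))"
        by (intro Bochner_Integration.integral_add cis_mult_integrable cut) measurable
      finally show ?thesis
        unfolding truncated_fourier_eq fourier_def by (simp only: distrib_left add_diff_cancel_right')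
    qed
    have t_int: "integrable lborel (?t R)" for R
      by (rule Bochner_Integration.integrable_bound[OF U2]) (measurable, auto simp: indicator_def)
    have le: "(\<integral>\<^sup>+ \<xi>. ennreal ((norm (fourier U \<xi> - truncated_fourier R U \<xi>))\<^sup>2) \<partial>lborel) \<le> ennreal (LINT x|lborel. ?t R x)" for R
    proof -
      have "(\<integral>\<^sup>+ \<xi>. ennreal ((norm (fourier (?T R) \<xi>))\<^sup>2) \<partial>lborel) \<le> (\<integral>\<^sup>+x. ennreal ((norm (?T R x))\<^sup>2) \<partial>lborel)"
        by (rule fourier_L2_bound[OF cut]) simp
      also have "\<dots> = (\<integral>\<^sup>+x. ennreal (?t R x) \<partial>lborel)"
        by (intro nn_integral_cong) (auto simp: indicator_def)
      also have "\<dots> = ennreal (LINT x|lborel. ?t R x)"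
        by (rule nn_integral_eq_integral[OF t_int]) auto
      finally show ?thesis unfolding eq .
    qed
    have "((\<lambda>R. LINT x|lborel. ?t R x) \<longlongrightarrow> (LINT (x::real^'n)|lborel. (0::real))) at_top"
    proof (rule integral_dominated_convergence_at_top[OF _ _ U2])
      show "AE x in lborel. ((\<lambda>R. ?t R x) \<longlongrightarrow> 0) at_top"
      proof (rule AE_I2, rule tendsto_eventually)
        fix x
        show "eventually (\<lambda>R. ?t R x = 0) at_top"
          using eventually_ge_at_top[of "norm x"] by eventually_elim auto
      qed
      show "\<forall>\<^sub>F R in at_top. AE x in lborel. norm (?t R x) \<le> (norm (U x))\<^sup>2"
        by (intro always_eventually allI) (auto simp: indicator_def)
    qed measurable
    from tendsto_ennrealI[OF this]
    have T: "((\<lambda>R. ennreal (LINT x|lborel. ?t R x)) \<longlongrightarrow> 0) at_top" by simp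
    show ?thesis
      by (rule tendsto_sandwich[OF _ _ tendsto_const T]) (use le in auto)
  qed
  ultimately show ?thesis
    using U2 by (auto simp: is_fourier_transform_def square_integrable_def)
qed

lemma fourier_gaussian_translate:
  fixes a :: "'a::euclidean_space"
  shows "fourier (\<lambda>x. complex_of_real (gaussian 1 (x - a))) \<xi> = cis (- (a \<bullet> \<xi>)) * complex_of_real (gaussian 1 \<xi>)"
proof -
  have "(LINT x|lborel. cis (- (x \<bullet> \<xi>)) * complex_of_real (gaussian 1 (x - a))) =
      (LINT x|distr lborel borel ((+) a). cis (- (x \<bullet> \<xi>)) * complex_of_real (gaussian 1 (x - a)))"
    by (simp only: lborel_distr_plus)
  also have "\<dots> = (LINT x|lborel. cis (- ((a + x) \<bullet> \<xi>)) * complex_of_real (gaussian 1 x))"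
    by (subst integral_distr) auto
  also have "\<dots> = (LINT x|lborel. cis (- (a \<bullet> \<xi>)) * (cis (- (x \<bullet> \<xi>)) * complex_of_real (gaussian 1 x)))"
    by (intro Bochner_Integration.integral_cong refl) (simp add: cis_mult inner_add_left flip: mult.assoc)
  finally have "fourier (\<lambda>x. complex_of_real (gaussian 1 (x - a))) \<xi> = cis (- (a \<bullet> \<xi>)) * fourier (\<lambda>x. complex_of_real (gaussian 1 x)) \<xi>"
    by (simp add: fourier_def)
  also have "fourier (\<lambda>x. complex_of_real (gaussian 1 x)) \<xi> = complex_of_real (gaussian 1 \<xi>)"
    using gaussian_fourier_shift(2)[of 1 0 \<xi>] by (simp add: heat_def gaussian_def)
  finally show ?thesis .
qed

text \<open>
  Exponential decay beats the polynomial weight: with \<open>p = 1 + (norm \<xi>)\<^sup>2\<close> and an integer \<open>m \<ge> s\<close>,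
  \<open>p ^ m \<le> (2 * m) ^ m * exp (p / 2)\<close> follows from \<open>y \<le> exp y\<close> at \<open>y = p / (2 * m)\<close>.
\<close>

lemma integrable_weight_gaussian:
  "integrable lborel (\<lambda>\<xi>::'a::euclidean_space. (1 + (norm \<xi>)\<^sup>2) powr s * (gaussian 1 \<xi>)\<^sup>2)"
proof -
  obtain m0 :: nat where "s \<le> real m0" using real_arch_simple by blast
  then obtain m :: nat where m: "s \<le> real m" "m > 0" by (intro that[of "Suc m0"]) auto
  let ?C = "(2 * real m) ^ m * exp (1 / 2)"
  have le: "(1 + (norm \<xi>)\<^sup>2) powr s * (gaussian 1 \<xi>)\<^sup>2 \<le> ?C * gaussian 1 \<xi>" for \<xi> :: 'a
  proof -
    define p where "p = 1 + (norm \<xi>)\<^sup>2"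
    have p: "p \<ge> 1" by (simp add: p_def)
    have "p / (2 * real m) \<le> exp (p / (2 * real m))"
      using exp_ge_add_one_self[of "p / (2 * real m)"] by linarith
    then have "p \<le> 2 * real m * exp (p / (2 * real m))"
      using m(2) by (simp add: field_simps)
    then have "p ^ m \<le> (2 * real m * exp (p / (2 * real m))) ^ m"
      using p by (intro power_mono) auto
    also have "\<dots> = (2 * real m) ^ m * exp (p / 2)"
      using m(2) by (simp add: power_mult_distrib flip: exp_of_nat_mult)
    finally have "p powr s \<le> (2 * real m) ^ m * exp (p / 2)"
      using p m powr_mono[of s "real m" p] by (simp add: powr_realpow)
    then have "p powr s * (gaussian 1 \<xi>)\<^sup>2 \<le> (2 * real m) ^ m * exp (p / 2) * (gaussian 1 \<xi>)\<^sup>2"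
      by (rule mult_right_mono) simp
    also have "\<dots> = (2 * real m) ^ m * (exp (p / 2) * (gaussian 1 \<xi>)\<^sup>2)" by simp
    also have "exp (p / 2) * (gaussian 1 \<xi>)\<^sup>2 = exp (1 / 2) * gaussian 1 \<xi>"
      by (simp add: gaussian_def p_def power2_eq_square add_divide_distrib flip: exp_add)
    finally show ?thesis by (simp add: p_def mult.assoc)
  qed
  show ?thesis
  proof (rule Bochner_Integration.integrable_bound)
    show "integrable lborel (\<lambda>\<xi>::'a. ?C * gaussian 1 \<xi>)"
      using gaussian_integrable(1)[of 1, where 'a='a] by simp
    show "AE \<xi> in lborel. norm ((1 + (norm (\<xi>::'a))\<^sup>2) powr s * (gaussian 1 \<xi>)\<^sup>2) \<le> norm (?C * gaussian 1 \<xi>)"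
    proof (intro always_eventually allI)
      fix \<xi> :: 'a
      have "0 \<le> (1 + (norm \<xi>)\<^sup>2) powr s * (gaussian 1 \<xi>)\<^sup>2" by simp
      then show "norm ((1 + (norm \<xi>)\<^sup>2) powr s * (gaussian 1 \<xi>)\<^sup>2) \<le> norm (?C * gaussian 1 \<xi>)"
        using le[of \<xi>] by simp
    qed
  qed measurable
qed

text \<open>
  All functions constructed below are linear combinations of these.
\<close>

lemma gaussian_translate_in_sobolev:
  fixes \<Omega> :: "(real^'n) set"
  shows "zero_off \<Omega> (\<lambda>x. gaussian 1 (x - a)) \<in> sobolev s \<Omega>"
proof -
  let ?U = "\<lambda>x. gaussian 1 (x - a)"
  let ?h = "\<lambda>\<xi>. cis (- (a \<bullet> \<xi>)) * complex_of_real (gaussian 1 \<xi>)"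
  have U1: "integrable lborel (\<lambda>x. complex_of_real (?U x))"
    using heat_integrable(1)[of 1 a] by (simp add: heat_def gaussian_def norm_minus_commute)
  have U2: "integrable lborel (\<lambda>x. (norm (complex_of_real (?U x)))\<^sup>2)"
    using heat_square_integrable[of 1 a] by (simp add: heat_def gaussian_def norm_minus_commute)
  have "is_fourier_transform (\<lambda>x. complex_of_real (?U x)) ?h"
    using is_fourier_transform_L1_L2[OF U1 U2] unfolding fourier_gaussian_translate[abs_def] .
  moreover have "integrable lborel (\<lambda>\<xi>. (1 + (norm \<xi>)\<^sup>2) powr s * (norm (?h \<xi>))\<^sup>2)"
    using integrable_weight_gaussian[of s, where 'a="real^'n"] by (simp add: norm_mult)
  ultimately have "sobolev_extension s \<Omega> (zero_off \<Omega> ?U) ?U ?h"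
    by (auto simp: sobolev_extension_def zero_off_def)
  moreover have "continuous_on \<Omega> (zero_off \<Omega> ?U)"
  proof (rule continuous_on_eq)
    show "continuous_on \<Omega> ?U" unfolding gaussian_def by (intro continuous_intros) simp_all
  qed (simp add: zero_off_def)
  ultimately show ?thesis
    unfolding sobolev_def by (auto simp: zero_off_def)
qed

section \<open>The Lyapunov equation\<close>

text \<open>
  The vector \<open>q(D) v\<close>.
\<close>

definition poly_apply :: "complex^'n^'n \<Rightarrow> complex poly \<Rightarrow> complex^'n \<Rightarrow> complex^'n" where
  "poly_apply D q v = (\<Sum>i\<le>degree q. coeff q i *s (((*v) D ^^ i) v))"

lemma poly_apply_atMost:
  assumes "degree q \<le> n"
  shows "poly_apply D q v = (\<Sum>i\<le>n. coeff q i *s (((*v) D ^^ i) v))"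
  unfolding poly_apply_def
  by (rule sum.mono_neutral_left) (use assms in \<open>auto simp: coeff_eq_0\<close>)

lemma funpow_matrix_linear:
  "((*v) D ^^ i) (v - c *s w) = ((*v) D ^^ i) v - c *s (((*v) D ^^ i) w)" for D :: "complex^'n^'n"
  by (induction i) (auto simp: matrix_vector_mult_diff_distrib vector_scalar_commute)

text \<open>
  The factor of a root commutes with the remaining factor; applied last it shows that
  \<open>r(D) v\<close> is an eigenvector or \<open>0\<close>, applied first that \<open>r\<close> annihilates \<open>(D - z) v\<close>, whenever
  the product annihilates \<open>v\<close>.
\<close>

lemma poly_apply_root_factor:
  fixes D :: "complex^'n^'n"
  shows "poly_apply D ([:- z, 1:] * r) v = D *v poly_apply D r v - z *s poly_apply D r v"
    and "poly_apply D ([:- z, 1:] * r) v = poly_apply D r (D *v v - z *s v)"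
proof -
  let ?n = "degree r"
  let ?P = "\<lambda>i. ((*v) D ^^ i) v"
  have "degree ([:- z, 1:] * r) \<le> Suc ?n"
    by (rule order_trans[OF degree_mult_le]) simp
  then have "poly_apply D ([:- z, 1:] * r) v = (\<Sum>i\<le>Suc ?n. coeff (pCons 0 r - smult z r) i *s ?P i)"
    by (subst poly_apply_atMost) auto
  also have "\<dots> = (\<Sum>i\<le>Suc ?n. coeff (pCons 0 r) i *s ?P i) - (\<Sum>i\<le>Suc ?n. (z * coeff r i) *s ?P i)"
    by (simp only: coeff_diff coeff_smult vector_sub_rdistrib sum_subtractf)
  also have "(\<Sum>i\<le>Suc ?n. (z * coeff r i) *s ?P i) = z *s poly_apply D r v"
    by (subst poly_apply_atMost[of r "Suc ?n"]) (simp_all add: vec.scale_sum_right vec.scale_scale)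
  also have s: "(\<Sum>i\<le>Suc ?n. coeff (pCons 0 r) i *s ?P i) = (\<Sum>i\<le>?n. coeff r i *s ?P (Suc i))"
    by (subst sum.atMost_Suc_shift) simp
  finally have e: "poly_apply D ([:- z, 1:] * r) v = (\<Sum>i\<le>?n. coeff r i *s ?P (Suc i)) - z *s poly_apply D r v" .
  moreover have "(\<Sum>i\<le>?n. coeff r i *s ?P (Suc i)) = D *v poly_apply D r v"
    unfolding poly_apply_def by (simp add: vec.linear_sum[OF matrix_vector_mul_linear_gen] vector_scalar_commute)
  ultimately show "poly_apply D ([:- z, 1:] * r) v = D *v poly_apply D r v - z *s poly_apply D r v" by simp
  show "poly_apply D ([:- z, 1:] * r) v = poly_apply D r (D *v v - z *s v)"
    unfolding e unfolding poly_apply_def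
    by (simp add: funpow_matrix_linear funpow_swap1 vec.scale_sum_right vec.scale_right_diff_distrib sum_subtractf mult.commute)
qed

text \<open>
  The \<open>n + 1\<close> vectors \<open>v, D v, \<dots>, D\<^sup>n v\<close> in an \<open>n\<close>-dimensional space satisfy a linear relation.
\<close>

lemma annihilating_polynomial:
  fixes D :: "complex^'n^'n"
  obtains q where "q \<noteq> 0" "poly_apply D q v = 0"
proof -
  let ?P = "\<lambda>i. ((*v) D ^^ i) v"
  let ?n = "CARD('n)"
  have ex: "\<exists>c. (\<exists>i\<le>?n. c i \<noteq> 0) \<and> (\<Sum>i\<le>?n. c i *s ?P i) = 0"
  proof (cases "inj_on ?P {..?n}")
    case True
    then have "card (?P ` {..?n}) = Suc ?n" by (simp only: card_image card_atMost)
    then have "vec.dependent (?P ` {..?n})"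
      using vec.independent_card_le_dim[OF subset_UNIV, of "?P ` {..?n}"]
      unfolding vec_dim_card by linarith
    then obtain u where u: "\<exists>w\<in>?P ` {..?n}. u w \<noteq> 0" "(\<Sum>w\<in>?P ` {..?n}. u w *s w) = 0"
      unfolding vec.dependent_finite[OF finite_imageI[OF finite_atMost]] by blast
    have "(\<Sum>i\<le>?n. u (?P i) *s ?P i) = 0"
      using u(2) unfolding sum.reindex[OF True] o_def .
    moreover have "\<exists>i\<le>?n. u (?P i) \<noteq> 0" using u(1) by blast
    ultimately show ?thesis by (intro exI[of _ "\<lambda>i. u (?P i)"] conjI)
  next
    case False
    then obtain i j where ij: "i \<le> ?n" "j \<le> ?n" "i \<noteq> j" "?P i = ?P j"
      unfolding inj_on_def by blast
    let ?c = "\<lambda>k. if k = i then 1 else if k = j then - 1 else 0 :: complex"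
    have "(\<Sum>k\<le>?n. ?c k *s ?P k) = (\<Sum>k\<in>{i, j}. ?c k *s ?P k)"
      using ij(1,2) by (intro sum.mono_neutral_right) auto
    also have "\<dots> = ?P i - ?P j" using ij(3) by simp
    also have "\<dots> = 0" by (simp only: ij(4) diff_self)
    finally have "(\<Sum>k\<le>?n. ?c k *s ?P k) = 0" .
    moreover have "\<exists>k\<le>?n. ?c k \<noteq> 0" using ij(1) by (intro exI[of _ i]) simp
    ultimately show ?thesis by (intro exI[of _ ?c] conjI)
  qed
  then obtain c where c: "\<exists>i\<le>?n. c i \<noteq> 0" "(\<Sum>i\<le>?n. c i *s ?P i) = 0" by blast
  define q where "q = (\<Sum>i\<le>?n. monom (c i) i)"
  have co: "coeff q i = (if i \<le> ?n then c i else 0)" for i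
    unfolding q_def by (simp add: coeff_sum)
  have "degree q \<le> ?n" by (intro degree_le) (simp add: co)
  then have "poly_apply D q v = (\<Sum>i\<le>?n. coeff q i *s ?P i)"
    by (rule poly_apply_atMost)
  also have "\<dots> = (\<Sum>i\<le>?n. c i *s ?P i)"
    by (intro sum.cong refl) (simp add: co)
  finally have "poly_apply D q v = 0" using c(2) by (rule trans)
  moreover have "q \<noteq> 0"
  proof
    assume "q = 0"
    then have "c i = 0" if "i \<le> ?n" for i using co[of i] that by simp
    then show False using c(1) by blast
  qed
  ultimately show thesis by (intro that)
qed

text \<open>
  Induction on the degree of a polynomial \<open>q\<close> with \<open>q(D) v = 0\<close> shows \<open>A v = 0\<close>. Split off a root:
  \<open>q(D) = (D - z) r(D)\<close>. If \<open>z\<close> is an eigenvalue of \<open>D\<close>, then \<open>r\<close> annihilates \<open>(D - z) v\<close>, so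
  \<open>A (D - z) v = 0\<close> by induction, that is \<open>B (A v) = z A v\<close>, and \<open>z\<close> is not an eigenvalue of \<open>B\<close>.
  Otherwise \<open>D - z\<close> is injective, and already \<open>r(D) v = 0\<close>.
\<close>

theorem sylvester_homogeneous:
  fixes A D B :: "complex^'n^'n"
  assumes AD: "A ** D = B ** A"
    and disjoint: "\<And>z v w. v \<noteq> 0 \<Longrightarrow> D *v v = z *s v \<Longrightarrow> w \<noteq> 0 \<Longrightarrow> B *v w = z *s w \<Longrightarrow> False"
  shows "A = 0"
proof -
  have claim: "A *v v = 0" if "degree q = n" "q \<noteq> 0" "poly_apply D q v = 0" for n q v
    using that
  proof (induction n arbitrary: q v)
    case 0
    then obtain c where "q = [:c:]" using degree_0_id by metis
    then have "c \<noteq> 0" "c *s v = 0" using 0 by (auto simp: poly_apply_def)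
    then have "v = 0" by (simp add: vector_mul_eq_0)
    then show ?case by simp
  next
    case (Suc n)
    then have "\<not> constant (poly q)" by (simp add: constant_degree)
    then obtain z where "poly q z = 0" using fundamental_theorem_of_algebra by blast
    then obtain r where r: "q = [:- z, 1:] * r" by (auto simp: poly_eq_0_iff_dvd)
    have r0: "r \<noteq> 0" using Suc.prems(2) r by auto
    have "degree q = 1 + degree r" unfolding r using r0 by (subst degree_mult_eq) auto
    then have deg: "degree r = n" using Suc.prems(1) by simp
    show ?case
    proof (cases "\<exists>u. u \<noteq> 0 \<and> D *v u = z *s u")
      case True
      have "A *v (D *v v - z *s v) = 0"
        by (rule Suc.IH[OF deg r0]) (use Suc.prems(3)[unfolded r poly_apply_root_factor(2)] in simp)
      then have "A *v (D *v v) = z *s (A *v v)"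
        by (simp add: matrix_vector_mult_diff_distrib vector_scalar_commute)
      then have "B *v (A *v v) = z *s (A *v v)"
        by (simp add: matrix_vector_mul_assoc AD)
      then show ?thesis using disjoint True by blast
    next
      case False
      have "D *v poly_apply D r v - z *s poly_apply D r v = 0"
        using Suc.prems(3)[unfolded r poly_apply_root_factor(1)] .
      then have "poly_apply D r v = 0" using False by auto
      then show ?thesis by (rule Suc.IH[OF deg r0])
    qed
  qed
  have "A *v v = 0" for v
    by (rule annihilating_polynomial[of D v]) (rule claim[OF refl])
  then show ?thesis by (simp add: matrix_eq)
qed

definition complexify :: "real^'n^'n \<Rightarrow> complex^'n^'n" where
  "complexify A = (\<chi> i j. complex_of_real (A $ i $ j))"

lemma complexify_mult: "complexify (A ** B) = complexify A ** complexify B"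
  by (simp add: complexify_def matrix_matrix_mult_def vec_eq_iff)

lemma complexify_eq_0: "complexify A = 0 \<longleftrightarrow> A = 0"
  by (simp add: complexify_def vec_eq_iff)

text \<open>
  The characteristic determinants of a matrix and its transpose agree.
\<close>

lemma eigenvalue_transpose:
  fixes M :: "complex^'n^'n"
  assumes "w \<noteq> 0" "transpose M *v w = z *s w"
  shows "\<exists>v. v \<noteq> 0 \<and> M *v v = z *s v"
proof -
  have shift: "(M' - mat z) *v u = M' *v u - z *s u" for M' :: "complex^'n^'n" and u
    by (simp add: matrix_vector_mult_diff_rdistrib)
      (simp add: mat_def matrix_vector_mult_def vec_eq_iff mult_delta_left)
  have "(transpose M - mat z) *v w = 0" using assms(2) by (simp add: shift)
  then have "\<not> invertible (transpose M - mat z)"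
    using assms(1) by (metis invertible_left_inverse matrix_left_invertible_ker)
  moreover have "transpose M - mat z = transpose (M - mat z)"
    by (simp add: transpose_def mat_def vec_eq_iff)
  ultimately have "\<not> invertible (M - mat z)"
    by (simp add: invertible_det_nz det_transpose)
  then obtain v where "v \<noteq> 0" "(M - mat z) *v v = 0"
    by (metis invertible_left_inverse matrix_left_invertible_ker)
  then show ?thesis by (auto simp: shift)
qed

text \<open>
  A Sylvester equation with \<open>B = - D\<^sup>T\<close>: the spectra of \<open>D\<close> and \<open>- D\<^sup>T\<close> lie in opposite open half
  planes.
\<close>

lemma lyapunov_injective:
  fixes D A :: "real^'n^'n"
  assumes eig: "(\<forall>z. complex_eigenvalue D z \<longrightarrow> Re z < 0) \<or> (\<forall>z. complex_eigenvalue D z \<longrightarrow> Re z > 0)"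
    and A: "transpose D ** A + A ** D = 0"
  shows "A = 0"
proof -
  let ?B = "- transpose (complexify D)"
  have eig_iff: "complex_eigenvalue D z \<longleftrightarrow> (\<exists>v. v \<noteq> 0 \<and> complexify D *v v = z *s v)" for z
    by (simp add: complex_eigenvalue_def complexify_def)
  have "A ** D = - (transpose D ** A)" using A by (simp add: eq_neg_iff_add_eq_0 add.commute)
  then have "complexify A ** complexify D = complexify (- (transpose D ** A))" by (simp flip: complexify_mult)
  also have "\<dots> = ?B ** complexify A"
    by (simp add: complexify_def matrix_matrix_mult_def vec_eq_iff transpose_def sum_negf)
  finally have "complexify A ** complexify D = ?B ** complexify A" .
  then have "complexify A = 0"
  proof (rule sylvester_homogeneous)
    fix z v w assume v: "v \<noteq> 0" "complexify D *v v = z *s v" and w: "w \<noteq> 0" "?B *v w = z *s w"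
    have "?B *v w = - (transpose (complexify D) *v w)"
      by (simp add: matrix_vector_mult_def vec_eq_iff sum_negf)
    then have "transpose (complexify D) *v w = - (z *s w)" using w(2) by simp
    then have "transpose (complexify D) *v w = (- z) *s w" by (simp add: vec_eq_iff)
    then have "complex_eigenvalue D (- z)" using eigenvalue_transpose[OF w(1)] eig_iff by blast
    moreover have "complex_eigenvalue D z" using v eig_iff by blast
    ultimately have "Re z < 0 \<and> Re (- z) < 0 \<or> Re z > 0 \<and> Re (- z) > 0" using eig by blast
    then show False by auto
  qed
  then show ?thesis by (simp add: complexify_eq_0)
qed

text \<open>
  An injective endomorphism of the finite-dimensional space of matrices is onto. With \<open>A\<close> its
  transpose is a solution too, and solutions are unique.
\<close>

theorem lyapunov_solvable:
  fixes D C :: "real^'n^'n"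
  assumes eig: "(\<forall>z. complex_eigenvalue D z \<longrightarrow> Re z < 0) \<or> (\<forall>z. complex_eigenvalue D z \<longrightarrow> Re z > 0)"
    and C: "C \<in> sym_matrices"
  obtains A where "A \<in> sym_matrices" "transpose D ** A + A ** D = C"
proof -
  let ?L = "\<lambda>A. transpose D ** A + A ** D"
  have lin: "linear ?L"
  proof (rule linearI)
    show "?L (X + Y) = ?L X + ?L Y" for X Y
      by (simp add: matrix_matrix_mult_def vec_eq_iff distrib_left distrib_right sum.distrib)
    show "?L (c *\<^sub>R X) = c *\<^sub>R ?L X" for c X
      by (simp add: matrix_matrix_mult_def vec_eq_iff distrib_left sum_distrib_left mult_ac)
  qed
  have "inj ?L"
    unfolding linear_injective_0[OF lin] using lyapunov_injective[OF eig] by blast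
  have "surj ?L" by (rule linear_injective_imp_surjective[OF lin \<open>inj ?L\<close> refl])
  from surjD[OF this, of C] obtain A where A: "C = ?L A" by blast
  have tr: "transpose (X + Y) = transpose X + transpose Y" for X Y :: "real^'n^'n"
    by (simp add: transpose_def vec_eq_iff)
  have "?L (transpose A) = transpose (?L A)"
    unfolding tr matrix_transpose_mul transpose_transpose by (rule add.commute)
  also have "transpose (?L A) = ?L A"
    unfolding A[symmetric] using C by (simp add: sym_matrices_def)
  finally have "transpose A = A" by (rule injD[OF \<open>inj ?L\<close>])
  then show ?thesis
    by (intro that[of A]) (simp_all only: A sym_matrices_def mem_Collect_eq)
qed

section \<open>Interpolation of minimal norm in Hilbert spaces of functions\<close>

text \<open>
  Elements are functions, with pointwise operations, so the Hilbert space theory needed below is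
  developed for the inner product \<open>ip\<close> on the set \<open>H\<close> directly.
\<close>

locale function_hilbert_space =
  fixes \<Omega> :: "'a set" and W :: "'w::real_inner set" and H :: "('a \<Rightarrow> 'w) set"
    and ip :: "('a \<Rightarrow> 'w) \<Rightarrow> ('a \<Rightarrow> 'w) \<Rightarrow> real"
  assumes hilbert: "hilbert_function_space \<Omega> W H ip"
begin

lemmas hilbert_rules = hilbert[unfolded hilbert_function_space_def]

lemma zero_in: "(\<lambda>x. 0) \<in> H"
  using hilbert_rules[THEN conjunct2, THEN conjunct1] by blast

lemma add_in: "M \<in> H \<Longrightarrow> S \<in> H \<Longrightarrow> (\<lambda>x. M x + S x) \<in> H"
  using hilbert_rules[THEN conjunct2, THEN conjunct2, THEN conjunct1] by blast

lemma scale_in: "M \<in> H \<Longrightarrow> (\<lambda>x. c *\<^sub>R M x) \<in> H"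
  using hilbert_rules[THEN conjunct2, THEN conjunct2, THEN conjunct2, THEN conjunct1] by blast

lemma ip_commute: "M \<in> H \<Longrightarrow> S \<in> H \<Longrightarrow> ip M S = ip S M"
  using hilbert_rules[THEN conjunct2, THEN conjunct2, THEN conjunct2, THEN conjunct2, THEN conjunct1] by blast

lemma ip_add_left: "M \<in> H \<Longrightarrow> S \<in> H \<Longrightarrow> T \<in> H \<Longrightarrow> ip (\<lambda>x. M x + S x) T = ip M T + ip S T"
  using hilbert_rules[THEN conjunct2, THEN conjunct2, THEN conjunct2, THEN conjunct2, THEN conjunct2, THEN conjunct1] by blast

lemma ip_scale_left: "M \<in> H \<Longrightarrow> S \<in> H \<Longrightarrow> ip (\<lambda>x. c *\<^sub>R M x) S = c * ip M S"
  using hilbert_rules[THEN conjunct2, THEN conjunct2, THEN conjunct2, THEN conjunct2, THEN conjunct2, THEN conjunct2, THEN conjunct1] by blast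

lemma ip_pos: "M \<in> H \<Longrightarrow> M \<noteq> (\<lambda>x. 0) \<Longrightarrow> 0 < ip M M"
  using hilbert_rules[THEN conjunct2, THEN conjunct2, THEN conjunct2, THEN conjunct2, THEN conjunct2, THEN conjunct2, THEN conjunct2, THEN conjunct1] by blast

lemma complete:
  assumes "\<And>m. u m \<in> H" "\<And>e. e > 0 \<Longrightarrow> \<exists>K::nat. \<forall>m\<ge>K. \<forall>m'\<ge>K. ip_norm ip (\<lambda>x. u m x - u m' x) < e"
  obtains M where "M \<in> H" "(\<lambda>m. ip_norm ip (\<lambda>x. u m x - M x)) \<longlonglongrightarrow> 0"
proof -
  have "\<forall>u :: nat \<Rightarrow> 'a \<Rightarrow> 'w. (\<forall>m. u m \<in> H) \<and>
        (\<forall>e>0. \<exists>K. \<forall>m\<ge>K. \<forall>m'\<ge>K. ip_norm ip (\<lambda>x. u m x - u m' x) < e) \<longrightarrow>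
        (\<exists>M\<in>H. (\<lambda>m. ip_norm ip (\<lambda>x. u m x - M x)) \<longlonglongrightarrow> 0)"
    using hilbert_rules by (elim conjE)
  from this[rule_format, of u] assms that show ?thesis by auto
qed

lemma diff_in: "M \<in> H \<Longrightarrow> S \<in> H \<Longrightarrow> (\<lambda>x. M x - S x) \<in> H"
  using add_in[of M "\<lambda>x. (- 1) *\<^sub>R S x"] scale_in[of S "- 1"] by simp

lemma ip_add_right: "M \<in> H \<Longrightarrow> S \<in> H \<Longrightarrow> T \<in> H \<Longrightarrow> ip T (\<lambda>x. M x + S x) = ip T M + ip T S"
  by (simp add: ip_commute[of T] add_in ip_add_left)

lemma ip_scale_right: "M \<in> H \<Longrightarrow> S \<in> H \<Longrightarrow> ip S (\<lambda>x. c *\<^sub>R M x) = c * ip S M"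
  by (simp add: ip_commute[of S] scale_in ip_scale_left)

lemma ip_diff_left: "M \<in> H \<Longrightarrow> S \<in> H \<Longrightarrow> T \<in> H \<Longrightarrow> ip (\<lambda>x. M x - S x) T = ip M T - ip S T"
  using ip_add_left[of M "\<lambda>x. (- 1) *\<^sub>R S x" T] ip_scale_left[of S T "- 1"] scale_in[of S "- 1"] by simp

lemma ip_diff_right: "M \<in> H \<Longrightarrow> S \<in> H \<Longrightarrow> T \<in> H \<Longrightarrow> ip T (\<lambda>x. M x - S x) = ip T M - ip T S"
  by (simp add: ip_commute[of T] diff_in ip_diff_left)

lemma ip_zero_left: "M \<in> H \<Longrightarrow> ip (\<lambda>x. 0) M = 0"
  using ip_scale_left[of M M 0] by simp

lemma ip_nonneg: "M \<in> H \<Longrightarrow> 0 \<le> ip M M"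
  using ip_pos[of M] ip_zero_left[OF zero_in] by (cases "M = (\<lambda>x. 0)") auto

lemma ip_eq_0D: "M \<in> H \<Longrightarrow> ip M M = 0 \<Longrightarrow> M = (\<lambda>x. 0)"
  using ip_pos[of M] by force

lemma sum_in: "finite A \<Longrightarrow> (\<And>a. a \<in> A \<Longrightarrow> r a \<in> H) \<Longrightarrow> (\<lambda>x. \<Sum>a\<in>A. c a *\<^sub>R r a x) \<in> H"
  by (induction A rule: finite_induct) (auto simp: zero_in intro!: add_in scale_in)

lemma ip_sum_left:
  "finite A \<Longrightarrow> (\<And>a. a \<in> A \<Longrightarrow> r a \<in> H) \<Longrightarrow> M \<in> H \<Longrightarrow> ip (\<lambda>x. \<Sum>a\<in>A. c a *\<^sub>R r a x) M = (\<Sum>a\<in>A. c a * ip (r a) M)"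
  by (induction A rule: finite_induct) (auto simp: ip_zero_left ip_add_left ip_scale_left sum_in scale_in)

lemma ip_norm_power2: "M \<in> H \<Longrightarrow> (ip_norm ip M)\<^sup>2 = ip M M"
  by (simp add: ip_norm_def ip_nonneg)

lemma parallelogram:
  assumes "M \<in> H" "S \<in> H"
  shows "ip (\<lambda>x. M x - S x) (\<lambda>x. M x - S x) =
    2 * ip M M + 2 * ip S S - 4 * ip (\<lambda>x. (1 / 2) *\<^sub>R (M x + S x)) (\<lambda>x. (1 / 2) *\<^sub>R (M x + S x))"
  using assms
  by (simp add: ip_diff_left ip_diff_right ip_scale_left ip_scale_right ip_add_left ip_add_right
      add_in scale_in diff_in ip_commute[of S M] del: scaleR_add_right) (simp add: field_simps)

text \<open>
  A quantitative continuity of the squared norm, which replaces the triangle inequality.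
\<close>

lemma ip_add_le:
  assumes "M \<in> H" "S \<in> H" "e > 0"
  shows "ip (\<lambda>x. M x + S x) (\<lambda>x. M x + S x) \<le> (1 + e) * ip M M + (1 + 1 / e) * ip S S"
proof -
  have "0 \<le> ip (\<lambda>x. e *\<^sub>R M x - S x) (\<lambda>x. e *\<^sub>R M x - S x)"
    using assms by (intro ip_nonneg diff_in scale_in)
  also have "\<dots> = e * (e * ip M M) - 2 * e * ip M S + ip S S"
    using assms by (simp add: ip_diff_left ip_diff_right ip_scale_left ip_scale_right scale_in diff_in ip_commute[of S M])
  finally have "2 * ip M S * e \<le> e * (e * ip M M) + ip S S" by (simp add: algebra_simps)
  then have "2 * ip M S \<le> e * ip M M + 1 / e * ip S S"
    using \<open>e > 0\<close> by (simp add: field_simps)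
  then show ?thesis
    using assms by (simp add: ip_add_left ip_add_right add_in ip_commute[of S M] algebra_simps)
qed

text \<open>
  By the parallelogram law the norms of midpoints force a minimising sequence to be Cauchy.
\<close>

lemma minimal_norm_point:
  assumes K: "K \<subseteq> H" "K \<noteq> {}"
    and mid: "\<And>M S. M \<in> K \<Longrightarrow> S \<in> K \<Longrightarrow> (\<lambda>x. (1 / 2) *\<^sub>R (M x + S x)) \<in> K"
    and closed: "\<And>u M. (\<And>m::nat. u m \<in> K) \<Longrightarrow> M \<in> H \<Longrightarrow> (\<lambda>m. ip_norm ip (\<lambda>x. u m x - M x)) \<longlonglongrightarrow> 0 \<Longrightarrow> M \<in> K"
  obtains S where "S \<in> K" "\<And>M. M \<in> K \<Longrightarrow> ip S S \<le> ip M M"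
proof -
  define d where "d = Inf ((\<lambda>M. ip M M) ` K)"
  have bdd: "bdd_below ((\<lambda>M. ip M M) ` K)"
    using K(1) ip_nonneg by (intro bdd_belowI[of _ 0]) auto
  have d: "d \<le> ip M M" if "M \<in> K" for M
    unfolding d_def using that bdd by (intro cInf_lower) auto
  have d0: "0 \<le> d"
    unfolding d_def using K ip_nonneg by (intro cInf_greatest) auto
  have "\<exists>M\<in>K. ip M M < d + 1 / real (Suc m)" for m
    using cInf_lessD[of "(\<lambda>M. ip M M) ` K" "d + 1 / real (Suc m)"] K(2) unfolding d_def by auto
  then obtain u where u: "\<And>m. u m \<in> K" "\<And>m. ip (u m) (u m) < d + 1 / real (Suc m)" by metis
  have uH: "u m \<in> H" for m using u(1) K(1) by blast
  have diff: "ip (\<lambda>x. u m x - u m' x) (\<lambda>x. u m x - u m' x) \<le> 2 / real (Suc m) + 2 / real (Suc m')" for m m'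
    using parallelogram[OF uH[of m] uH[of m']] d[OF mid[OF u(1)[of m] u(1)[of m']]] u(2)[of m] u(2)[of m']
    by linarith
  have cauchy: "\<exists>K. \<forall>m\<ge>K. \<forall>m'\<ge>K. ip_norm ip (\<lambda>x. u m x - u m' x) < e" if e: "e > 0" for e
  proof -
    obtain k where k: "k \<noteq> 0" "inverse (real k) < e\<^sup>2 / 4" using real_arch_inverse[of "e\<^sup>2 / 4"] e by auto
    have small: "2 / real (Suc m) < e\<^sup>2 / 2" if "m \<ge> k" for m
    proof -
      have "1 / real (Suc m) \<le> inverse (real k)" using that k(1) by (simp add: inverse_eq_divide frac_le)
      then show ?thesis using k(2) by simp
    qed
    show ?thesis
    proof (intro exI[of _ k] allI impI)
      fix m m' assume "m \<ge> k" "m' \<ge> k"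
      then have "ip (\<lambda>x. u m x - u m' x) (\<lambda>x. u m x - u m' x) < e\<^sup>2"
        using diff[of m m'] small[of m] small[of m'] by linarith
      then show "ip_norm ip (\<lambda>x. u m x - u m' x) < e"
        unfolding ip_norm_def using e by (intro real_less_lsqrt) (auto intro!: ip_nonneg diff_in uH)
    qed
  qed
  obtain S where S: "S \<in> H" "(\<lambda>m. ip_norm ip (\<lambda>x. u m x - S x)) \<longlonglongrightarrow> 0"
    by (rule complete[of u, OF uH cauchy]) blast
  have SK: "S \<in> K" by (rule closed[OF u(1) S])
  \<comment> \<open>The squared norm of the limit is at most the infimum \<open>d\<close>, first up to a factor \<open>1 + e\<close>.\<close>
  have Le: "ip S S \<le> (1 + e) * d" if e: "e > 0" for e
  proof (rule LIMSEQ_le_const)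
    have "(\<lambda>m. 1 / real (Suc m)) \<longlonglongrightarrow> 0"
      using LIMSEQ_inverse_real_of_nat by (simp add: inverse_eq_divide)
    then have "(\<lambda>m. (1 + e) * (d + 1 / real (Suc m)) + (1 + 1 / e) * (ip_norm ip (\<lambda>x. u m x - S x))\<^sup>2) \<longlonglongrightarrow> (1 + e) * (d + 0) + (1 + 1 / e) * 0\<^sup>2"
      by (intro tendsto_intros S(2))
    then show "(\<lambda>m. (1 + e) * (d + 1 / real (Suc m)) + (1 + 1 / e) * (ip_norm ip (\<lambda>x. u m x - S x))\<^sup>2) \<longlonglongrightarrow> (1 + e) * d"
      by simp
    have "ip S S \<le> (1 + e) * (d + 1 / real (Suc m)) + (1 + 1 / e) * (ip_norm ip (\<lambda>x. u m x - S x))\<^sup>2" for m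
    proof -
      have D: "(\<lambda>x. u m x - S x) \<in> H" "(\<lambda>x. S x - u m x) \<in> H" by (intro diff_in uH S(1))+
      have sw: "ip (\<lambda>x. S x - u m x) (\<lambda>x. S x - u m x) = (ip_norm ip (\<lambda>x. u m x - S x))\<^sup>2"
        unfolding ip_norm_power2[OF D(1)] using uH[of m] S(1)
        by (simp add: ip_diff_left ip_diff_right diff_in)
      have "ip S S \<le> (1 + e) * ip (u m) (u m) + (1 + 1 / e) * (ip_norm ip (\<lambda>x. u m x - S x))\<^sup>2"
        using ip_add_le[OF uH[of m] D(2) e] unfolding sw by simp
      also have "\<dots> \<le> (1 + e) * (d + 1 / real (Suc m)) + (1 + 1 / e) * (ip_norm ip (\<lambda>x. u m x - S x))\<^sup>2"
        using u(2)[of m] e by (intro add_right_mono mult_left_mono) auto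
      finally show ?thesis .
    qed
    then show "\<exists>N. \<forall>m\<ge>N. ip S S \<le> (1 + e) * (d + 1 / real (Suc m)) + (1 + 1 / e) * (ip_norm ip (\<lambda>x. u m x - S x))\<^sup>2"
      by blast
  qed
  have "ip S S \<le> d"
  proof (rule LIMSEQ_le_const)
    have "(\<lambda>m. 1 / real (Suc m)) \<longlonglongrightarrow> 0"
      using LIMSEQ_inverse_real_of_nat by (simp add: inverse_eq_divide)
    then have "(\<lambda>m. (1 + 1 / real (Suc m)) * d) \<longlonglongrightarrow> (1 + 0) * d"
      by (intro tendsto_intros)
    then show "(\<lambda>m. (1 + 1 / real (Suc m)) * d) \<longlonglongrightarrow> d" by simp
    show "\<exists>N. \<forall>m\<ge>N. ip S S \<le> (1 + 1 / real (Suc m)) * d"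
      by (intro exI[of _ 0] allI impI Le) simp
  qed
  then show ?thesis
    using SK d by (intro that[of S]) (auto intro: order_trans)
qed

lemma functional_diff:
  assumes "bounded_functional_on H ip l" "M \<in> H" "S \<in> H"
  shows "l (\<lambda>x. M x - S x) = l M - l S"
proof -
  have add: "\<And>M S. M \<in> H \<Longrightarrow> S \<in> H \<Longrightarrow> l (\<lambda>x. M x + S x) = l M + l S"
    and scale: "\<And>c M. M \<in> H \<Longrightarrow> l (\<lambda>x. c *\<^sub>R M x) = c * l M"
    using assms(1) by (auto simp: bounded_functional_on_def)
  show ?thesis
    using add[OF assms(2) scale_in[OF assms(3), of "- 1"]] scale[OF assms(3), of "- 1"] by simp
qed

lemma functional_sum:
  assumes "bounded_functional_on H ip l"
  shows "finite A \<Longrightarrow> (\<And>a. a \<in> A \<Longrightarrow> r a \<in> H) \<Longrightarrow> l (\<lambda>x. \<Sum>a\<in>A. c a *\<^sub>R r a x) = (\<Sum>a\<in>A. c a * l (r a))"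
proof (induction A rule: finite_induct)
  case empty
  have "\<And>c M. M \<in> H \<Longrightarrow> l (\<lambda>x. c *\<^sub>R M x) = c * l M"
    using assms by (auto simp: bounded_functional_on_def)
  from this[OF zero_in, of 0] show ?case by simp
next
  case (insert a A)
  have add: "\<And>M S. M \<in> H \<Longrightarrow> S \<in> H \<Longrightarrow> l (\<lambda>x. M x + S x) = l M + l S"
    and scale: "\<And>c M. M \<in> H \<Longrightarrow> l (\<lambda>x. c *\<^sub>R M x) = c * l M"
    using assms by (auto simp: bounded_functional_on_def)
  show ?case
    using insert by (simp add: add scale scale_in sum_in)
qed

text \<open>
  Bounded functionals define closed affine sets; the point of least norm is orthogonal to the
  directions of the affine set, since moving along such a direction cannot decrease the norm.
\<close>

lemma affine_minimizer:
  assumes l: "\<And>a. a \<in> A \<Longrightarrow> bounded_functional_on H ip (l a)"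
    and M0: "M0 \<in> H" "\<And>a. a \<in> A \<Longrightarrow> l a M0 = t a"
  obtains S where "S \<in> H" "\<And>a. a \<in> A \<Longrightarrow> l a S = t a"
    "\<And>D. D \<in> H \<Longrightarrow> (\<And>a. a \<in> A \<Longrightarrow> l a D = 0) \<Longrightarrow> ip S D = 0"
proof -
  define K where "K = {M \<in> H. \<forall>a\<in>A. l a M = t a}"
  have add: "\<And>a M S. a \<in> A \<Longrightarrow> M \<in> H \<Longrightarrow> S \<in> H \<Longrightarrow> l a (\<lambda>x. M x + S x) = l a M + l a S"
    and scale: "\<And>a c M. a \<in> A \<Longrightarrow> M \<in> H \<Longrightarrow> l a (\<lambda>x. c *\<^sub>R M x) = c * l a M"
    and bd: "\<And>a. a \<in> A \<Longrightarrow> \<exists>B. \<forall>M\<in>H. \<bar>l a M\<bar> \<le> B * ip_norm ip M"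
    using l by (auto simp: bounded_functional_on_def)
  obtain S where S: "S \<in> K" "\<And>M. M \<in> K \<Longrightarrow> ip S S \<le> ip M M"
  proof (rule minimal_norm_point[of K])
    show "K \<subseteq> H" "K \<noteq> {}" using M0 by (auto simp: K_def)
    show "(\<lambda>x. (1 / 2) *\<^sub>R (M x + S x)) \<in> K" if "M \<in> K" "S \<in> K" for M S
      using that by (auto simp: K_def add scale add_in scale_in simp del: scaleR_add_right)
    show "M \<in> K" if u: "\<And>m::nat. u m \<in> K" and M: "M \<in> H" and lim: "(\<lambda>m. ip_norm ip (\<lambda>x. u m x - M x)) \<longlonglongrightarrow> 0" for u M
    proof -
      have uH: "u m \<in> H" for m using u by (auto simp: K_def)
      have "l a M = t a" if a: "a \<in> A" for a
      proof -
        obtain B where B: "\<And>M. M \<in> H \<Longrightarrow> \<bar>l a M\<bar> \<le> B * ip_norm ip M" using bd[OF a] by blast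
        have "\<bar>t a - l a M\<bar> \<le> B * ip_norm ip (\<lambda>x. u m x - M x)" for m
        proof -
          have "l a (u m) = t a" using u[of m] a by (simp add: K_def)
          then show ?thesis
            using B[OF diff_in[OF uH[of m] M]] functional_diff[OF l[OF a] uH[of m] M] by simp
        qed
        moreover have "(\<lambda>m. B * ip_norm ip (\<lambda>x. u m x - M x)) \<longlonglongrightarrow> 0"
          using tendsto_mult_left[OF lim, of B] by simp
        ultimately have "\<bar>t a - l a M\<bar> \<le> 0"
          by (intro LIMSEQ_le_const) blast+
        then show ?thesis by simp
      qed
      then show ?thesis using M by (simp add: K_def)
    qed
  qed blast
  have SH: "S \<in> H" and lS: "\<And>a. a \<in> A \<Longrightarrow> l a S = t a" using S(1) by (auto simp: K_def)
  have orth: "ip S D = 0" if D: "D \<in> H" "\<And>a. a \<in> A \<Longrightarrow> l a D = 0" for D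
  proof (rule ccontr)
    assume ne: "ip S D \<noteq> 0"
    define b q where "b = ip S D" and "q = ip D D"
    have q: "q \<ge> 0" using ip_nonneg[OF D(1)] by (simp add: q_def)
    \<comment> \<open>The minimiser of the quadratic \<open>2 * c * b + c\<^sup>2 * q\<close> would be \<open>- b / q\<close>; adding \<open>1\<close> avoids the case \<open>q = 0\<close>.\<close>
    define c where "c = - b / (q + 1)"
    have "(\<lambda>x. S x + c *\<^sub>R D x) \<in> K"
      using SH D by (auto simp: K_def add scale add_in scale_in lS)
    then have "ip S S \<le> ip (\<lambda>x. S x + c *\<^sub>R D x) (\<lambda>x. S x + c *\<^sub>R D x)" by (rule S(2))
    also have "\<dots> = ip S S + 2 * c * b + c * (c * q)"
      using SH D(1) by (simp add: ip_add_left ip_add_right ip_scale_left ip_scale_right add_in scale_in ip_commute[of D S] b_def q_def)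
    finally have "0 \<le> c * (2 * b + c * q)" by (simp add: algebra_simps)
    also have "2 * b + c * q = b * ((q + 2) / (q + 1))"
      using q by (simp add: c_def field_simps)
    also have "c * (b * ((q + 2) / (q + 1))) = - ((b * b) * ((q + 2) / ((q + 1) * (q + 1))))"
      by (simp add: c_def)
    finally have "(b * b) * ((q + 2) / ((q + 1) * (q + 1))) \<le> 0" by simp
    moreover have "b * b > 0" using ne by (simp add: b_def flip: power2_eq_square)
    moreover have "(q + 2) / ((q + 1) * (q + 1)) > 0" using q by simp
    ultimately show False by (metis mult_pos_pos not_le)
  qed
  show ?thesis by (rule that[OF SH lS orth])
qed

text \<open>
  For \<open>l \<noteq> 0\<close> take \<open>S\<close> of least norm with \<open>l S = 1\<close>. It is orthogonal to the kernel of \<open>l\<close>, which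
  contains \<open>M - l M * S\<close>.
\<close>

lemma riesz_representation:
  assumes l: "bounded_functional_on H ip l"
  obtains r where "r \<in> H" "\<And>M. M \<in> H \<Longrightarrow> l M = ip M r"
proof (cases "\<forall>M\<in>H. l M = 0")
  case True
  show ?thesis
    by (rule that[OF zero_in]) (simp add: True ip_commute[OF _ zero_in] ip_zero_left)
next
  case False
  then obtain M1 where M1: "M1 \<in> H" "l M1 \<noteq> 0" by blast
  have scale: "\<And>c M. M \<in> H \<Longrightarrow> l (\<lambda>x. c *\<^sub>R M x) = c * l M"
    using l by (auto simp: bounded_functional_on_def)
  have "l (\<lambda>x. (1 / l M1) *\<^sub>R M1 x) = 1" using scale[OF M1(1)] M1(2) by simp
  then obtain S where S: "S \<in> H" "l S = 1" "\<And>D. D \<in> H \<Longrightarrow> l D = 0 \<Longrightarrow> ip S D = 0"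
    using affine_minimizer[of "UNIV :: unit set" "\<lambda>_. l" "\<lambda>x. (1 / l M1) *\<^sub>R M1 x" "\<lambda>_. 1"] l scale_in[OF M1(1)]
    by auto
  have "S \<noteq> (\<lambda>x. 0)"
  proof
    assume "S = (\<lambda>x. 0)"
    then have "l S = 0" using scale[OF S(1), of 0] by simp
    then show False using S(2) by simp
  qed
  then have pos: "ip S S > 0" by (rule ip_pos[OF S(1)])
  have "l M = ip M (\<lambda>x. (1 / ip S S) *\<^sub>R S x)" if M: "M \<in> H" for M
  proof -
    have D: "(\<lambda>x. M x - l M *\<^sub>R S x) \<in> H" by (intro diff_in scale_in M S(1))
    have "l (\<lambda>x. M x - l M *\<^sub>R S x) = 0"
      using functional_diff[OF l M scale_in[OF S(1)]] scale[OF S(1)] S(2) by simp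
    then have "ip S (\<lambda>x. M x - l M *\<^sub>R S x) = 0" by (rule S(3)[OF D])
    then have "ip S M = l M * ip S S"
      using M S(1) by (simp add: ip_diff_right ip_scale_right scale_in)
    then show ?thesis
      using pos M S(1) by (simp add: ip_scale_right ip_commute[of M S])
  qed
  then show ?thesis by (rule that[OF scale_in[OF S(1)]])
qed

text \<open>
  The dual family \<open>B\<close> expresses the linear independence of the functionals. A solution \<open>S\<close> of
  least norm is orthogonal to the common kernel, which contains \<open>M - (\<Sum>b\<in>A. l b M * B b)\<close> for every \<open>M\<close>;
  hence \<open>S\<close> and the combination of the representers \<open>r b\<close> with coefficients \<open>ip S (B b)\<close> have the same
  inner product with every \<open>M\<close>. Uniqueness of \<open>S\<close> is Pythagoras' theorem. The coefficients are
  unique since pairing with \<open>B a\<close> reads off the one with index \<open>a\<close>.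
\<close>

theorem minimal_norm_interpolation:
  assumes A: "finite A"
    and l: "\<And>a. a \<in> A \<Longrightarrow> bounded_functional_on H ip (l a)"
    and r: "\<And>a. a \<in> A \<Longrightarrow> r a \<in> H" "\<And>a M. a \<in> A \<Longrightarrow> M \<in> H \<Longrightarrow> l a M = ip M (r a)"
    and B: "\<And>a. a \<in> A \<Longrightarrow> B a \<in> H" "\<And>a b. a \<in> A \<Longrightarrow> b \<in> A \<Longrightarrow> l a (B b) = (if a = b then 1 else 0)"
  obtains c S where "S = (\<lambda>x. \<Sum>b\<in>A. c b *\<^sub>R r b x)" "S \<in> H" "\<And>a. a \<in> A \<Longrightarrow> l a S = t a"
    and "\<And>M. M \<in> H \<Longrightarrow> (\<And>a. a \<in> A \<Longrightarrow> l a M = t a) \<Longrightarrow> ip S S \<le> ip M M"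
    and "\<And>M. M \<in> H \<Longrightarrow> (\<And>a. a \<in> A \<Longrightarrow> l a M = t a) \<Longrightarrow> ip M M \<le> ip S S \<Longrightarrow> M = S"
    and "\<And>c'. (\<And>a. a \<in> A \<Longrightarrow> l a (\<lambda>x. \<Sum>b\<in>A. c' b *\<^sub>R r b x) = t a) \<Longrightarrow> (\<And>a. a \<in> A \<Longrightarrow> c' a = c a)"
proof -
  have in_H: "(\<lambda>x. \<Sum>b\<in>A. c b *\<^sub>R r b x) \<in> H" for c by (intro sum_in A r(1))
  have dual: "c a = ip (\<lambda>x. \<Sum>b\<in>A. c b *\<^sub>R r b x) (B a)" if a: "a \<in> A" for c a
  proof -
    have "ip (\<lambda>x. \<Sum>b\<in>A. c b *\<^sub>R r b x) (B a) = (\<Sum>b\<in>A. c b * ip (r b) (B a))"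
      by (rule ip_sum_left[OF A r(1) B(1)[OF a]])
    also have "\<dots> = (\<Sum>b\<in>A. c b * l b (B a))"
      using r B(1)[OF a] by (intro sum.cong refl) (simp add: ip_commute)
    also have "\<dots> = (\<Sum>b\<in>A. if b = a then c b else 0)"
      using B(2) a by (intro sum.cong refl) auto
    finally show ?thesis using a A by simp
  qed
  have "l a (\<lambda>x. \<Sum>b\<in>A. t b *\<^sub>R B b x) = t a" if a: "a \<in> A" for a
  proof -
    have "l a (\<lambda>x. \<Sum>b\<in>A. t b *\<^sub>R B b x) = (\<Sum>b\<in>A. t b * l a (B b))"
      by (rule functional_sum[OF l[OF a] A B(1)])
    also have "\<dots> = (\<Sum>b\<in>A. if a = b then t b else 0)"
      using B(2) a by (intro sum.cong refl) auto
    finally show ?thesis using a A by simp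
  qed
  with l sum_in[OF A B(1)] obtain S where S: "S \<in> H" "\<And>a. a \<in> A \<Longrightarrow> l a S = t a"
    "\<And>D. D \<in> H \<Longrightarrow> (\<And>a. a \<in> A \<Longrightarrow> l a D = 0) \<Longrightarrow> ip S D = 0"
    by (rule affine_minimizer[of A l "\<lambda>x. \<Sum>b\<in>A. t b *\<^sub>R B b x" t]) blast+
  define c where "c = (\<lambda>a. ip S (B a))"
  have orth: "ip (\<lambda>x. S x - (\<Sum>b\<in>A. c b *\<^sub>R r b x)) M = 0" if M: "M \<in> H" for M
  proof -
    have P: "(\<lambda>x. \<Sum>b\<in>A. l b M *\<^sub>R B b x) \<in> H" by (intro sum_in A B(1))
    have "l a (\<lambda>x. M x - (\<Sum>b\<in>A. l b M *\<^sub>R B b x)) = 0" if a: "a \<in> A" for a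
    proof -
      have "l a (\<lambda>x. \<Sum>b\<in>A. l b M *\<^sub>R B b x) = (\<Sum>b\<in>A. l b M * l a (B b))"
        by (rule functional_sum[OF l[OF a] A B(1)])
      also have "\<dots> = (\<Sum>b\<in>A. if a = b then l b M else 0)"
        using B(2) a by (intro sum.cong refl) auto
      finally have "l a (\<lambda>x. \<Sum>b\<in>A. l b M *\<^sub>R B b x) = l a M" using a A by simp
      then show ?thesis using functional_diff[OF l[OF a] M P] by simp
    qed
    then have "ip S (\<lambda>x. M x - (\<Sum>b\<in>A. l b M *\<^sub>R B b x)) = 0"
      by (intro S(3) diff_in M P)
    then have "ip S M = ip S (\<lambda>x. \<Sum>b\<in>A. l b M *\<^sub>R B b x)"
      using ip_diff_right[OF M P S(1)] by simp
    also have "\<dots> = (\<Sum>b\<in>A. l b M * ip (B b) S)"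
      using ip_sum_left[OF A B(1) S(1), where c = "\<lambda>b. l b M"] ip_commute[OF S(1) P] by simp
    also have "\<dots> = (\<Sum>b\<in>A. c b * ip (r b) M)"
      using r(2)[OF _ M] B(1) S(1) r(1) M by (intro sum.cong refl) (simp add: c_def ip_commute)
    also have "\<dots> = ip (\<lambda>x. \<Sum>b\<in>A. c b *\<^sub>R r b x) M"
      by (rule ip_sum_left[OF A r(1) M, symmetric])
    finally show ?thesis using ip_diff_left[OF S(1) in_H M] by simp
  qed
  have D: "(\<lambda>x. S x - (\<Sum>b\<in>A. c b *\<^sub>R r b x)) \<in> H" by (intro diff_in S(1) in_H)
  have "(\<lambda>x. S x - (\<Sum>b\<in>A. c b *\<^sub>R r b x)) = (\<lambda>x. 0)" by (rule ip_eq_0D[OF D orth[OF D]])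
  then have eq: "S = (\<lambda>x. \<Sum>b\<in>A. c b *\<^sub>R r b x)" by (simp add: fun_eq_iff)
  have pyth: "ip M M = ip S S + ip (\<lambda>x. M x - S x) (\<lambda>x. M x - S x)"
    if M: "M \<in> H" "\<And>a. a \<in> A \<Longrightarrow> l a M = t a" for M
  proof -
    have "ip S (\<lambda>x. M x - S x) = 0"
      using M S(1,2) functional_diff[OF l M(1) S(1)] by (intro S(3) diff_in) auto
    then have "ip S M = ip S S" using ip_diff_right[OF M(1) S(1) S(1)] by simp
    then show ?thesis
      using M(1) S(1) by (simp add: ip_diff_left ip_diff_right diff_in ip_commute[of M S])
  qed
  show ?thesis
  proof (rule that[OF eq S(1,2)])
    show "ip S S \<le> ip M M" if "M \<in> H" "\<And>a. a \<in> A \<Longrightarrow> l a M = t a" for M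
      using pyth[OF that] ip_nonneg[OF diff_in[OF that(1) S(1)]] by linarith
    show "M = S" if M: "M \<in> H" "\<And>a. a \<in> A \<Longrightarrow> l a M = t a" and le: "ip M M \<le> ip S S" for M
    proof -
      have MS: "(\<lambda>x. M x - S x) \<in> H" by (intro diff_in M(1) S(1))
      have "ip (\<lambda>x. M x - S x) (\<lambda>x. M x - S x) = 0"
        using pyth[OF M] ip_nonneg[OF MS] le by linarith
      then have "(\<lambda>x. M x - S x) = (\<lambda>x. 0)" by (rule ip_eq_0D[OF MS])
      then show ?thesis by (simp add: fun_eq_iff)
    qed
    show "c' a = c a" if c': "\<And>a. a \<in> A \<Longrightarrow> l a (\<lambda>x. \<Sum>b\<in>A. c' b *\<^sub>R r b x) = t a" and a: "a \<in> A" for c' a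
    proof -
      let ?S' = "\<lambda>x. \<Sum>b\<in>A. c' b *\<^sub>R r b x"
      have DS: "(\<lambda>x. ?S' x - S x) \<in> H" by (intro diff_in in_H S(1))
      have z: "l b (\<lambda>x. ?S' x - S x) = 0" if "b \<in> A" for b
        using functional_diff[OF l[OF that] in_H S(1)] c' S(2) that by simp
      have "ip (\<lambda>x. \<Sum>b\<in>A. k b *\<^sub>R r b x) (\<lambda>x. ?S' x - S x) = 0" for k
        using ip_sum_left[OF A r(1) DS, where c = k] z r(2)[OF _ DS] by (simp add: ip_commute[OF r(1) DS])
      from this[of c'] this[of c] have "ip (\<lambda>x. ?S' x - S x) (\<lambda>x. ?S' x - S x) = 0"
        using ip_diff_left[OF in_H S(1) DS] unfolding eq[symmetric] by simp
      then have "(\<lambda>x. ?S' x - S x) = (\<lambda>x. 0)" by (rule ip_eq_0D[OF DS])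
      then have "?S' = S" by (simp add: fun_eq_iff)
      then show ?thesis using dual[OF a, of c'] by (simp add: c_def)
    qed
  qed
qed

end

section \<open>The collocation functionals\<close>

lemma collocation_functional_entry: "collocation_functional f p i j M = F_op f p M $ i $ j"
  by (simp add: collocation_functional_def matrix_vector_mult_basis column_def inner_axis')

lemma F_op_entry:
  "F_op f p M $ i $ j = (\<Sum>k\<in>UNIV. jacobian f (at p) $ k $ i * M p $ k $ j) +
     (\<Sum>k\<in>UNIV. M p $ i $ k * jacobian f (at p) $ k $ j) + frechet_derivative (\<lambda>y. M y $ i $ j) (at p) (f p)"
  by (simp add: F_op_def matrix_matrix_mult_def transpose_def)

text \<open>
  Also for functions that are not differentiable, where both sides are the same unspecified
  value.
\<close>

lemma frechet_derivative_cong_open: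
  assumes "open \<Omega>" "p \<in> \<Omega>" "\<And>y. y \<in> \<Omega> \<Longrightarrow> u y = v y"
  shows "frechet_derivative u (at p) = frechet_derivative v (at p)"
proof -
  have "(u has_derivative D) (at p) \<longleftrightarrow> (v has_derivative D) (at p)" for D
  proof
    assume "(u has_derivative D) (at p)"
    then show "(v has_derivative D) (at p)"
      using assms by (rule has_derivative_transform_within_open)
  next
    assume "(v has_derivative D) (at p)"
    then show "(u has_derivative D) (at p)"
      using assms(1,2) by (rule has_derivative_transform_within_open) (rule assms(3)[symmetric])
  qed
  then show ?thesis by (simp add: frechet_derivative_def)
qed

text \<open>
  The operator only sees a neighbourhood of \<open>p\<close>. So it does not distinguish a kernel section from its
  extension by \<open>0\<close>, nor the ansatz from an element of the Hilbert space that agrees with it on \<open>\<Omega>\<close>.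
\<close>

lemma F_op_cong:
  assumes "open \<Omega>" "p \<in> \<Omega>" "\<And>y. y \<in> \<Omega> \<Longrightarrow> M y = S y"
  shows "F_op f p M = F_op f p S"
proof -
  have "frechet_derivative (\<lambda>y. M y $ i $ j) (at p) = frechet_derivative (\<lambda>y. S y $ i $ j) (at p)" for i j
    using assms by (intro frechet_derivative_cong_open[of \<Omega>]) simp_all
  then show ?thesis using assms by (simp add: F_op_def)
qed

definition entries_differentiable :: "(real^'n \<Rightarrow> real^'n^'n) \<Rightarrow> real^'n \<Rightarrow> bool" where
  "entries_differentiable M p \<longleftrightarrow> (\<forall>i j. (\<lambda>y. M y $ i $ j) differentiable (at p))"

lemma frechet_derivative_add_apply:
  assumes "u differentiable (at p)" "v differentiable (at p)"
  shows "frechet_derivative (\<lambda>y. u y + v y) (at p) d = frechet_derivative u (at p) d + frechet_derivative v (at p) d"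
proof -
  have "((\<lambda>y. u y + v y) has_derivative (\<lambda>d. frechet_derivative u (at p) d + frechet_derivative v (at p) d)) (at p)"
    using assms by (intro has_derivative_add) (simp_all add: frechet_derivative_works)
  from frechet_derivative_at[OF this] show ?thesis by metis
qed

lemma frechet_derivative_cmult_apply:
  fixes u :: "'a::real_normed_vector \<Rightarrow> real"
  assumes "u differentiable (at p)"
  shows "frechet_derivative (\<lambda>y. c * u y) (at p) d = c * frechet_derivative u (at p) d"
proof -
  have "((\<lambda>y. c * u y) has_derivative (\<lambda>d. c * frechet_derivative u (at p) d)) (at p)"
    using assms by (intro has_derivative_mult_right) (simp_all add: frechet_derivative_works)
  from frechet_derivative_at[OF this] show ?thesis by metis
qed

lemma F_op_add:
  assumes "entries_differentiable M p" "entries_differentiable S p"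
  shows "F_op f p (\<lambda>x. M x + S x) = F_op f p M + F_op f p S"
  using assms
  by (simp add: vec_eq_iff F_op_entry frechet_derivative_add_apply entries_differentiable_def
      distrib_left distrib_right sum.distrib)

lemma F_op_scale:
  assumes "entries_differentiable M p"
  shows "F_op f p (\<lambda>x. c *\<^sub>R M x) = c *\<^sub>R F_op f p M"
  using assms
  by (simp add: vec_eq_iff F_op_entry frechet_derivative_cmult_apply entries_differentiable_def
      distrib_left sum_distrib_left mult_ac)

lemma entries_differentiable_add:
  "entries_differentiable M p \<Longrightarrow> entries_differentiable S p \<Longrightarrow> entries_differentiable (\<lambda>x. M x + S x) p"
  by (simp add: entries_differentiable_def)

lemma F_op_transpose: "F_op f p (\<lambda>y. transpose (M y)) = transpose (F_op f p M)"
  by (simp add: vec_eq_iff F_op_entry transpose_def mult.commute add.commute)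

text \<open>
  The product rule for a scalar function times a constant matrix. If \<open>u\<close> vanishes at \<open>p\<close>
  only the derivative of \<open>u\<close> along the flow contributes; if \<open>f p = 0\<close> only the Lyapunov operator does.
\<close>

lemma F_op_scalar_mult:
  assumes "u differentiable (at p)"
  shows "F_op f p (\<lambda>x. u x *\<^sub>R A) =
    u p *\<^sub>R (transpose (jacobian f (at p)) ** A + A ** jacobian f (at p)) + frechet_derivative u (at p) (f p) *\<^sub>R A"
proof -
  have fd: "frechet_derivative (\<lambda>y. u y * a) (at p) d = a * frechet_derivative u (at p) d" for a d
    unfolding mult.commute[of _ a] by (rule frechet_derivative_cmult_apply[OF assms])
  show ?thesis
    by (simp add: fd vec_eq_iff F_op_entry matrix_matrix_mult_def transpose_def distrib_left sum_distrib_left mult_ac)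
qed

locale sobolev_collocation =
  fixes \<Omega> :: "(real^'n) set" and \<sigma> :: real
    and ip :: "(real^'n \<Rightarrow> real^'n^'n) \<Rightarrow> (real^'n \<Rightarrow> real^'n^'n) \<Rightarrow> real"
  assumes open_domain: "open \<Omega>" and order: "\<sigma> > real CARD('n) / 2 + 1"
    and hilbert_sym: "hilbert_function_space \<Omega> sym_matrices (sobolev_sym \<sigma> \<Omega>) ip"
    and norms: "equivalent_norms (sobolev_sym \<sigma> \<Omega>) (ip_norm ip) (sobolev_sym_norm \<sigma> \<Omega>)"
begin

sublocale function_hilbert_space \<Omega> sym_matrices "sobolev_sym \<sigma> \<Omega>" ip
  by unfold_locales (rule hilbert_sym)

lemma sobolev_sym_entries_differentiable:
  assumes "M \<in> sobolev_sym \<sigma> \<Omega>" "p \<in> \<Omega>"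
  shows "entries_differentiable M p"
proof -
  obtain K where "\<And>u x. u \<in> sobolev \<sigma> \<Omega> \<Longrightarrow> x \<in> \<Omega> \<Longrightarrow> u differentiable (at x)"
    by (rule sobolev_embedding_C1[OF order open_domain]) blast
  then show ?thesis
    using assms by (auto simp: entries_differentiable_def sobolev_sym_def)
qed

text \<open>
  The functional is a linear combination of values and first derivatives of entries at \<open>p\<close>, which
  the Sobolev embedding controls.
\<close>

theorem collocation_bounded:
  assumes p: "p \<in> \<Omega>"
  shows "bounded_functional_on (sobolev_sym \<sigma> \<Omega>) ip (collocation_functional f p i j)"
  unfolding bounded_functional_on_def collocation_functional_entry
proof (intro conjI ballI allI)
  fix M S assume "M \<in> sobolev_sym \<sigma> \<Omega>" "S \<in> sobolev_sym \<sigma> \<Omega>"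
  then show "F_op f p (\<lambda>x. M x + S x) $ i $ j = F_op f p M $ i $ j + F_op f p S $ i $ j"
    using sobolev_sym_entries_differentiable[OF _ p] by (simp add: F_op_add)
next
  fix c M assume "M \<in> sobolev_sym \<sigma> \<Omega>"
  then show "F_op f p (\<lambda>x. c *\<^sub>R M x) $ i $ j = c * F_op f p M $ i $ j"
    using sobolev_sym_entries_differentiable[OF _ p] by (simp add: F_op_scale)
next
  obtain K where K: "K \<ge> 0" 
    "\<And>u x. u \<in> sobolev \<sigma> \<Omega> \<Longrightarrow> x \<in> \<Omega> \<Longrightarrow> \<bar>u x\<bar> \<le> K * sobolev_norm \<sigma> \<Omega> u"
    "\<And>u x d. u \<in> sobolev \<sigma> \<Omega> \<Longrightarrow> x \<in> \<Omega> \<Longrightarrow> \<bar>frechet_derivative u (at x) d\<bar> \<le> norm d * K * sobolev_norm \<sigma> \<Omega> u"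
    by (rule sobolev_embedding_C1[OF order open_domain]) blast
  obtain c where c: "c > 0" "\<And>M. M \<in> sobolev_sym \<sigma> \<Omega> \<Longrightarrow> c * sobolev_sym_norm \<sigma> \<Omega> M \<le> ip_norm ip M"
    using norms unfolding equivalent_norms_def by blast
  let ?J = "jacobian f (at p)"
  define B where "B = (\<Sum>k\<in>UNIV. \<bar>?J $ k $ i\<bar> * K) + (\<Sum>k\<in>UNIV. K * \<bar>?J $ k $ j\<bar>) + norm (f p) * K"
  have B0: "B \<ge> 0" using K(1) by (simp add: B_def sum_nonneg)
  show "\<exists>K. \<forall>M\<in>sobolev_sym \<sigma> \<Omega>. \<bar>F_op f p M $ i $ j\<bar> \<le> K * ip_norm ip M"
  proof (intro exI ballI)
    fix M assume M: "M \<in> sobolev_sym \<sigma> \<Omega>"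
    let ?N = "sobolev_sym_norm \<sigma> \<Omega> M"
    have ent: "(\<lambda>x. M x $ a $ b) \<in> sobolev \<sigma> \<Omega>" for a b using M by (auto simp: sobolev_sym_def)
    have le: "sobolev_norm \<sigma> \<Omega> (\<lambda>x. M x $ a $ b) \<le> ?N" for a b
    proof -
      have "(sobolev_norm \<sigma> \<Omega> (\<lambda>x. M x $ a $ b))\<^sup>2 \<le> (\<Sum>j\<in>UNIV. (sobolev_norm \<sigma> \<Omega> (\<lambda>x. M x $ a $ j))\<^sup>2)"
        by (rule member_le_sum) auto
      also have "\<dots> \<le> (\<Sum>i\<in>UNIV. \<Sum>j\<in>UNIV. (sobolev_norm \<sigma> \<Omega> (\<lambda>x. M x $ i $ j))\<^sup>2)"
        by (rule member_le_sum[of a UNIV "\<lambda>i. \<Sum>j\<in>UNIV. (sobolev_norm \<sigma> \<Omega> (\<lambda>x. M x $ i $ j))\<^sup>2"]) (auto intro: sum_nonneg)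
      finally show ?thesis unfolding sobolev_sym_norm_def by (rule real_le_rsqrt)
    qed
    have v: "\<bar>M p $ a $ b\<bar> \<le> K * ?N" for a b
      using K(2)[OF ent p] mult_left_mono[OF le K(1)] by (rule order_trans)
    have d: "\<bar>frechet_derivative (\<lambda>y. M y $ i $ j) (at p) (f p)\<bar> \<le> norm (f p) * K * ?N"
      using K(3)[OF ent p] mult_left_mono[OF le, of "norm (f p) * K"] K(1) by (meson mult_nonneg_nonneg norm_ge_zero order_trans)
    have "\<bar>F_op f p M $ i $ j\<bar> \<le> (\<Sum>k\<in>UNIV. \<bar>?J $ k $ i * M p $ k $ j\<bar>) + (\<Sum>k\<in>UNIV. \<bar>M p $ i $ k * ?J $ k $ j\<bar>) + \<bar>frechet_derivative (\<lambda>y. M y $ i $ j) (at p) (f p)\<bar>"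
      unfolding F_op_entry by (intro order_trans[OF abs_triangle_ineq] add_mono sum_abs order_refl)
    also have "\<dots> \<le> (\<Sum>k\<in>UNIV. \<bar>?J $ k $ i\<bar> * (K * ?N)) + (\<Sum>k\<in>UNIV. (K * ?N) * \<bar>?J $ k $ j\<bar>) + norm (f p) * K * ?N"
      unfolding abs_mult by (intro add_mono sum_mono mult_left_mono mult_right_mono v d) auto
    also have "\<dots> = B * ?N"
      unfolding B_def distrib_right sum_distrib_right
      by (intro arg_cong2[where f = "(+)"] sum.cong) (simp_all add: mult_ac)
    also have "\<dots> \<le> B * (ip_norm ip M / c)"
      using c(2)[OF M] c(1) by (intro mult_left_mono B0) (simp add: field_simps)
    finally show "\<bar>F_op f p M $ i $ j\<bar> \<le> B / c * ip_norm ip M" by simp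
  qed
qed

text \<open>
  Matrices with a single repeated entry are symmetric. They transfer the linear structure of
  the matrix-valued space, which is part of its being a Hilbert space, to the scalar space.
\<close>

lemma repeated_entry_in_sobolev_sym:
  assumes "u \<in> sobolev \<sigma> \<Omega>"
  shows "(\<lambda>x. \<chi> i j. u x) \<in> sobolev_sym \<sigma> \<Omega>"
  using assms by (auto simp: sobolev_sym_def sym_matrices_def transpose_def)

lemma sobolev_add: "u \<in> sobolev \<sigma> \<Omega> \<Longrightarrow> v \<in> sobolev \<sigma> \<Omega> \<Longrightarrow> (\<lambda>x. u x + v x) \<in> sobolev \<sigma> \<Omega>"
  using add_in[OF repeated_entry_in_sobolev_sym repeated_entry_in_sobolev_sym, of u v] by (auto simp: sobolev_sym_def)

lemma sobolev_scale: "u \<in> sobolev \<sigma> \<Omega> \<Longrightarrow> (\<lambda>x. c * u x) \<in> sobolev \<sigma> \<Omega>"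
  using scale_in[OF repeated_entry_in_sobolev_sym, of u c] by (auto simp: sobolev_sym_def)

lemma scalar_times_matrix:
  assumes "u \<in> sobolev \<sigma> \<Omega>" "A \<in> sym_matrices"
  shows "(\<lambda>x. u x *\<^sub>R A) \<in> sobolev_sym \<sigma> \<Omega>"
  using assms sobolev_scale[OF assms(1), of "A $ i $ j" for i j]
  by (auto simp: sobolev_sym_def sym_matrices_def transpose_def vec_eq_iff mult.commute)

text \<open>
  Closing up under all exponential factors \<open>exp (b \<bullet> x)\<close> makes the set of multipliers stable under
  multiplication with \<open>exp (c \<bullet> x) - s\<close>. These factors replace polynomials vanishing at given points.
\<close>

definition gauss_multiplier :: "(real^'n \<Rightarrow> real) \<Rightarrow> bool" where
  "gauss_multiplier P \<longleftrightarrow> (\<forall>b. zero_off \<Omega> (\<lambda>x. gaussian 1 x * exp (b \<bullet> x) * P x) \<in> sobolev \<sigma> \<Omega>)"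

text \<open>
  Completing the square turns the exponential factor into a translation of the Gaussian.
\<close>

lemma gauss_multiplier_1: "gauss_multiplier (\<lambda>x. 1)"
  unfolding gauss_multiplier_def
proof
  fix b
  have "gaussian 1 x * exp (b \<bullet> x) * 1 = exp ((norm b)\<^sup>2 / 2) * gaussian 1 (x - b)" for x :: "real^'n"
    by (simp add: gaussian_def power2_norm_eq_inner inner_diff_left inner_diff_right inner_commute
        diff_divide_distrib add_divide_distrib flip: exp_add)
  then have "zero_off \<Omega> (\<lambda>x. gaussian 1 x * exp (b \<bullet> x) * 1) = (\<lambda>x. exp ((norm b)\<^sup>2 / 2) * zero_off \<Omega> (\<lambda>x. gaussian 1 (x - b)) x)"
    by (auto simp: zero_off_def)
  then show "zero_off \<Omega> (\<lambda>x. gaussian 1 x * exp (b \<bullet> x) * 1) \<in> sobolev \<sigma> \<Omega>"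
    by (simp only: sobolev_scale gaussian_translate_in_sobolev)
qed

lemma gauss_multiplier_step:
  assumes "gauss_multiplier P"
  shows "gauss_multiplier (\<lambda>x. (exp (c \<bullet> x) - s) * P x)"
  unfolding gauss_multiplier_def
proof
  fix b
  have "zero_off \<Omega> (\<lambda>x. gaussian 1 x * exp (b \<bullet> x) * ((exp (c \<bullet> x) - s) * P x)) =
     (\<lambda>x. zero_off \<Omega> (\<lambda>x. gaussian 1 x * exp ((b + c) \<bullet> x) * P x) x + (- s) * zero_off \<Omega> (\<lambda>x. gaussian 1 x * exp (b \<bullet> x) * P x) x)"
    by (auto simp: zero_off_def inner_add_left exp_add algebra_simps)
  then show "zero_off \<Omega> (\<lambda>x. gaussian 1 x * exp (b \<bullet> x) * ((exp (c \<bullet> x) - s) * P x)) \<in> sobolev \<sigma> \<Omega>"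
    using assms by (simp only: sobolev_add sobolev_scale gauss_multiplier_def)
qed

lemma exp_inner_has_derivative:
  "((\<lambda>x. exp (c \<bullet> x) - s) has_derivative (\<lambda>d. exp (c \<bullet> z) * (c \<bullet> d))) (at (z::real^'n))"
  by (auto intro!: derivative_eq_intros)

text \<open>
  For each point \<open>z\<close> take the square of \<open>exp (c \<bullet> x) - exp (c \<bullet> z)\<close> with \<open>c = x0 - z\<close>: it vanishes at \<open>z\<close>
  to second order, and is not \<open>0\<close> at \<open>x0\<close> because \<open>c \<bullet> x0 \<noteq> c \<bullet> z\<close>.
\<close>

lemma vanishing_multiplier:
  assumes "finite Z" "x0 \<notin> Z"
  shows "\<exists>P. gauss_multiplier P \<and> P x0 \<noteq> 0 \<and> (\<forall>x. P differentiable (at x)) \<and>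
    (\<forall>z\<in>Z. P z = 0 \<and> (P has_derivative (\<lambda>d. 0)) (at z))"
  using assms
proof (induction Z rule: finite_induct)
  case empty
  show ?case by (intro exI[of _ "\<lambda>x. 1"]) (simp add: gauss_multiplier_1)
next
  case (insert z Z)
  then obtain P where P: "gauss_multiplier P" "P x0 \<noteq> 0" "\<And>x. P differentiable (at x)"
    "\<And>z. z \<in> Z \<Longrightarrow> P z = 0" "\<And>z. z \<in> Z \<Longrightarrow> (P has_derivative (\<lambda>d. 0)) (at z)" by auto
  define c where "c = x0 - z"
  define E where "E = (\<lambda>x. exp (c \<bullet> x) - exp (c \<bullet> z))"
  have E': "(E has_derivative (\<lambda>d. exp (c \<bullet> x) * (c \<bullet> d))) (at x)" for x
    unfolding E_def by (rule exp_inner_has_derivative)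
  have "c \<noteq> 0" using insert.prems by (auto simp: c_def)
  moreover have "c \<bullet> x0 - c \<bullet> z = c \<bullet> c"
    unfolding inner_diff_right[symmetric] by (simp only: c_def)
  ultimately have "c \<bullet> x0 \<noteq> c \<bullet> z" by auto
  then have E0: "E x0 \<noteq> 0" by (simp add: E_def)
  let ?P = "\<lambda>x. E x * (E x * P x)"
  have "gauss_multiplier ?P" unfolding E_def by (intro gauss_multiplier_step P(1))
  moreover have "?P x0 \<noteq> 0" using E0 P(2) by simp
  moreover have "?P differentiable (at x)" for x
    using E'[of x] P(3)[of x] by (intro differentiable_mult) (auto simp: differentiable_def)
  moreover have "?P y = 0 \<and> (?P has_derivative (\<lambda>d. 0)) (at y)" if y: "y \<in> insert z Z" for y
  proof -
    obtain D where D: "(P has_derivative D) (at y)" using P(3)[of y] by (auto simp: differentiable_def)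
    have der: "(?P has_derivative (\<lambda>d. E y * (E y * D d + exp (c \<bullet> y) * (c \<bullet> d) * P y) + exp (c \<bullet> y) * (c \<bullet> d) * (E y * P y))) (at y)"
      by (intro has_derivative_mult E' D)
    show ?thesis
    proof (cases "y = z")
      case True
      then have "E y = 0" by (simp add: E_def)
      then show ?thesis using der by simp
    next
      case False
      then have "y \<in> Z" using y by simp
      then have "P y = 0" "(P has_derivative (\<lambda>d. 0)) (at y)" using P(4,5) by auto
      moreover have "(?P has_derivative (\<lambda>d. E y * (E y * 0 + exp (c \<bullet> y) * (c \<bullet> d) * P y) + exp (c \<bullet> y) * (c \<bullet> d) * (E y * P y))) (at y)"
        by (intro has_derivative_mult E' calculation(2))
      ultimately show ?thesis by simp
    qed
  qed
  ultimately show ?case by (intro exI[of _ ?P] conjI allI ballI) auto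
qed

lemma gauss_multiplier_function:
  assumes "gauss_multiplier P" "y \<in> \<Omega>" "(P has_derivative D) (at y)"
  defines "u \<equiv> zero_off \<Omega> (\<lambda>x. gaussian 1 x * P x)"
  shows "u \<in> sobolev \<sigma> \<Omega>" "u y = gaussian 1 y * P y"
    and "P y = 0 \<Longrightarrow> (u has_derivative (\<lambda>d. gaussian 1 y * D d)) (at y)"
proof -
  show "u \<in> sobolev \<sigma> \<Omega>"
    using assms(1)[unfolded gauss_multiplier_def, rule_format, of 0] by (simp add: u_def)
  show "u y = gaussian 1 y * P y" using assms(2) by (simp add: u_def zero_off_def)
  assume P0: "P y = 0"
  have g: "(gaussian 1 has_derivative (\<lambda>d. - (y \<bullet> d * exp (- ((norm y)\<^sup>2 / 2))))) (at y)"
    unfolding gaussian_def[abs_def] by (auto intro!: derivative_eq_intros)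
  have "((\<lambda>x. gaussian 1 x * P x) has_derivative (\<lambda>d. gaussian 1 y * D d)) (at y)"
    using has_derivative_mult[OF g assms(3)] P0 by simp
  then show "(u has_derivative (\<lambda>d. gaussian 1 y * D d)) (at y)"
    by (rule has_derivative_transform_within_open[OF _ open_domain assms(2)]) (simp add: u_def zero_off_def)
qed

lemma bump_value:
  assumes Z: "finite Z" "Z \<subseteq> \<Omega>" "x0 \<in> \<Omega>" "x0 \<notin> Z"
  obtains u where "u \<in> sobolev \<sigma> \<Omega>" "u x0 = 1" "\<And>z. z \<in> Z \<Longrightarrow> u z = 0"
    "\<And>z d. z \<in> Z \<Longrightarrow> frechet_derivative u (at z) d = 0"
proof -
  obtain P where P: "gauss_multiplier P" "P x0 \<noteq> 0" "\<And>x. P differentiable (at x)"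
    "\<And>z. z \<in> Z \<Longrightarrow> P z = 0" "\<And>z. z \<in> Z \<Longrightarrow> (P has_derivative (\<lambda>d. 0)) (at z)"
    using vanishing_multiplier[OF Z(1,4)] by blast
  let ?u = "zero_off \<Omega> (\<lambda>x. gaussian 1 x * P x)"
  obtain D where "(P has_derivative D) (at x0)" using P(3)[of x0] by (auto simp: differentiable_def)
  note u0 = gauss_multiplier_function[OF P(1) Z(3) this]
  have ne: "?u x0 \<noteq> 0" using u0(2) P(2) gaussian_bounds(1)[of 1 x0] by simp
  have z: "?u z = 0" "(?u has_derivative (\<lambda>d. 0)) (at z)" if "z \<in> Z" for z
    using gauss_multiplier_function[OF P(1) _ P(5)[OF that]] P(4)[OF that] Z(2) that by auto
  have dz: "((\<lambda>x. (1 / ?u x0) * ?u x) has_derivative (\<lambda>d. (1 / ?u x0) * 0)) (at z)" if "z \<in> Z" for z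
    by (intro has_derivative_mult_right z(2) that)
  show ?thesis
  proof (rule that[of "\<lambda>x. (1 / ?u x0) * ?u x"])
    show "(\<lambda>x. (1 / ?u x0) * ?u x) \<in> sobolev \<sigma> \<Omega>" by (intro sobolev_scale u0(1))
    show "frechet_derivative (\<lambda>x. (1 / ?u x0) * ?u x) (at y) d = 0" if "y \<in> Z" for y d
      using frechet_derivative_at[OF dz[OF that]] by (metis mult_zero_right)
  qed (use ne z in auto)
qed

text \<open>
  Another factor \<open>exp (c \<bullet> x) - exp (c \<bullet> x0)\<close> makes the value at \<open>x0\<close> vanish, while the derivative
  along \<open>c\<close> is a nonzero multiple of \<open>c \<bullet> c\<close>.
\<close>

lemma bump_slope:
  assumes Z: "finite Z" "Z \<subseteq> \<Omega>" "x0 \<in> \<Omega>" "x0 \<notin> Z" and c: "c \<noteq> 0"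
  obtains u where "u \<in> sobolev \<sigma> \<Omega>" "u x0 = 0" "frechet_derivative u (at x0) c = 1" "\<And>z. z \<in> Z \<Longrightarrow> u z = 0"
    "\<And>z d. z \<in> Z \<Longrightarrow> frechet_derivative u (at z) d = 0"
proof -
  obtain P where P: "gauss_multiplier P" "P x0 \<noteq> 0" "\<And>x. P differentiable (at x)"
    "\<And>z. z \<in> Z \<Longrightarrow> P z = 0" "\<And>z. z \<in> Z \<Longrightarrow> (P has_derivative (\<lambda>d. 0)) (at z)"
    using vanishing_multiplier[OF Z(1,4)] by blast
  define E where "E = (\<lambda>x. exp (c \<bullet> x) - exp (c \<bullet> x0))"
  have E': "(E has_derivative (\<lambda>d. exp (c \<bullet> x) * (c \<bullet> d))) (at x)" for x
    unfolding E_def by (rule exp_inner_has_derivative)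
  let ?Q = "\<lambda>x. E x * P x"
  have Q: "gauss_multiplier ?Q" unfolding E_def by (intro gauss_multiplier_step P(1))
  let ?u = "zero_off \<Omega> (\<lambda>x. gaussian 1 x * ?Q x)"
  obtain D where D: "(P has_derivative D) (at x0)" using P(3)[of x0] by (auto simp: differentiable_def)
  have "(?Q has_derivative (\<lambda>d. E x0 * D d + exp (c \<bullet> x0) * (c \<bullet> d) * P x0)) (at x0)"
    by (intro has_derivative_mult E' D)
  then have Q0: "(?Q has_derivative (\<lambda>d. exp (c \<bullet> x0) * (c \<bullet> d) * P x0)) (at x0)" by (simp add: E_def)
  have E0: "E x0 = 0" by (simp add: E_def)
  note u0 = gauss_multiplier_function[OF Q Z(3) Q0]
  let ?s = "gaussian 1 x0 * (exp (c \<bullet> x0) * (c \<bullet> c) * P x0)"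
  have s: "?s \<noteq> 0" using c P(2) gaussian_bounds(1)[of 1 x0] by simp
  have du: "(?u has_derivative (\<lambda>d. gaussian 1 x0 * (exp (c \<bullet> x0) * (c \<bullet> d) * P x0))) (at x0)"
    using E0 by (intro u0(3)) simp
  have z: "?u z = 0" "(?u has_derivative (\<lambda>d. 0)) (at z)" if zZ: "z \<in> Z" for z
  proof -
    have "(?Q has_derivative (\<lambda>d. E z * 0 + exp (c \<bullet> z) * (c \<bullet> d) * P z)) (at z)"
      by (intro has_derivative_mult E' P(5) zZ)
    then have "(?Q has_derivative (\<lambda>d. 0)) (at z)" using P(4)[OF zZ] by simp
    note m = gauss_multiplier_function[OF Q _ this]
    show "?u z = 0" "(?u has_derivative (\<lambda>d. 0)) (at z)"
      using m P(4)[OF zZ] Z(2) zZ by auto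
  qed
  have dz: "((\<lambda>x. (1 / ?s) * ?u x) has_derivative (\<lambda>d. (1 / ?s) * 0)) (at z)" if "z \<in> Z" for z
    by (intro has_derivative_mult_right z(2) that)
  have d0: "((\<lambda>x. (1 / ?s) * ?u x) has_derivative (\<lambda>d. (1 / ?s) * (gaussian 1 x0 * (exp (c \<bullet> x0) * (c \<bullet> d) * P x0)))) (at x0)"
    by (intro has_derivative_mult_right du)
  show ?thesis
  proof (rule that[of "\<lambda>x. (1 / ?s) * ?u x"])
    show "(\<lambda>x. (1 / ?s) * ?u x) \<in> sobolev \<sigma> \<Omega>" by (intro sobolev_scale u0(1))
    show "1 / ?s * ?u x0 = 0" using u0(2) E0 by simp
    have "frechet_derivative (\<lambda>x. (1 / ?s) * ?u x) (at x0) c = (1 / ?s) * ?s"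
      using fun_cong[OF frechet_derivative_at[OF d0], of c] by simp
    then show "frechet_derivative (\<lambda>x. (1 / ?s) * ?u x) (at x0) c = 1"
      using s by simp
    show "frechet_derivative (\<lambda>x. (1 / ?s) * ?u x) (at y) d = 0" if "y \<in> Z" for y d
      using frechet_derivative_at[OF dz[OF that]] by (metis mult_zero_right)
    show "1 / ?s * ?u y = 0" if "y \<in> Z" for y using z(1)[OF that] by simp
  qed
qed

text \<open>
  Localise at \<open>x0\<close> by functions that vanish to second order on \<open>Z\<close>. If \<open>f x0 \<noteq> 0\<close>, use one with
  value \<open>0\<close> and derivative \<open>1\<close> along \<open>f x0\<close>, times \<open>C\<close>. At an equilibrium no derivative is seen, but
  there the Lyapunov equation provides the matrix to multiply with.
\<close>

theorem collocation_prescribed: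
  assumes Z: "finite Z" "Z \<subseteq> \<Omega>" "x0 \<in> \<Omega>" "x0 \<notin> Z"
    and eq: "f x0 = 0 \<Longrightarrow> (\<forall>z. complex_eigenvalue (jacobian f (at x0)) z \<longrightarrow> Re z < 0) \<or>
      (\<forall>z. complex_eigenvalue (jacobian f (at x0)) z \<longrightarrow> Re z > 0)"
    and C: "C \<in> sym_matrices"
  obtains M where "M \<in> sobolev_sym \<sigma> \<Omega>" "F_op f x0 M = C" "\<And>z. z \<in> Z \<Longrightarrow> F_op f z M = 0"
proof -
  obtain K where diff: "\<And>u x. u \<in> sobolev \<sigma> \<Omega> \<Longrightarrow> x \<in> \<Omega> \<Longrightarrow> u differentiable (at x)"
    by (rule sobolev_embedding_C1[OF order open_domain]) blast
  have vanish: "F_op f z (\<lambda>x. u x *\<^sub>R A) = 0"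
    if "u \<in> sobolev \<sigma> \<Omega>" "z \<in> Z" "u z = 0" "\<And>d. frechet_derivative u (at z) d = 0" for u A z
    using that Z(2) by (subst F_op_scalar_mult) (auto intro!: diff)
  show ?thesis
  proof (cases "f x0 = 0")
    case True
    obtain A where A: "A \<in> sym_matrices" "transpose (jacobian f (at x0)) ** A + A ** jacobian f (at x0) = C"
      by (rule lyapunov_solvable[OF eq[OF True] C]) blast
    obtain u where u: "u \<in> sobolev \<sigma> \<Omega>" "u x0 = 1" "\<And>z. z \<in> Z \<Longrightarrow> u z = 0"
      "\<And>z d. z \<in> Z \<Longrightarrow> frechet_derivative u (at z) d = 0"
      by (rule bump_value[OF Z]) blast
    have "linear (frechet_derivative u (at x0))"
      by (rule linear_frechet_derivative[OF diff[OF u(1) Z(3)]])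
    then have "frechet_derivative u (at x0) (f x0) = 0" using True by (simp add: linear_0)
    then have "F_op f x0 (\<lambda>x. u x *\<^sub>R A) = C"
      using A(2) u(2) by (subst F_op_scalar_mult[OF diff[OF u(1) Z(3)]]) simp
    then show ?thesis
      using u A(1) vanish by (intro that[of "\<lambda>x. u x *\<^sub>R A"] scalar_times_matrix) auto
  next
    case False
    obtain u where u: "u \<in> sobolev \<sigma> \<Omega>" "u x0 = 0" "frechet_derivative u (at x0) (f x0) = 1" "\<And>z. z \<in> Z \<Longrightarrow> u z = 0"
      "\<And>z d. z \<in> Z \<Longrightarrow> frechet_derivative u (at z) d = 0"
      by (rule bump_slope[OF Z False]) blast
    have "F_op f x0 (\<lambda>x. u x *\<^sub>R C) = C"
      using u(2,3) by (subst F_op_scalar_mult[OF diff[OF u(1) Z(3)]]) simp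
    then show ?thesis
      using u C vanish by (intro that[of "\<lambda>x. u x *\<^sub>R C"] scalar_times_matrix) auto
  qed
qed

end

section \<open>Coordinates of symmetric matrices\<close>

lemma E_unit_entry: "E_unit \<mu> \<nu> $ a $ b = (if a = \<mu> \<and> b = \<nu> then 1 else 0)"
  by (simp add: E_unit_def)

lemma E_sym_symmetric: "E_sym \<mu> \<nu> \<in> sym_matrices"
  by (auto simp: sym_matrices_def transpose_def vec_eq_iff E_sym_def E_unit_def)

lemma inner_E_unit: "B \<bullet> E_unit \<mu> \<nu> = B $ \<mu> $ \<nu>" for B :: "real^'n^'n"
proof -
  have "B \<bullet> E_unit \<mu> \<nu> = (\<Sum>i\<in>UNIV. \<Sum>j\<in>UNIV. if i = \<mu> then if j = \<nu> then B $ i $ j else 0 else 0)"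
    by (auto simp: inner_vec_def E_unit_entry intro!: sum.cong)
  also have "\<dots> = (\<Sum>i\<in>UNIV. if i = \<mu> then \<Sum>j\<in>UNIV. if j = \<nu> then B $ i $ j else 0 else 0)"
    by (intro sum.cong) auto
  finally show ?thesis by simp
qed

text \<open>
  The entry \<open>(a, b)\<close> meets only the basis matrix indexed by the sorted pair.
\<close>

lemma E_sym_sum_entry:
  fixes c :: "'n::{finite,linorder} \<Rightarrow> 'n \<Rightarrow> real"
  shows "(\<Sum>(\<mu>, \<nu>)\<in>{(\<mu>, \<nu>). \<mu> \<le> \<nu>}. c \<mu> \<nu> *\<^sub>R E_sym \<mu> \<nu>) $ a $ b =
    c (min a b) (max a b) * (if a = b then 1 else 1 / sqrt 2)"
proof -
  have "(\<Sum>(\<mu>, \<nu>)\<in>{(\<mu>, \<nu>). \<mu> \<le> \<nu>}. c \<mu> \<nu> *\<^sub>R E_sym \<mu> \<nu>) $ a $ b =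
     (\<Sum>q\<in>{(\<mu>, \<nu>). \<mu> \<le> \<nu>}. if q = (min a b, max a b) then c (min a b) (max a b) * (if a = b then 1 else 1 / sqrt 2) else 0)"
    unfolding sum_component
    by (intro sum.cong refl) (auto simp: E_sym_def E_unit_entry min_def max_def split: if_splits)
  also have "\<dots> = c (min a b) (max a b) * (if a = b then 1 else 1 / sqrt 2)"
    by (subst sum.delta) (auto simp: min_def max_def)
  finally show ?thesis .
qed

text \<open>
  The matrices \<open>E_sym \<mu> \<nu>\<close> with \<open>\<mu> \<le> \<nu>\<close> form an orthonormal basis of the symmetric matrices.
\<close>

lemma sym_matrix_expansion:
  fixes B :: "'n::{finite,linorder} rmatrix"
  assumes "B \<in> sym_matrices"
  shows "(\<Sum>(\<mu>, \<nu>)\<in>{(\<mu>, \<nu>). \<mu> \<le> \<nu>}. (B \<bullet> E_sym \<mu> \<nu>) *\<^sub>R E_sym \<mu> \<nu>) = B"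
proof -
  have B: "B $ i $ j = B $ j $ i" for i j
    using assms by (auto simp: sym_matrices_def transpose_def vec_eq_iff)
  have "(B \<bullet> E_sym (min a b) (max a b)) * (if a = b then 1 else 1 / sqrt 2) = B $ a $ b" for a b
    using B[of a b] by (auto simp: E_sym_def inner_add_right inner_E_unit min_def max_def)
  then show ?thesis unfolding vec_eq_iff E_sym_sum_entry by simp
qed

lemma E_unit_sum_entry:
  fixes g :: "'n::finite \<Rightarrow> 'n \<Rightarrow> real"
  shows "((\<Sum>\<mu>\<in>UNIV. g \<mu> \<mu> *\<^sub>R E_unit \<mu> \<mu>) +
      (1 / 2) *\<^sub>R (\<Sum>(\<mu>, \<nu>)\<in>{(\<mu>, \<nu>). \<mu> \<noteq> \<nu>}. (g \<mu> \<nu> + g \<nu> \<mu>) *\<^sub>R E_unit \<mu> \<nu>)) $ a $ b = (g a b + g b a) / 2"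
proof -
  have "(\<Sum>\<mu>\<in>UNIV. g \<mu> \<mu> *\<^sub>R E_unit \<mu> \<mu>) $ a $ b = (\<Sum>\<mu>\<in>UNIV. if \<mu> = a then if a = b then g a a else 0 else 0)"
    unfolding sum_component by (intro sum.cong refl) (auto simp: E_unit_entry)
  then have 1: "(\<Sum>\<mu>\<in>UNIV. g \<mu> \<mu> *\<^sub>R E_unit \<mu> \<mu>) $ a $ b = (if a = b then g a a else 0)"
    by (simp only: sum.delta finite_class.finite_UNIV UNIV_I if_True)
  have "(\<Sum>(\<mu>, \<nu>)\<in>{(\<mu>, \<nu>). \<mu> \<noteq> \<nu>}. (g \<mu> \<nu> + g \<nu> \<mu>) *\<^sub>R E_unit \<mu> \<nu>) $ a $ b =
     (\<Sum>q\<in>{(\<mu>, \<nu>). \<mu> \<noteq> \<nu>}. if q = (a, b) then g a b + g b a else 0)"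
    unfolding sum_component by (intro sum.cong refl) (auto simp: E_unit_entry split: if_splits)
  also have "\<dots> = (if a = b then 0 else g a b + g b a)"
    by (subst sum.delta) auto
  finally show ?thesis
    unfolding vector_add_component vector_scaleR_component 1 by simp
qed

lemma E_unit_full_sum_entry:
  fixes g :: "'n::finite \<Rightarrow> 'n \<Rightarrow> real"
  shows "(\<Sum>\<mu>\<in>UNIV. \<Sum>\<nu>\<in>UNIV. g \<mu> \<nu> *\<^sub>R E_unit \<mu> \<nu>) $ a $ b = g a b"
proof -
  have "(\<Sum>\<mu>\<in>UNIV. \<Sum>\<nu>\<in>UNIV. g \<mu> \<nu> *\<^sub>R E_unit \<mu> \<nu>) $ a $ b =
     (\<Sum>\<mu>\<in>UNIV. if \<mu> = a then \<Sum>\<nu>\<in>UNIV. if \<nu> = b then g a b else 0 else 0)"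
    unfolding sum_component by (intro sum.cong refl) (auto simp: E_unit_entry mult_delta_right)
  also have "\<dots> = g a b" by simp
  finally show ?thesis .
qed

text \<open>
  Fold the square along the diagonal: an off-diagonal pair is met twice, each time with half of
  the coefficient.
\<close>

lemma sum_over_upper_triangle:
  fixes h :: "'n::{finite,linorder} \<Rightarrow> 'n \<Rightarrow> real"
  assumes "\<And>i j. i < j \<Longrightarrow> \<beta> j i = \<beta> i j \<and> \<beta> i j = \<gamma> i j / 2" "\<And>i. \<beta> i i = \<gamma> i i"
  shows "(\<Sum>i\<in>UNIV. \<Sum>j\<in>UNIV. \<beta> i j * h i j) = (\<Sum>(i, j)\<in>{(i, j). i \<le> j}. \<gamma> i j * ((h i j + h j i) / 2))"
proof -
  let ?F = "\<lambda>i j. \<beta> i j * h i j"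
  have "(\<Sum>i\<in>UNIV. \<Sum>j\<in>UNIV. ?F i j) = (\<Sum>(i, j)\<in>UNIV. ?F i j)"
    by (simp add: sum.cartesian_product)
  also have "(UNIV :: ('n \<times> 'n) set) = {(i, j). i \<le> j} \<union> {(i, j). j < i}" by auto
  also have "(\<Sum>(i, j)\<in>{(i, j). i \<le> j} \<union> {(i, j). j < i}. ?F i j) = (\<Sum>(i, j)\<in>{(i, j). i \<le> j}. ?F i j) + (\<Sum>(i, j)\<in>{(i, j). j < i}. ?F i j)"
    by (intro sum.union_disjoint) auto
  also have "(\<Sum>(i, j)\<in>{(i, j). j < i}. ?F i j) = (\<Sum>(i, j)\<in>{(i, j). i < j}. ?F j i)"
    by (rule sum.reindex_bij_witness[of _ prod.swap prod.swap]) auto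
  also have "\<dots> = (\<Sum>(i, j)\<in>{(i, j). i \<le> j}. if i < j then ?F j i else 0)"
    by (rule sum.mono_neutral_cong_left) (auto split: if_splits)
  also have "(\<Sum>(i, j)\<in>{(i, j). i \<le> j}. ?F i j) + \<dots> = (\<Sum>(i, j)\<in>{(i, j). i \<le> j}. \<gamma> i j * ((h i j + h j i) / 2))"
    unfolding sum.distrib[symmetric]
  proof (intro sum.cong refl)
    fix q assume "q \<in> {(i::'n, j). i \<le> j}"
    then obtain i j where q: "q = (i, j)" "i \<le> j" by auto
    show "(case q of (i, j) \<Rightarrow> ?F i j) + (case q of (i, j) \<Rightarrow> if i < j then ?F j i else 0) = (case q of (i, j) \<Rightarrow> \<gamma> i j * ((h i j + h j i) / 2))"
    proof (cases "i < j")
      case True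
      then have "\<gamma> i j = 2 * \<beta> i j" "\<beta> j i = \<beta> i j" using assms(1)[OF True] by auto
      then show ?thesis using True q by (simp add: distrib_left)
    next
      case False
      then show ?thesis using q assms(2)[of i] by simp
    qed
  qed
  finally show ?thesis .
qed

lemma tensor_slice_entry: "tensor_slice T x \<mu> \<nu> y $ i $ j = T y x i j \<mu> \<nu>"
  by (simp add: tensor_slice_def)

lemma tensor_sum_E_unit:
  "(\<Sum>k\<in>UNIV. \<Sum>l\<in>UNIV. t k l * E_unit \<mu> \<nu> $ k $ l) = (t \<mu> \<nu> :: real)"
  using inner_E_unit[of "\<chi> k l. t k l" \<mu> \<nu>] by (simp add: inner_vec_def)

lemma represented_E_sym:
  assumes "represented_by_tensor \<Omega> \<Phi> T" "x \<in> \<Omega>" "y \<in> \<Omega>"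
  shows "\<Phi> y x (E_sym \<mu> \<nu>) = (if \<mu> = \<nu> then tensor_slice T x \<mu> \<mu> y
    else (1 / sqrt 2) *\<^sub>R (tensor_slice T x \<mu> \<nu> y + tensor_slice T x \<nu> \<mu> y))"
proof -
  have "\<Phi> y x (E_sym \<mu> \<nu>) $ i $ j = (\<Sum>k\<in>UNIV. \<Sum>l\<in>UNIV. T y x i j k l * E_sym \<mu> \<nu> $ k $ l)" for i j
    using assms E_sym_symmetric unfolding represented_by_tensor_def by blast
  moreover have "(\<Sum>k\<in>UNIV. \<Sum>l\<in>UNIV. T y x i j k l * E_sym \<mu> \<nu> $ k $ l) =
     (1 / sqrt 2) * (T y x i j \<mu> \<nu> + T y x i j \<nu> \<mu>)" if "\<mu> \<noteq> \<nu>" for i j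
  proof -
    have "T y x i j k l * E_sym \<mu> \<nu> $ k $ l = (1 / sqrt 2) * (T y x i j k l * E_unit \<mu> \<nu> $ k $ l + T y x i j k l * E_unit \<nu> \<mu> $ k $ l)" for k l
      using that by (simp add: E_sym_def algebra_simps)
    then show ?thesis
      by (simp only: sum_distrib_left[symmetric] sum.distrib tensor_sum_E_unit)
  qed
  moreover have "E_sym \<mu> \<mu> = E_unit \<mu> \<mu>" by (simp add: E_sym_def)
  ultimately have "\<Phi> y x (E_sym \<mu> \<nu>) $ i $ j =
     (if \<mu> = \<nu> then T y x i j \<mu> \<mu> else (1 / sqrt 2) * (T y x i j \<mu> \<nu> + T y x i j \<nu> \<mu>))" for i j
    by (auto simp: tensor_sum_E_unit)
  then show ?thesis
    by (auto simp: vec_eq_iff tensor_slice_entry)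
qed

context sobolev_collocation
begin

text \<open>
  The reproducing property evaluates the Riesz representer \<open>r\<close> of a functional at a point: pairing
  \<open>r\<close> with the kernel section gives the value of \<open>r\<close>, and by symmetry the functional applied to the
  section.
\<close>

lemma kernel_representer:
  assumes \<Phi>: "reproducing_kernel \<Omega> sym_matrices (sobolev_sym \<sigma> \<Omega>) ip \<Phi>" and p: "p \<in> \<Omega>"
    and r: "r \<in> sobolev_sym \<sigma> \<Omega>" "\<And>M. M \<in> sobolev_sym \<sigma> \<Omega> \<Longrightarrow> collocation_functional f p i j M = ip M r"
    and x: "x \<in> \<Omega>" and \<alpha>: "\<alpha> \<in> sym_matrices"
  shows "r x \<bullet> \<alpha> = collocation_functional f p i j (\<lambda>y. \<Phi> y x \<alpha>)"
proof -
  let ?k = "zero_off \<Omega> (\<lambda>y. \<Phi> y x \<alpha>)"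
  have k: "?k \<in> sobolev_sym \<sigma> \<Omega>" and rep: "r x \<bullet> \<alpha> = ip r ?k"
    using \<Phi> x \<alpha> r(1) unfolding reproducing_kernel_def by blast+
  have "F_op f p ?k = F_op f p (\<lambda>y. \<Phi> y x \<alpha>)"
    by (rule F_op_cong[OF open_domain p]) (simp add: zero_off_def)
  then show ?thesis
    using rep r(2)[OF k] ip_commute[OF r(1) k] by (simp add: collocation_functional_entry)
qed

end

lemma kernel_representer_entry:
  fixes \<Omega> :: "'n::{finite,linorder} rvector set"
  assumes "sobolev_collocation \<Omega> \<sigma> ip" "reproducing_kernel \<Omega> sym_matrices (sobolev_sym \<sigma> \<Omega>) ip \<Phi>" "p \<in> \<Omega>"
    and r: "r \<in> sobolev_sym \<sigma> \<Omega>" "\<And>M. M \<in> sobolev_sym \<sigma> \<Omega> \<Longrightarrow> collocation_functional f p i j M = ip M r"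
    and x: "x \<in> \<Omega>"
  shows "(\<Sum>(\<mu>, \<nu>)\<in>{(\<mu>, \<nu>). \<mu> \<le> \<nu>}. collocation_functional f p i j (\<lambda>y. \<Phi> y x (E_sym \<mu> \<nu>)) *\<^sub>R E_sym \<mu> \<nu>) = r x"
proof -
  have "r x \<in> sym_matrices" using r(1) by (auto simp: sobolev_sym_def)
  then show ?thesis
    using sym_matrix_expansion[of "r x"]
    by (simp only: sobolev_collocation.kernel_representer[OF assms(1-3) r x E_sym_symmetric])
qed

text \<open>
  The two factors \<open>1 / sqrt 2\<close>, one from the argument \<open>E_sym \<mu> \<nu>\<close> and one from the coefficient
  matrix, combine to the \<open>1 / 2\<close> in front of the off-diagonal sum.
\<close>

lemma tensor_form_of_representer:
  fixes \<Omega> :: "'n::{finite,linorder} rvector set"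
  assumes \<Omega>: "open \<Omega>" "p \<in> \<Omega>" "x \<in> \<Omega>" and T: "represented_by_tensor \<Omega> \<Phi> T"
    and diff: "\<And>\<mu> \<nu>. entries_differentiable (tensor_slice T x \<mu> \<nu>) p"
  shows "(\<Sum>(\<mu>, \<nu>)\<in>{(\<mu>, \<nu>). \<mu> \<le> \<nu>}. collocation_functional f p i j (\<lambda>y. \<Phi> y x (E_sym \<mu> \<nu>)) *\<^sub>R E_sym \<mu> \<nu>) =
    (\<Sum>\<mu>\<in>UNIV. (F_op f p (tensor_slice T x \<mu> \<mu>) $ i $ j) *\<^sub>R E_unit \<mu> \<mu>) +
    (1 / 2) *\<^sub>R (\<Sum>(\<mu>, \<nu>)\<in>{(\<mu>, \<nu>). \<mu> \<noteq> \<nu>}.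
      (F_op f p (tensor_slice T x \<mu> \<nu>) $ i $ j + F_op f p (tensor_slice T x \<nu> \<mu>) $ i $ j) *\<^sub>R E_unit \<mu> \<nu>)"
proof -
  let ?g = "\<lambda>\<mu> \<nu>. F_op f p (tensor_slice T x \<mu> \<nu>) $ i $ j"
  have F: "F_op f p (\<lambda>y. \<Phi> y x (E_sym \<mu> \<nu>)) = (if \<mu> = \<nu> then F_op f p (tensor_slice T x \<mu> \<mu>)
     else (1 / sqrt 2) *\<^sub>R (F_op f p (tensor_slice T x \<mu> \<nu>) + F_op f p (tensor_slice T x \<nu> \<mu>)))" for \<mu> \<nu>
  proof -
    have "F_op f p (\<lambda>y. \<Phi> y x (E_sym \<mu> \<nu>)) = F_op f p (\<lambda>y. if \<mu> = \<nu> then tensor_slice T x \<mu> \<mu> y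
       else (1 / sqrt 2) *\<^sub>R (tensor_slice T x \<mu> \<nu> y + tensor_slice T x \<nu> \<mu> y))"
      by (rule F_op_cong[OF \<Omega>(1,2)]) (rule represented_E_sym[OF T \<Omega>(3)])
    then show ?thesis
      using F_op_scale[OF entries_differentiable_add[OF diff diff], of f "1 / sqrt 2" \<mu> \<nu> \<nu> \<mu>]
      by (simp add: F_op_add[OF diff diff])
  qed
  have "collocation_functional f p i j (\<lambda>y. \<Phi> y x (E_sym (min a b) (max a b))) * (if a = b then 1 else 1 / sqrt 2) = (?g a b + ?g b a) / 2" for a b
    by (auto simp: collocation_functional_entry F min_def max_def)
  then show ?thesis
    unfolding vec_eq_iff E_sym_sum_entry E_unit_sum_entry[where g = ?g] by simp
qed

section \<open>The optimal recovery\<close>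

lemma triple_sum_entry:
  fixes X :: "'k \<Rightarrow> 'i \<Rightarrow> 'j \<Rightarrow> real^'n^'m"
  shows "(\<Sum>k\<in>K. \<Sum>i\<in>I. \<Sum>j\<in>J. w k i j *\<^sub>R X k i j) $ a $ b = (\<Sum>k\<in>K. \<Sum>i\<in>I. \<Sum>j\<in>J. w k i j * X k i j $ a $ b)"
  by (simp only: sum_component vector_scaleR_component real_scaleR_def)

text \<open>
  The symmetric matrix that is dual to one position of the upper triangle.
\<close>

lemma symmetric_unit:
  fixes i j :: "'n::{finite,linorder}"
  obtains E :: "'n rmatrix" where "E \<in> sym_matrices"
    "\<And>a b. a \<le> b \<Longrightarrow> E $ a $ b = (if a = i \<and> b = j then 1 else 0)"
proof
  let ?E = "(\<chi> a b. if min a b = i \<and> max a b = j then 1 else 0) :: 'n rmatrix"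
  show "?E \<in> sym_matrices"
    by (simp add: sym_matrices_def transpose_def min.commute max.commute)
  show "?E $ a $ b = (if a = i \<and> b = j then 1 else 0)" if "a \<le> b" for a b
    using that by simp
qed

theorem theorem7p2:
  fixes \<Omega> :: "'n::{finite,linorder} rvector set"
    and \<sigma> :: real
    and ip :: "('n rvector \<Rightarrow> 'n rmatrix) \<Rightarrow> ('n rvector \<Rightarrow> 'n rmatrix) \<Rightarrow> real"
    and \<Phi> :: "'n rvector \<Rightarrow> 'n rvector \<Rightarrow> 'n rmatrix \<Rightarrow> 'n rmatrix"
    and T :: "'n rvector \<Rightarrow> 'n rvector \<Rightarrow> 'n \<Rightarrow> 'n \<Rightarrow> 'n \<Rightarrow> 'n \<Rightarrow> real"
    and f :: "'n rvector \<Rightarrow> 'n rvector"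
    and p :: "nat \<Rightarrow> 'n rvector"
    and N :: nat
    and C :: "'n rmatrix"
  assumes domain: "bounded_lipschitz_domain \<Omega>"
    and order: "\<sigma> > real CARD('n) / 2 + 1"
    and kernel: "sobolev_sym_kernel \<sigma> \<Omega> ip \<Phi>"
    and f_C1: "\<forall>x. f differentiable (at x)" "continuous_on UNIV (\<lambda>x. jacobian f (at x))"
    and f_sobolev: "\<forall>i. zero_off \<Omega> (\<lambda>x. f x $ i) \<in> sobolev (\<sigma> - 1) \<Omega>"
    and Df_sobolev: "\<forall>i j. zero_off \<Omega> (\<lambda>x. jacobian f (at x) $ i $ j) \<in> sobolev (\<sigma> - 1) \<Omega>"
    and equilibria:
      "(\<forall>x0\<in>\<Omega>. f x0 = 0 \<longrightarrow> (\<forall>z. complex_eigenvalue (jacobian f (at x0)) z \<longrightarrow> Re z < 0)) \<or>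
       (\<forall>x0\<in>\<Omega>. f x0 = 0 \<longrightarrow> (\<forall>z. complex_eigenvalue (jacobian f (at x0)) z \<longrightarrow> Re z > 0))"
    and points: "p ` {1..N} \<subseteq> \<Omega>" "inj_on p {1..N}"
    and C: "C \<in> sym_matrices" "positive_definite C"
    and tensor: "represented_by_tensor \<Omega> \<Phi> T"
      "\<forall>k\<in>{1..N}. \<forall>x\<in>\<Omega>. \<forall>i j \<mu> \<nu>. (\<lambda>y. T y x i j \<mu> \<nu>) differentiable (at (p k))"
  shows
    "(\<forall>k\<in>{1..N}. \<forall>i j. bounded_functional_on (sobolev_sym \<sigma> \<Omega>) ip (collocation_functional f (p k) i j)) \<and>
     (\<exists>!S. is_norm_minimal f p N C (sobolev_sym \<sigma> \<Omega>) ip S) \<and>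
     (\<forall>S. is_norm_minimal f p N C (sobolev_sym \<sigma> \<Omega>) ip S \<longrightarrow>
       (\<exists>\<gamma> :: nat \<Rightarrow> 'n \<Rightarrow> 'n \<Rightarrow> real.
          (\<forall>x\<in>\<Omega>. S x = kernel_ansatz f p N \<Phi> \<gamma> x) \<and>
          (\<forall>x\<in>\<Omega>. S x =
             (\<Sum>k\<in>{1..N}. \<Sum>(i, j)\<in>{(i, j). i \<le> j}. \<gamma> k i j *\<^sub>R
                ((\<Sum>\<mu>\<in>UNIV. (F_op f (p k) (tensor_slice T x \<mu> \<mu>) $ i $ j) *\<^sub>R E_unit \<mu> \<mu>) +
                 (1 / 2) *\<^sub>R (\<Sum>(\<mu>, \<nu>)\<in>{(\<mu>, \<nu>). \<mu> \<noteq> \<nu>}.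
                   (F_op f (p k) (tensor_slice T x \<mu> \<nu>) $ i $ j +
                    F_op f (p k) (tensor_slice T x \<nu> \<mu>) $ i $ j) *\<^sub>R E_unit \<mu> \<nu>)))) \<and>
          (\<forall>\<gamma>'. satisfies_constraints f p N C (kernel_ansatz f p N \<Phi> \<gamma>') \<longleftrightarrow>
             (\<forall>k\<in>{1..N}. \<forall>i j. i \<le> j \<longrightarrow> \<gamma>' k i j = \<gamma> k i j)) \<and>
          (\<forall>\<phi> ip' \<beta>.
             sobolev_kernel \<sigma> \<Omega> ip' \<phi> \<and>
             (\<forall>x\<in>\<Omega>. \<forall>y\<in>\<Omega>. \<forall>i j k l. T x y i j k l = (if i = k \<and> j = l then \<phi> x y else 0)) \<and>
             (\<forall>k\<in>{1..N}. \<forall>i j. (i < j \<longrightarrow> \<beta> k $ j $ i = \<beta> k $ i $ j \<and> \<beta> k $ i $ j = \<gamma> k i j / 2) \<and>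
                               \<beta> k $ i $ i = \<gamma> k i i) \<longrightarrow>
             (\<forall>x\<in>\<Omega>. S x =
                (\<Sum>k\<in>{1..N}. \<Sum>i\<in>UNIV. \<Sum>j\<in>UNIV. (\<beta> k $ i $ j) *\<^sub>R
                   (\<Sum>\<mu>\<in>UNIV. \<Sum>\<nu>\<in>UNIV. (F_op f (p k) (tensor_slice T x \<mu> \<nu>) $ i $ j) *\<^sub>R E_unit \<mu> \<nu>))))))"

proof -
  define A where "A = {1..N} \<times> {(i::'n, j::'n). i \<le> j}"
  define l where "l = (\<lambda>(k, i, j). collocation_functional f (p k) i j)"
  define t where "t = (\<lambda>(k::nat, i, j). - C $ i $ j)"
  have open_\<Omega>: "open \<Omega>" using domain by (simp add: bounded_lipschitz_domain_def)
  have col: "sobolev_collocation \<Omega> \<sigma> ip"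
    using kernel open_\<Omega> order by (unfold_locales) (auto simp: sobolev_sym_kernel_def)
  then interpret sobolev_collocation \<Omega> \<sigma> ip .
  have rk: "reproducing_kernel \<Omega> sym_matrices (sobolev_sym \<sigma> \<Omega>) ip \<Phi>"
    using kernel by (simp add: sobolev_sym_kernel_def)
  have p: "p k \<in> \<Omega>" if "k \<in> {1..N}" for k using points(1) that by blast
  have finA: "finite A" by (simp add: A_def)
  have bounded: "bounded_functional_on (sobolev_sym \<sigma> \<Omega>) ip (l a)" if "a \<in> A" for a
    using that by (auto simp: A_def l_def intro!: collocation_bounded p)
  have constraints: "satisfies_constraints f p N C M \<longleftrightarrow> (\<forall>a\<in>A. l a M = t a)" for M
    by (auto simp: satisfies_constraints_def A_def l_def t_def)
  have "\<exists>r\<in>sobolev_sym \<sigma> \<Omega>. \<forall>M\<in>sobolev_sym \<sigma> \<Omega>. l a M = ip M r" if "a \<in> A" for a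
    by (rule riesz_representation[OF bounded[OF that]]) blast
  then obtain r where r: "\<And>a. a \<in> A \<Longrightarrow> r a \<in> sobolev_sym \<sigma> \<Omega>"
      "\<And>a M. a \<in> A \<Longrightarrow> M \<in> sobolev_sym \<sigma> \<Omega> \<Longrightarrow> l a M = ip M (r a)"
    by metis
  have dual: "\<exists>B\<in>sobolev_sym \<sigma> \<Omega>. \<forall>a\<in>A. l a B = (if a = b then 1 else 0)" if b: "b \<in> A" for b
  proof -
    obtain k i j where kij: "b = (k, i, j)" "k \<in> {1..N}" "i \<le> j" using b by (auto simp: A_def)
    \<comment> \<open>The functionals only see the upper triangle, where \<open>E\<close> has a single nonzero entry.\<close>
    obtain E :: "'n rmatrix" where E: "E \<in> sym_matrices"
      "\<And>a b. a \<le> b \<Longrightarrow> E $ a $ b = (if a = i \<and> b = j then 1 else 0)"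
      by (rule symmetric_unit[of i j]) blast
    let ?Z = "p ` ({1..N} - {k})"
    have Z1: "finite ?Z" by simp
    have Z2: "?Z \<subseteq> \<Omega>" using points(1) by blast
    have Z3: "p k \<in> \<Omega>" by (rule p[OF kij(2)])
    have Z4: "p k \<notin> ?Z"
    proof
      assume "p k \<in> ?Z"
      then obtain k' where k': "p k = p k'" "k' \<in> {1..N}" "k' \<noteq> k" by blast
      then show False using inj_onD[OF points(2) k'(1) kij(2) k'(2)] by simp
    qed
    have eq: "(\<forall>z. complex_eigenvalue (jacobian f (at (p k))) z \<longrightarrow> Re z < 0) \<or>
        (\<forall>z. complex_eigenvalue (jacobian f (at (p k))) z \<longrightarrow> Re z > 0)" if "f (p k) = 0"
      using equilibria Z3 that by blast
    obtain M where M: "M \<in> sobolev_sym \<sigma> \<Omega>" "F_op f (p k) M = E" "\<And>z. z \<in> ?Z \<Longrightarrow> F_op f z M = 0"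
      by (rule collocation_prescribed[OF Z1 Z2 Z3 Z4 eq E(1)], assumption, rule that)
    have "l a M = (if a = b then 1 else 0)" if "a \<in> A" for a
    proof -
      obtain k' i' j' where a: "a = (k', i', j')" "k' \<in> {1..N}" "i' \<le> j'" using \<open>a \<in> A\<close> by (auto simp: A_def)
      show ?thesis
      proof (cases "k' = k")
        case True
        then have "l a M = E $ i' $ j'" using a M(2) by (simp add: l_def collocation_functional_entry)
        then show ?thesis using E(2)[OF a(3)] True a(1) kij(1) by simp
      next
        case False
        then have "p k' \<in> ?Z" using a(2) by blast
        then show ?thesis using False a kij M(3) by (simp add: l_def collocation_functional_entry)
      qed
    qed
    then show ?thesis using M(1) by blast
  qed
  then obtain B where B: "\<And>b. b \<in> A \<Longrightarrow> B b \<in> sobolev_sym \<sigma> \<Omega>"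
      "\<And>a b. a \<in> A \<Longrightarrow> b \<in> A \<Longrightarrow> l a (B b) = (if a = b then 1 else 0)"
    by metis
  obtain c S0 where S0_def: "S0 = (\<lambda>x. \<Sum>b\<in>A. c b *\<^sub>R r b x)" and S0_in: "S0 \<in> sobolev_sym \<sigma> \<Omega>"
    and S0_eq: "\<And>a. a \<in> A \<Longrightarrow> l a S0 = t a"
    and S0_min: "\<And>M. M \<in> sobolev_sym \<sigma> \<Omega> \<Longrightarrow> (\<And>a. a \<in> A \<Longrightarrow> l a M = t a) \<Longrightarrow> ip S0 S0 \<le> ip M M"
    and S0_unique: "\<And>M. M \<in> sobolev_sym \<sigma> \<Omega> \<Longrightarrow> (\<And>a. a \<in> A \<Longrightarrow> l a M = t a) \<Longrightarrow> ip M M \<le> ip S0 S0 \<Longrightarrow> M = S0"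
    and coeff_unique: "\<And>c' a. (\<And>a. a \<in> A \<Longrightarrow> l a (\<lambda>x. \<Sum>b\<in>A. c' b *\<^sub>R r b x) = t a) \<Longrightarrow> a \<in> A \<Longrightarrow> c' a = c a"
    by (rule minimal_norm_interpolation[OF finA bounded r B, where t = t]) (assumption+, rule that, assumption+, blast+)
  have minimal: "is_norm_minimal f p N C (sobolev_sym \<sigma> \<Omega>) ip S \<longleftrightarrow> S = S0" for S
  proof
    assume "is_norm_minimal f p N C (sobolev_sym \<sigma> \<Omega>) ip S"
    then have S: "S \<in> sobolev_sym \<sigma> \<Omega>" "\<And>a. a \<in> A \<Longrightarrow> l a S = t a"
      and le: "\<And>M. M \<in> sobolev_sym \<sigma> \<Omega> \<Longrightarrow> (\<forall>a\<in>A. l a M = t a) \<Longrightarrow> ip_norm ip S \<le> ip_norm ip M"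
      by (auto simp: is_norm_minimal_def constraints)
    have "ip_norm ip S \<le> ip_norm ip S0" using S0_eq by (intro le S0_in) auto
    then have "ip S S \<le> ip S0 S0" by (simp add: ip_norm_def)
    with S show "S = S0" by (rule S0_unique)
  next
    assume S: "S = S0"
    show "is_norm_minimal f p N C (sobolev_sym \<sigma> \<Omega>) ip S"
      unfolding is_norm_minimal_def constraints S
      using S0_in S0_eq S0_min by (auto simp: ip_norm_def)
  qed
  have rep: "(\<Sum>(\<mu>, \<nu>)\<in>{(\<mu>, \<nu>). \<mu> \<le> \<nu>}. collocation_functional f (p k) i j (\<lambda>y. \<Phi> y x (E_sym \<mu> \<nu>)) *\<^sub>R E_sym \<mu> \<nu>) = r (k, i, j) x"
    if "k \<in> {1..N}" "i \<le> j" "x \<in> \<Omega>" for k i j x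
  proof -
    have a: "(k, i, j) \<in> A" using that by (simp add: A_def)
    show ?thesis
      using r[OF a] that p by (intro kernel_representer_entry[OF col rk]) (auto simp: l_def)
  qed
  have ansatz: "kernel_ansatz f p N \<Phi> \<gamma> x = (\<Sum>b\<in>A. (case b of (k, i, j) \<Rightarrow> \<gamma> k i j) *\<^sub>R r b x)" if x: "x \<in> \<Omega>" for \<gamma> x
  proof -
    have "kernel_ansatz f p N \<Phi> \<gamma> x = (\<Sum>k\<in>{1..N}. \<Sum>(i, j)\<in>{(i, j). i \<le> j}. \<gamma> k i j *\<^sub>R r (k, i, j) x)"
      unfolding kernel_ansatz_def using rep x by (intro sum.cong refl) auto
    also have "\<dots> = (\<Sum>(k, q)\<in>A. case q of (i, j) \<Rightarrow> \<gamma> k i j *\<^sub>R r (k, i, j) x)"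
      unfolding A_def by (rule sum.cartesian_product)
    also have "\<dots> = (\<Sum>b\<in>A. (case b of (k, i, j) \<Rightarrow> \<gamma> k i j) *\<^sub>R r b x)"
      by (intro sum.cong refl) auto
    finally show ?thesis .
  qed
  \<comment> \<open>The ansatz is only controlled on \<open>\<Omega>\<close>, but that is all the functionals see.\<close>
  have ansatz_constraints: "satisfies_constraints f p N C (kernel_ansatz f p N \<Phi> \<gamma>) \<longleftrightarrow>
      (\<forall>a\<in>A. l a (\<lambda>x. \<Sum>b\<in>A. (case b of (k, i, j) \<Rightarrow> \<gamma> k i j) *\<^sub>R r b x) = t a)" for \<gamma>
  proof -
    have "l a (kernel_ansatz f p N \<Phi> \<gamma>) = l a (\<lambda>x. \<Sum>b\<in>A. (case b of (k, i, j) \<Rightarrow> \<gamma> k i j) *\<^sub>R r b x)" if "a \<in> A" for a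
    proof -
      obtain k i j where a: "a = (k, i, j)" "k \<in> {1..N}" using \<open>a \<in> A\<close> by (auto simp: A_def)
      have "F_op f (p k) (kernel_ansatz f p N \<Phi> \<gamma>) = F_op f (p k) (\<lambda>x. \<Sum>b\<in>A. (case b of (k, i, j) \<Rightarrow> \<gamma> k i j) *\<^sub>R r b x)"
        by (rule F_op_cong[OF open_\<Omega> p[OF a(2)]]) (rule ansatz)
      then show ?thesis by (simp add: a l_def collocation_functional_entry)
    qed
    then show ?thesis unfolding constraints by simp
  qed
  define \<gamma> where "\<gamma> = (\<lambda>k i j. c (k, i, j))"
  have \<gamma>_c: "(case b of (k, i, j) \<Rightarrow> \<gamma> k i j) = c b" for b by (simp add: \<gamma>_def split: prod.split)
  have S0_ansatz: "S0 x = kernel_ansatz f p N \<Phi> \<gamma> x" if "x \<in> \<Omega>" for x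
    unfolding ansatz[OF that] \<gamma>_c S0_def ..
  have diff: "entries_differentiable (tensor_slice T x \<mu> \<nu>) (p k)" if "k \<in> {1..N}" "x \<in> \<Omega>" for k x \<mu> \<nu>
    using tensor(2) that unfolding entries_differentiable_def tensor_slice_entry by blast
  let ?tens = "\<lambda>k i j x. (\<Sum>\<mu>\<in>UNIV. (F_op f (p k) (tensor_slice T x \<mu> \<mu>) $ i $ j) *\<^sub>R E_unit \<mu> \<mu>) +
         (1 / 2) *\<^sub>R (\<Sum>(\<mu>, \<nu>)\<in>{(\<mu>, \<nu>). \<mu> \<noteq> \<nu>}.
           (F_op f (p k) (tensor_slice T x \<mu> \<nu>) $ i $ j +
            F_op f (p k) (tensor_slice T x \<nu> \<mu>) $ i $ j) *\<^sub>R E_unit \<mu> \<nu>)"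
  have S0_tensor: "S0 x = (\<Sum>k\<in>{1..N}. \<Sum>(i, j)\<in>{(i, j). i \<le> j}. \<gamma> k i j *\<^sub>R ?tens k i j x)" if x: "x \<in> \<Omega>" for x
    unfolding S0_ansatz[OF x] kernel_ansatz_def
    using tensor_form_of_representer[OF open_\<Omega> p x tensor(1) diff[OF _ x]]
    by (intro sum.cong refl) auto
  have coeffs: "satisfies_constraints f p N C (kernel_ansatz f p N \<Phi> \<gamma>') \<longleftrightarrow>
      (\<forall>k\<in>{1..N}. \<forall>i j. i \<le> j \<longrightarrow> \<gamma>' k i j = \<gamma> k i j)" for \<gamma>'
  proof
    assume "satisfies_constraints f p N C (kernel_ansatz f p N \<Phi> \<gamma>')"
    then have "(case a of (k, i, j) \<Rightarrow> \<gamma>' k i j) = c a" if "a \<in> A" for a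
      unfolding ansatz_constraints using that by (intro coeff_unique) blast+
    then have "(case (k, i, j) of (k, i, j) \<Rightarrow> \<gamma>' k i j) = c (k, i, j)" if "k \<in> {1..N}" "i \<le> j" for k i j
      using that unfolding A_def by blast
    then show "\<forall>k\<in>{1..N}. \<forall>i j. i \<le> j \<longrightarrow> \<gamma>' k i j = \<gamma> k i j" by (simp add: \<gamma>_def)
  next
    assume "\<forall>k\<in>{1..N}. \<forall>i j. i \<le> j \<longrightarrow> \<gamma>' k i j = \<gamma> k i j"
    then have "(\<Sum>b\<in>A. (case b of (k, i, j) \<Rightarrow> \<gamma>' k i j) *\<^sub>R r b x) = (\<Sum>b\<in>A. c b *\<^sub>R r b x)" for x
      by (intro sum.cong refl) (auto simp: A_def \<gamma>_def)
    then show "satisfies_constraints f p N C (kernel_ansatz f p N \<Phi> \<gamma>')"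
      unfolding ansatz_constraints using S0_eq[unfolded S0_def] by simp
  qed
  have diagonal: "S0 x = (\<Sum>k\<in>{1..N}. \<Sum>i\<in>UNIV. \<Sum>j\<in>UNIV. (\<beta> k $ i $ j) *\<^sub>R
      (\<Sum>\<mu>\<in>UNIV. \<Sum>\<nu>\<in>UNIV. (F_op f (p k) (tensor_slice T x \<mu> \<nu>) $ i $ j) *\<^sub>R E_unit \<mu> \<nu>))"
    if T: "\<forall>x\<in>\<Omega>. \<forall>y\<in>\<Omega>. \<forall>i j k l. T x y i j k l = (if i = k \<and> j = l then \<phi> x y else 0)"
      and \<beta>: "\<forall>k\<in>{1..N}. \<forall>i j. (i < j \<longrightarrow> \<beta> k $ j $ i = \<beta> k $ i $ j \<and> \<beta> k $ i $ j = \<gamma> k i j / 2) \<and> \<beta> k $ i $ i = \<gamma> k i i"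
      and x: "x \<in> \<Omega>" for \<phi> :: "'n rvector \<Rightarrow> 'n rvector \<Rightarrow> real" and \<beta> :: "nat \<Rightarrow> 'n rmatrix" and x
  proof -
    let ?F = "\<lambda>k \<mu> \<nu>. F_op f (p k) (tensor_slice T x \<mu> \<nu>)"
    \<comment> \<open>For a diagonal kernel, exchanging \<open>\<mu>\<close> and \<open>\<nu>\<close> transposes the slice, and \<open>F_op\<close> commutes with transposition.\<close>
    have tr: "?F k \<nu> \<mu> $ i $ j = ?F k \<mu> \<nu> $ j $ i"
      if k: "k \<in> {1..N}" for k \<mu> \<nu> i j
    proof -
      have "?F k \<nu> \<mu> = F_op f (p k) (\<lambda>y. transpose (tensor_slice T x \<mu> \<nu> y))"
      proof (rule F_op_cong[OF open_\<Omega> p[OF k]])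
        fix y assume "y \<in> \<Omega>"
        then show "tensor_slice T x \<nu> \<mu> y = transpose (tensor_slice T x \<mu> \<nu> y)"
          using T x by (auto simp: vec_eq_iff transpose_def tensor_slice_entry)
      qed
      then show ?thesis by (simp add: F_op_transpose) (simp add: transpose_def)
    qed
    have "S0 x $ a $ b = (\<Sum>k\<in>{1..N}. \<Sum>i\<in>UNIV. \<Sum>j\<in>UNIV. \<beta> k $ i $ j * ?F k a b $ i $ j)" for a b
    proof -
      have "S0 x $ a $ b = (\<Sum>k\<in>{1..N}. \<Sum>(i, j)\<in>{(i, j). i \<le> j}. \<gamma> k i j *
          ((?F k a b $ i $ j + ?F k b a $ i $ j) / 2))"
        unfolding S0_tensor[OF x] sum_component
      proof (intro sum.cong refl)
        fix k q assume "q \<in> {(i::'n, j). i \<le> j}"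
        then obtain i j where q: "q = (i, j)" by force
        show "(case q of (i, j) \<Rightarrow> \<gamma> k i j *\<^sub>R ?tens k i j x) $ a $ b =
           (case q of (i, j) \<Rightarrow> \<gamma> k i j * ((?F k a b $ i $ j + ?F k b a $ i $ j) / 2))"
          unfolding q prod.case vector_scaleR_component real_scaleR_def
            E_unit_sum_entry[where g = "\<lambda>\<mu> \<nu>. ?F k \<mu> \<nu> $ i $ j"] ..
      qed
      also have "\<dots> = (\<Sum>k\<in>{1..N}. \<Sum>i\<in>UNIV. \<Sum>j\<in>UNIV. \<beta> k $ i $ j * ?F k a b $ i $ j)"
      proof (rule sum.cong[OF refl])
        fix k assume k: "k \<in> {1..N}"
        have "(\<Sum>i\<in>UNIV. \<Sum>j\<in>UNIV. \<beta> k $ i $ j * ?F k a b $ i $ j) =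
           (\<Sum>(i, j)\<in>{(i, j). i \<le> j}. \<gamma> k i j * ((?F k a b $ i $ j + ?F k a b $ j $ i) / 2))"
          using \<beta> k by (intro sum_over_upper_triangle) blast+
        then show "(\<Sum>(i, j)\<in>{(i, j). i \<le> j}. \<gamma> k i j *
          ((?F k a b $ i $ j + ?F k b a $ i $ j) / 2)) =
          (\<Sum>i\<in>UNIV. \<Sum>j\<in>UNIV. \<beta> k $ i $ j * ?F k a b $ i $ j)"
          unfolding tr[OF k, of a b] by (rule sym)
      qed
      finally show ?thesis .
    qed
    then show ?thesis
      unfolding vec_eq_iff triple_sum_entry E_unit_full_sum_entry by blast
  qed
  show ?thesis
    unfolding minimal
  proof (intro conjI)
    show "\<forall>k\<in>{1..N}. \<forall>i j. bounded_functional_on (sobolev_sym \<sigma> \<Omega>) ip (collocation_functional f (p k) i j)"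
      by (intro ballI allI collocation_bounded p)
    show "\<exists>!S. S = S0" by simp
  qed (intro allI impI, erule ssubst, intro exI[of _ \<gamma>] conjI ballI allI impI,
      erule S0_ansatz, erule S0_tensor, rule coeffs, elim conjE, rule diagonal, assumption+)
qed

end
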